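(* For every loopless matroid $M$, the palindromic polynomials $\underline{H}_M(x)$ and $H_M(x)$ are $\gamma$-positive.
   Context: A polynomial $f(x)\in\mathbb{Z}[x]$ of degree $d$ with $f(x)=x^df(x^{-1})$ can be uniquely written as $f(x)=\sum_{i=0}^{\lfloor d/2\rfloor}\gamma_i x^i(1+x)^{d-2i}$ with $\gamma_i\in\mathbb{Z}$; $f$ is $\gamma$-positive if all $\gamma_i\ge0$. For a loopless matroid $M$ on $E$ (every singleton of rank $1$) with lattice of flats $\mathcal{L}(M)$: $\underline{\mathrm{CH}}(M)=\mathbb{Q}[x_F: F\in\mathcal{L}(M)\setminus\{\varnothing,E\}]/(I+J)$, $I$ generated by $x_{F_1}x_{F_2}$ for incomparable $F_1,F_2$, $J$ by $\sum_{F\ni i}x_F-\sum_{F\ni j}x_F$ for $i,j\in E$; and $\mathrm{CH}(M)=\mathbb{Q}[x_F,y_i: F\in\mathcal{L}(M)\setminus\{E\},\, i\in E]/(I'+J')$, $I'$ generated by $y_i-\sum_{F\not\ni i}x_F$, $J'$ by $x_{F_1}x_{F_2}$ for incomparable $F_1,F_2$ and $y_ix_F$ for $i\notin F$. All variables of degree $1$; $\underline{H}_M(x)=\sum_j\dim_{\mathbb{Q}}\underline{\mathrm{CH}}^j(M)x^j$ and $H_M(x)=\sum_j\dim_{\mathbb{Q}}\mathrm{CH}^j(M)x^j$; these are palindromic (of degrees $\mathrm{rk}(M)-1$ for $\mathrm{rk}(M)>0$, and $\mathrm{rk}(M)$, respectively). *)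

theory Defs
  imports "HOL-Library.Poly_Mapping" "HOL-Computational_Algebra.Polynomial"
begin

type_synonym 'v mpoly = "('v \<Rightarrow>\<^sub>0 nat) \<Rightarrow>\<^sub>0 rat"

definition Var :: "'v \<Rightarrow> 'v mpoly" where
  "Var v = Poly_Mapping.single (Poly_Mapping.single v 1) 1"

definition Const :: "rat \<Rightarrow> 'v mpoly" where
  "Const c = Poly_Mapping.single 0 c"

definition mdeg :: "('v \<Rightarrow>\<^sub>0 nat) \<Rightarrow> nat" where
  "mdeg m = (\<Sum>v\<in>Poly_Mapping.keys m. Poly_Mapping.lookup m v)"

definition homog_in :: "'v set \<Rightarrow> nat \<Rightarrow> 'v mpoly \<Rightarrow> bool" where
  "homog_in VS j p \<longleftrightarrow> (\<forall>m\<in>Poly_Mapping.keys p. mdeg m = j \<and> Poly_Mapping.keys m \<subseteq> VS)"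

definition ideal_gen :: "'v mpoly set \<Rightarrow> 'v mpoly set" where
  "ideal_gen G = {(\<Sum>g\<in>F. q g * g) | F q. finite F \<and> F \<subseteq> G}"

text \<open>Dimension over Q of the degree-j part of Q[VS]/(G), for G a set of homogeneous
  generators: the maximal number of degree-j homogeneous polynomials which are
  linearly independent modulo the ideal.\<close>
definition quot_dim :: "'v set \<Rightarrow> 'v mpoly set \<Rightarrow> nat \<Rightarrow> nat" where
  "quot_dim VS G j = (GREATEST n. \<exists>ps :: nat \<Rightarrow> 'v mpoly.
      (\<forall>i<n. homog_in VS j (ps i)) \<and>
      (\<forall>c :: nat \<Rightarrow> rat. (\<Sum>i<n. Const (c i) * ps i) \<in> ideal_gen G \<longrightarrow> (\<forall>i<n. c i = 0)))"

definition matroid :: "'a set \<Rightarrow> ('a set \<Rightarrow> nat) \<Rightarrow> bool" where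
  "matroid E rk \<longleftrightarrow> finite E \<and>
     (\<forall>A. A \<subseteq> E \<longrightarrow> rk A \<le> card A) \<and>
     (\<forall>A B. A \<subseteq> B \<longrightarrow> B \<subseteq> E \<longrightarrow> rk A \<le> rk B) \<and>
     (\<forall>A B. A \<subseteq> E \<longrightarrow> B \<subseteq> E \<longrightarrow> rk (A \<union> B) + rk (A \<inter> B) \<le> rk A + rk B)"

definition loopless :: "'a set \<Rightarrow> ('a set \<Rightarrow> nat) \<Rightarrow> bool" where
  "loopless E rk \<longleftrightarrow> (\<forall>i\<in>E. rk {i} = 1)"

definition flats :: "'a set \<Rightarrow> ('a set \<Rightarrow> nat) \<Rightarrow> 'a set set" where
  "flats E rk = {F. F \<subseteq> E \<and> (\<forall>e\<in>E - F. rk F < rk (insert e F))}"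

definition uCH_vars :: "'a set \<Rightarrow> ('a set \<Rightarrow> nat) \<Rightarrow> 'a set set" where
  "uCH_vars E rk = flats E rk - {{}, E}"

definition uCH_rels :: "'a set \<Rightarrow> ('a set \<Rightarrow> nat) \<Rightarrow> 'a set mpoly set" where
  "uCH_rels E rk =
     {Var F1 * Var F2 | F1 F2. F1 \<in> uCH_vars E rk \<and> F2 \<in> uCH_vars E rk \<and>
                               \<not> F1 \<subseteq> F2 \<and> \<not> F2 \<subseteq> F1}
   \<union> {(\<Sum>F\<in>{F\<in>uCH_vars E rk. i \<in> F}. Var F) - (\<Sum>F\<in>{F\<in>uCH_vars E rk. j \<in> F}. Var F)
       | i j. i \<in> E \<and> j \<in> E}"

definition uH_coeff :: "'a set \<Rightarrow> ('a set \<Rightarrow> nat) \<Rightarrow> nat \<Rightarrow> nat" where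
  "uH_coeff E rk j = quot_dim (uCH_vars E rk) (uCH_rels E rk) j"

text \<open>Augmented Chow ring: Inl F stands for x_F, Inr i for y_i.\<close>
definition CH_vars :: "'a set \<Rightarrow> ('a set \<Rightarrow> nat) \<Rightarrow> ('a set + 'a) set" where
  "CH_vars E rk = Inl ` (flats E rk - {E}) \<union> Inr ` E"

definition CH_rels :: "'a set \<Rightarrow> ('a set \<Rightarrow> nat) \<Rightarrow> ('a set + 'a) mpoly set" where
  "CH_rels E rk =
     {Var (Inr i) - (\<Sum>F\<in>{F\<in>flats E rk - {E}. i \<notin> F}. Var (Inl F)) | i. i \<in> E}
   \<union> {Var (Inl F1) * Var (Inl F2) | F1 F2. F1 \<in> flats E rk - {E} \<and> F2 \<in> flats E rk - {E} \<and>
                               \<not> F1 \<subseteq> F2 \<and> \<not> F2 \<subseteq> F1}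
   \<union> {Var (Inr i) * Var (Inl F) | i F. i \<in> E \<and> F \<in> flats E rk - {E} \<and> i \<notin> F}"

definition H_coeff :: "'a set \<Rightarrow> ('a set \<Rightarrow> nat) \<Rightarrow> nat \<Rightarrow> nat" where
  "H_coeff E rk j = quot_dim (CH_vars E rk) (CH_rels E rk) j"

definition gamma_positive :: "int poly \<Rightarrow> bool" where
  "gamma_positive f \<longleftrightarrow> (\<exists>\<gamma> :: nat \<Rightarrow> int. (\<forall>i. 0 \<le> \<gamma> i) \<and>
     f = (\<Sum>i\<le>degree f div 2. smult (\<gamma> i) ([:0, 1:] ^ i * [:1, 1:] ^ (degree f - 2 * i))))"

end

theory Submission
  imports Defs
begin

text \<open>Both Chow rings are treated at once: with \<open>c = 0\<close> for the Chow ring and \<open>c = 1\<close> for the augmented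
  one, put \<open>\<rho> F = rk F + c\<close>, let \<open>F\<close> range over the flats with \<open>\<rho> F \<ge> 1\<close>, and eliminate the \<open>y_i\<close> by
  setting \<open>x_E = - (\<Sum>F \<noteq> E. x_F)\<close> or its analogue. The relations imply
  \<open>x_F * (\<Sum>H \<supseteq> G. x_H) ^ (\<rho> G - \<rho> F) = 0\<close> for \<open>F \<subset> G\<close>, so the monomials
  \<open>\<Prod>x_(F_i) ^ a_i\<close> over chains with \<open>1 \<le> a_i < \<rho> F_i - \<rho> F_(i-1)\<close> span. They are independent because
  multiplication by the complementary monomials \<open>\<Prod>x_(F_i) ^ (\<rho> F_i - \<rho> F_(i-1) - a_i)\<close>, completed by
  powers of \<open>x_E\<close>, gives a matrix in the top degree that is triangular with respect to the sum of
  ranks, with diagonal entries \<open>\<plusminus> x_E ^ (\<rho> E - 1)\<close>; the latter is nonzero since a degree map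
  exists.

  The resulting Hilbert series satisfy \<open>h F = 1 + (\<Sum>G \<supset> F. (x + \<dots> + x ^ (rk G - rk F - 1)) * h G)\<close>.
  Label a covering \<open>F \<subset> G\<close> by the least element of \<open>G - F\<close>. Every interval of flats has a unique
  increasing maximal chain, which turns the recursion into a sum over maximal chains without
  double descents, each contributing \<open>x ^ k * (1 + x) ^ (n - 2 * k)\<close> with \<open>k\<close> its number of
  descents.\<close>

section \<open>Flats of a matroid\<close>

text \<open>The obstacle is non-vanishing: manipulating relations produces spanning sets, while
  independence needs an element known to lie outside the ideal. All of it is reduced to one such
  element, x_E ^ (rho E - 1), and that one is settled by a linear functional on a second polynomial
  ring with variables h_F. There the value on a monomial is 0 or 1 by definition, so compatibility
  with the relations becomes the cancellation of a few truth values, which submodularity of the rank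
  provides; x_F is recovered from the h_F by Moebius inversion.

  The gamma-expansion rests on one identity: b n = x + ... + x ^ (n - 1) satisfies b (n + 1) = (1 +
  x) * b n - x * b (n - 1) for n >= 2. Sums over labelled chains are carried by two functions of a
  flat and a last label, one of them with a pending factor; a step without descent turns this factor
  into 1 + x, and a descent merges it with its own into a single x.\<close>

locale loopless_matroid =
  fixes E :: "'a set" and rk :: "'a set \<Rightarrow> nat"
  assumes matroid: "matroid E rk" and loopless: "loopless E rk"
begin

lemma finite_ground: "finite E"
  using matroid by (simp add: matroid_def)

lemma rk_le_card: "A \<subseteq> E \<Longrightarrow> rk A \<le> card A"
  using matroid by (simp add: matroid_def)

lemma rk_mono: "A \<subseteq> B \<Longrightarrow> B \<subseteq> E \<Longrightarrow> rk A \<le> rk B"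
  using matroid by (simp add: matroid_def)

lemma rk_submodular: "A \<subseteq> E \<Longrightarrow> B \<subseteq> E \<Longrightarrow> rk (A \<union> B) + rk (A \<inter> B) \<le> rk A + rk B"
  using matroid by (simp add: matroid_def)

lemma rk_empty: "rk {} = 0"
  using rk_le_card[of "{}"] by simp

lemma rk_singleton: "i \<in> E \<Longrightarrow> rk {i} = 1"
  using loopless by (simp add: loopless_def)

lemma rk_insert_le: "A \<subseteq> E \<Longrightarrow> e \<in> E \<Longrightarrow> rk (insert e A) \<le> rk A + 1"
  using rk_submodular[of A "{e}"] rk_le_card[of "{e}"] by auto

definition cl :: "'a set \<Rightarrow> 'a set" where
  "cl A = {e \<in> E. rk (insert e A) = rk A}"

abbreviation "L \<equiv> flats E rk"

lemma cl_subset: "cl A \<subseteq> E"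
  by (auto simp: cl_def)

lemma subset_cl: "A \<subseteq> E \<Longrightarrow> A \<subseteq> cl A"
  by (auto simp: cl_def insert_absorb)

lemma rk_union_cl:
  assumes "A \<subseteq> E" "S \<subseteq> cl A"
  shows "rk (A \<union> S) = rk A"
proof -
  have "finite S" using assms(2) cl_subset finite_ground by (meson finite_subset)
  then show ?thesis using assms(2)
  proof (induction S rule: finite_induct)
    case (insert x S)
    then have x: "x \<in> E" "rk (insert x A) = rk A" and S: "S \<subseteq> E" "rk (A \<union> S) = rk A"
      using cl_subset by (auto simp: cl_def)
    have "rk ((A \<union> S) \<union> insert x A) + rk ((A \<union> S) \<inter> insert x A) \<le> rk (A \<union> S) + rk (insert x A)"
      using x S assms by (intro rk_submodular) auto
    moreover have "rk A \<le> rk ((A \<union> S) \<inter> insert x A)"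
      using x S assms by (intro rk_mono) auto
    moreover have "rk A \<le> rk ((A \<union> S) \<union> insert x A)"
      using x S assms by (intro rk_mono) auto
    moreover have "(A \<union> S) \<union> insert x A = A \<union> insert x S" by auto
    ultimately show ?case using x S by simp
  qed simp
qed

lemma rk_cl: "A \<subseteq> E \<Longrightarrow> rk (cl A) = rk A"
  using rk_union_cl[of A "cl A"] subset_cl[of A] by (simp add: Un_absorb1)

lemma flat_subset: "F \<in> L \<Longrightarrow> F \<subseteq> E"
  by (simp add: flats_def)

lemma finite_flats: "finite L"
  by (rule finite_subset[of _ "Pow E"]) (auto simp: flats_def finite_ground)

lemma cl_flat: "A \<subseteq> E \<Longrightarrow> cl A \<in> L"
proof -
  assume A: "A \<subseteq> E"
  { fix e assume e: "e \<in> E - cl A"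
    then have "rk A < rk (insert e A)"
      using rk_mono[of A "insert e A"] A by (auto simp: cl_def order_less_le)
    also have "\<dots> \<le> rk (insert e (cl A))"
      using e A subset_cl[OF A] cl_subset by (intro rk_mono) auto
    finally have "rk (cl A) < rk (insert e (cl A))" by (simp add: rk_cl A) }
  then show ?thesis by (auto simp: flats_def cl_subset)
qed

lemma flat_insert: "F \<in> L \<Longrightarrow> e \<in> E \<Longrightarrow> e \<notin> F \<Longrightarrow> rk (insert e F) = rk F + 1"
  using rk_insert_le[of F e] unfolding flats_def by (metis (no_types, lifting) DiffI Suc_eq_plus1 Suc_leI le_antisym mem_Collect_eq)

text \<open>An \<open>e\<close> that adds nothing to the rank of \<open>A\<close> adds, by
  submodularity, nothing to the rank of a larger set, so a flat containing \<open>A\<close> already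
  contains \<open>e\<close>.\<close>

lemma cl_least:
  assumes "A \<subseteq> F" "F \<in> L" shows "cl A \<subseteq> F"
proof (rule ccontr)
  assume "\<not> cl A \<subseteq> F"
  then obtain e where e: "e \<in> cl A" "e \<notin> F" by auto
  have F: "F \<subseteq> E" using assms flat_subset by auto
  have eE: "e \<in> E" "rk (insert e A) = rk A" using e by (auto simp: cl_def)
  have "rk (F \<union> insert e A) + rk (F \<inter> insert e A) \<le> rk F + rk (insert e A)"
    using F assms eE by (intro rk_submodular) auto
  moreover have "F \<union> insert e A = insert e F" "F \<inter> insert e A = A" using assms e by auto
  ultimately show False using flat_insert[OF assms(2) eE(1) e(2)] eE by simp
qed

lemma ground_flat: "E \<in> L"
  by (simp add: flats_def)

lemma empty_flat: "{} \<in> L"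
  by (auto simp: flats_def rk_empty rk_singleton)

lemma flat_inter:
  assumes "F \<in> L" "G \<in> L" shows "F \<inter> G \<in> L"
proof -
  have "cl (F \<inter> G) \<subseteq> F \<inter> G" using cl_least assms by (metis inf_le1 inf_le2 le_inf_iff)
  moreover have "F \<inter> G \<subseteq> E" using assms flat_subset by auto
  ultimately show ?thesis using cl_flat subset_cl by (metis subset_antisym)
qed

lemma flat_strict_mono:
  assumes "F \<in> L" "G \<in> L" "F \<subset> G" shows "rk F < rk G"
proof -
  obtain e where e: "e \<in> G" "e \<notin> F" using assms by auto
  then have "rk (insert e F) \<le> rk G" using assms flat_subset by (intro rk_mono) auto
  then show ?thesis using flat_insert[of F e] assms e flat_subset by force
qed

lemma flat_mono: "G \<in> L \<Longrightarrow> F \<subseteq> G \<Longrightarrow> rk F \<le> rk G"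
  using flat_subset rk_mono by auto

lemma flat_rk_0: "F \<in> L \<Longrightarrow> rk F = 0 \<longleftrightarrow> F = {}"
  using flat_strict_mono[OF empty_flat, of F] rk_empty by (metis empty_subsetI less_irrefl psubsetI)

definition join :: "'a set \<Rightarrow> 'a set \<Rightarrow> 'a set" where
  "join F G = cl (F \<union> G)"

lemma join_flat: "F \<in> L \<Longrightarrow> G \<in> L \<Longrightarrow> join F G \<in> L"
  unfolding join_def using flat_subset by (intro cl_flat) auto

lemma join_subset_iff: "F \<in> L \<Longrightarrow> G \<in> L \<Longrightarrow> U \<in> L \<Longrightarrow> join F G \<subseteq> U \<longleftrightarrow> F \<subseteq> U \<and> G \<subseteq> U"
  unfolding join_def using cl_least[of "F \<union> G" U] subset_cl[of "F \<union> G"] flat_subset by (metis Un_subset_iff subset_trans)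

lemma join_upper: "F \<in> L \<Longrightarrow> G \<in> L \<Longrightarrow> F \<subseteq> join F G" "F \<in> L \<Longrightarrow> G \<in> L \<Longrightarrow> G \<subseteq> join F G"
  using join_subset_iff[of F G "join F G"] join_flat by auto

lemma rk_join: "F \<in> L \<Longrightarrow> G \<in> L \<Longrightarrow> rk (join F G) + rk (F \<inter> G) \<le> rk F + rk G"
  unfolding join_def using rk_submodular[of F G] rk_cl[of "F \<union> G"] flat_subset by auto

lemma cl_insert_flat:
  assumes "F \<in> L" "e \<in> E" "e \<notin> F"
  shows "cl (insert e F) \<in> L" "rk (cl (insert e F)) = rk F + 1" "F \<subset> cl (insert e F)"
    "e \<in> cl (insert e F)"
proof -
  have sub: "insert e F \<subseteq> E" using assms flat_subset by auto
  show "cl (insert e F) \<in> L" "rk (cl (insert e F)) = rk F + 1"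
    using cl_flat[OF sub] rk_cl[OF sub] flat_insert assms by auto
  show "F \<subset> cl (insert e F)" "e \<in> cl (insert e F)" using subset_cl[OF sub] assms by auto
qed

lemma cl_singleton_subset_iff: "i \<in> E \<Longrightarrow> F \<in> L \<Longrightarrow> cl {i} \<subseteq> F \<longleftrightarrow> i \<in> F"
  using subset_cl[of "{i}"] cl_least[of "{i}" F] by auto

lemma flat_rk_1E:
  assumes "F \<in> L" "rk F = 1"
  obtains i where "i \<in> E" "F = cl {i}"
proof -
  obtain i where i: "i \<in> F" using assms rk_empty by (cases "F = {}") auto
  then have iE: "i \<in> E" using assms flat_subset by auto
  then have "cl {i} \<in> L" "rk (cl {i}) = 1" "cl {i} \<subseteq> F"
    using cl_flat[of "{i}"] rk_cl[of "{i}"] rk_singleton i cl_least[of "{i}"] assms by auto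
  then have "F = cl {i}" using flat_strict_mono[of "cl {i}" F] assms by (auto simp: psubset_eq)
  then show ?thesis using that iE by auto
qed

lemma rk_atom: "i \<in> E \<Longrightarrow> rk (cl {i}) = 1" "i \<in> E \<Longrightarrow> cl {i} \<in> L"
  using rk_cl[of "{i}"] rk_singleton cl_flat[of "{i}"] by auto

end

section \<open>Gamma-positivity of the chain recursion\<close>

text \<open>The length \<open>n\<close> is a parameter instead of \<open>degree f\<close>, so that 0
  qualifies and sums stay inside. The condition on \<open>2 * i\<close> discards the indices at
  which the truncated \<open>n - 2 * i\<close> would leave a stray power of x.\<close>

definition gamma_nonneg :: "nat \<Rightarrow> int poly \<Rightarrow> bool" where
  "gamma_nonneg n f \<longleftrightarrow> (\<exists>\<gamma> :: nat \<Rightarrow> int. (\<forall>i. 0 \<le> \<gamma> i) \<and> (\<forall>i. n < 2 * i \<longrightarrow> \<gamma> i = 0) \<and>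
     f = (\<Sum>i\<le>n. smult (\<gamma> i) ([:0, 1:] ^ i * [:1, 1:] ^ (n - 2 * i))))"

lemma gamma_nonneg_0: "gamma_nonneg n 0"
  unfolding gamma_nonneg_def by (intro exI[of _ "\<lambda>_. 0"]) auto

lemma gamma_nonneg_1: "gamma_nonneg 0 1"
  unfolding gamma_nonneg_def by (intro exI[of _ "\<lambda>i. if i = 0 then 1 else 0"]) auto

lemma gamma_nonneg_add:
  assumes "gamma_nonneg n f" "gamma_nonneg n g" shows "gamma_nonneg n (f + g)"
proof -
  obtain \<gamma> \<gamma>' where "\<forall>i. 0 \<le> \<gamma> i" "\<forall>i. n < 2 * i \<longrightarrow> \<gamma> i = 0"
     "f = (\<Sum>i\<le>n. smult (\<gamma> i) ([:0, 1:] ^ i * [:1, 1:] ^ (n - 2 * i)))"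
     "\<forall>i. 0 \<le> \<gamma>' i" "\<forall>i. n < 2 * i \<longrightarrow> \<gamma>' i = 0"
     "g = (\<Sum>i\<le>n. smult (\<gamma>' i) ([:0, 1:] ^ i * [:1, 1:] ^ (n - 2 * i)))"
    using assms unfolding gamma_nonneg_def by blast
  then show ?thesis unfolding gamma_nonneg_def
    by (intro exI[of _ "\<lambda>i. \<gamma> i + \<gamma>' i"]) (auto simp: sum.distrib smult_add_left)
qed

lemma gamma_nonneg_sum: "(\<And>i. i \<in> A \<Longrightarrow> gamma_nonneg n (f i)) \<Longrightarrow> gamma_nonneg n (\<Sum>i\<in>A. f i)"
  by (induction A rule: infinite_finite_induct) (auto simp: gamma_nonneg_0 gamma_nonneg_add)

lemma gamma_nonneg_mult_1X:
  assumes "gamma_nonneg n f" shows "gamma_nonneg (Suc n) ([:1, 1:] * f)"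
proof -
  obtain \<gamma> where g: "\<forall>i. 0 \<le> \<gamma> i" "\<forall>i. n < 2 * i \<longrightarrow> \<gamma> i = 0"
     "f = (\<Sum>i\<le>n. smult (\<gamma> i) ([:0, 1:] ^ i * [:1, 1:] ^ (n - 2 * i)))"
    using assms unfolding gamma_nonneg_def by blast
  have "[:1, 1:] * smult (\<gamma> i) ([:0, 1:] ^ i * [:1, 1:] ^ (n - 2 * i))
      = smult (\<gamma> i) ([:0, 1:] ^ i * [:1, 1:] ^ (Suc n - 2 * i))" for i
  proof (cases "n < 2 * i")
    case False
    then have "Suc n - 2 * i = Suc (n - 2 * i)" by simp
    then show ?thesis by (simp only: power_Suc mult_smult_right mult.left_commute)
  qed (use g in simp)
  then have "[:1, 1:] * f = (\<Sum>i\<le>Suc n. smult (\<gamma> i) ([:0, 1:] ^ i * [:1, 1:] ^ (Suc n - 2 * i)))"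
    unfolding g(3) sum_distrib_left using g(2) by simp
  then show ?thesis unfolding gamma_nonneg_def using g by (intro exI[of _ \<gamma>]) auto
qed

lemma gamma_nonneg_mult_X:
  assumes "gamma_nonneg n f" shows "gamma_nonneg (Suc (Suc n)) ([:0, 1:] * f)"
proof -
  obtain \<gamma> where g: "\<forall>i. 0 \<le> \<gamma> i" "\<forall>i. n < 2 * i \<longrightarrow> \<gamma> i = 0"
     "f = (\<Sum>i\<le>n. smult (\<gamma> i) ([:0, 1:] ^ i * [:1, 1:] ^ (n - 2 * i)))"
    using assms unfolding gamma_nonneg_def by blast
  define \<gamma>' where "\<gamma>' i = (case i of 0 \<Rightarrow> 0 | Suc j \<Rightarrow> \<gamma> j)" for i
  have "[:0, 1:] * smult (\<gamma> i) ([:0, 1:] ^ i * [:1, 1:] ^ (n - 2 * i))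
      = smult (\<gamma>' (Suc i)) ([:0, 1:] ^ Suc i * [:1, 1:] ^ (Suc (Suc n) - 2 * Suc i))" for i
    by (simp only: \<gamma>'_def power_Suc mult_smult_right mult.assoc nat.case) simp
  then have "[:0, 1:] * f =
      (\<Sum>i\<le>n. smult (\<gamma>' (Suc i)) ([:0, 1:] ^ Suc i * [:1, 1:] ^ (Suc (Suc n) - 2 * Suc i)))"
    unfolding g(3) sum_distrib_left by simp
  also have "\<dots> = (\<Sum>i\<le>Suc n. smult (\<gamma>' i) ([:0, 1:] ^ i * [:1, 1:] ^ (Suc (Suc n) - 2 * i)))"
    by (subst sum.atMost_Suc_shift) (simp add: \<gamma>'_def)
  also have "\<dots> = (\<Sum>i\<le>Suc (Suc n). smult (\<gamma>' i) ([:0, 1:] ^ i * [:1, 1:] ^ (Suc (Suc n) - 2 * i)))"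
    using g(2) by (simp add: \<gamma>'_def)
  finally show ?thesis unfolding gamma_nonneg_def using g
    by (intro exI[of _ \<gamma>']) (auto simp: \<gamma>'_def split: nat.splits)
qed

text \<open>Constant coefficient 1 forces \<open>\<gamma> 0 = 1\<close>, and the term of index 0 is
  the only one that reaches x ^ n; hence \<open>n\<close> is the degree that
  \<open>gamma_positive\<close> refers to.\<close>

lemma gamma_nonneg_imp_gamma_positive:
  assumes "gamma_nonneg n f" "coeff f 0 = 1" shows "gamma_positive f"
proof -
  obtain \<gamma> where g: "\<forall>i. 0 \<le> \<gamma> i" "\<forall>i. n < 2 * i \<longrightarrow> \<gamma> i = 0"
     "f = (\<Sum>i\<le>n. smult (\<gamma> i) ([:0, 1:] ^ i * [:1, 1:] ^ (n - 2 * i)))"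
    using assms unfolding gamma_nonneg_def by blast
  have deg1: "degree ([:1, 1:] ^ k :: int poly) = k" and deg0: "degree ([:0, 1:] ^ k :: int poly) = k" for k
    by (simp_all add: degree_power_eq)
  have lc: "coeff ([:1, 1:] ^ k :: int poly) k = 1" for k
    using lead_coeff_power[of "[:1,1:] :: int poly" k] by (simp add: deg1)
  have f0: "f = smult (\<gamma> 0) ([:1, 1:] ^ n) + (\<Sum>i\<in>{..n} - {0}. smult (\<gamma> i) ([:0, 1:] ^ i * [:1, 1:] ^ (n - 2 * i)))"
    unfolding g(3) by (subst sum.remove[of _ 0]) auto
  have z: "coeff (\<Sum>i\<in>{..n} - {0}. smult (\<gamma> i) ([:0, 1:] ^ i * [:1, 1:] ^ (n - 2 * i))) 0 = 0"
    unfolding coeff_sum by (intro sum.neutral) (auto simp: coeff_mult coeff_0_power)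
  have "coeff ([:1, 1:] ^ n :: int poly) 0 = 1" by (simp add: coeff_0_power)
  then have g0: "\<gamma> 0 = 1" using assms(2) z unfolding f0 by simp
  have small: "coeff (smult (\<gamma> i) ([:0, 1:] ^ i * [:1, 1:] ^ (n - 2 * i))) k = 0"
    if "i \<noteq> 0 \<or> k > n" "k \<ge> n" for i k
  proof (cases "n < 2 * i")
    case False
    have "degree ([:0, 1:] ^ i * [:1, 1:] ^ (n - 2 * i) :: int poly) \<le> i + (n - 2 * i)"
      using degree_mult_le[of "[:0, 1:] ^ i" "[:1, 1:] ^ (n - 2 * i) :: int poly"] by (simp add: deg0 deg1)
    also have "\<dots> < k" using that False by auto
    finally show ?thesis by (simp add: coeff_eq_0)
  qed (use g in simp)
  have "coeff (\<Sum>i\<in>{..n} - {0}. smult (\<gamma> i) ([:0, 1:] ^ i * [:1, 1:] ^ (n - 2 * i))) n = 0"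
    unfolding coeff_sum by (intro sum.neutral ballI small) auto
  then have "coeff f n = 1" unfolding f0 coeff_add by (simp add: g0 lc)
  moreover have "degree f \<le> n"
    by (rule degree_le) (use small in \<open>auto simp: g(3) coeff_sum intro!: sum.neutral\<close>)
  ultimately have deg: "degree f = n" using le_degree[of f n] by simp
  have "f = (\<Sum>i\<le>n div 2. smult (\<gamma> i) ([:0, 1:] ^ i * [:1, 1:] ^ (n - 2 * i)))"
    unfolding g(3)
  proof (rule sum.mono_neutral_right)
    have "n < 2 * i" if "\<not> i \<le> n div 2" for i using that by auto
    then show "\<forall>i\<in>{..n} - {..n div 2}. smult (\<gamma> i) ([:0, 1:] ^ i * [:1, 1:] ^ (n - 2 * i)) = 0"
      using g(2) by auto
  qed auto
  then show ?thesis unfolding gamma_positive_def deg using g(1) by blast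
qed

text \<open>Generating function of the exponents allowed at one flat of a chain when the rank jumps
  by \<open>n\<close> there.\<close>

definition bracket :: "nat \<Rightarrow> int poly" where
  "bracket n = (\<Sum>a\<in>{1..<n}. monom 1 a)"

lemma bracket_1: "bracket 0 = 0" "bracket (Suc 0) = 0" "bracket (Suc (Suc 0)) = [:0, 1:]"
  by (auto simp: bracket_def monom_altdef)

text \<open>For n >= 1, \<open>bracket n\<close> is a combination of 1 ^ n and x ^ n, whence the
  recurrence with characteristic polynomial (t - 1) * (t - x).\<close>

lemma bracket_rec: "bracket (Suc (Suc (Suc d))) = [:1, 1:] * bracket (Suc (Suc d)) - [:0, 1:] * bracket (Suc d)"
proof -
  have s: "bracket (Suc (Suc n)) = bracket (Suc n) + monom 1 (Suc n)" for n
    by (simp add: bracket_def)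
  have m: "monom 1 (Suc (Suc d)) = [:0,1:] * monom (1::int) (Suc d)"
    by (simp add: monom_altdef)
  show ?thesis unfolding s m by (simp add: algebra_simps one_pCons)
qed

section \<open>Edge labels and increasing chains\<close>

context loopless_matroid
begin

text \<open>The value 0 is kept free, so that a last label of 0 imposes no restriction on the next
  step.\<close>

definition idx :: "'a \<Rightarrow> nat" where
  "idx = (SOME f. inj_on f E \<and> 0 \<notin> f ` E)"

lemma idx: "inj_on idx E" "0 \<notin> idx ` E"
proof -
  obtain f :: "'a \<Rightarrow> nat" where "inj_on f E" using finite_imp_inj_to_nat_seg[OF finite_ground] by blast
  then have "inj_on (\<lambda>x. Suc (f x)) E \<and> 0 \<notin> (\<lambda>x. Suc (f x)) ` E" by (auto simp: inj_on_def)
  then have "inj_on idx E \<and> 0 \<notin> idx ` E" unfolding idx_def by (rule someI[of "\<lambda>f. inj_on f E \<and> 0 \<notin> f ` E"])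
  then show "inj_on idx E" "0 \<notin> idx ` E" by auto
qed

definition label :: "'a set \<Rightarrow> 'a set \<Rightarrow> nat" where
  "label F G = Min (idx ` (G - F))"

definition covers :: "'a set \<Rightarrow> 'a set set" where
  "covers F = {G \<in> L. F \<subset> G \<and> rk G = rk F + 1}"

lemma label_le: "G \<subseteq> E \<Longrightarrow> e \<in> G - F \<Longrightarrow> label F G \<le> idx e"
  unfolding label_def using finite_subset[OF _ finite_ground] by (intro Min_le) auto

lemma label_obtain:
  assumes "G \<subseteq> E" "F \<subset> G" obtains e where "e \<in> G - F" "idx e = label F G"
proof -
  have "label F G \<in> idx ` (G - F)"
    unfolding label_def using assms finite_subset[OF _ finite_ground] by (intro Min_in) auto
  then show ?thesis using that by (auto simp: eq_commute)
qed

lemma label_pos: "G \<subseteq> E \<Longrightarrow> F \<subset> G \<Longrightarrow> 0 < label F G"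
  by (metis label_obtain idx(2) DiffD1 gr0I image_eqI subsetD)

lemma cover_eq:
  assumes "F \<in> L" "G \<in> covers F" "e \<in> G - F" shows "G = cl (insert e F)"
proof -
  have G: "G \<in> L" "F \<subset> G" "rk G = rk F + 1" using assms by (auto simp: covers_def)
  have e: "e \<in> E" using G assms flat_subset by auto
  have "cl (insert e F) \<subseteq> G" using assms G by (intro cl_least) auto
  then show ?thesis using flat_strict_mono[of "cl (insert e F)" G] cl_insert_flat[of F e] assms G e
    by (auto simp: psubset_eq)
qed

text \<open>An increasing maximal chain from \<open>F\<close> to \<open>H\<close> must start with the cover spanned by the
  element of smallest index in \<open>H - F\<close>; this is its first step.\<close>

lemma sum_first_cover:
  fixes \<psi> :: "'a set \<Rightarrow> 'b::comm_monoid_add"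
  assumes F: "F \<in> L"
  shows "(\<Sum>H\<in>{H\<in>L. F \<subset> H \<and> l < label F H}. \<psi> H) =
    (\<Sum>G\<in>{G\<in>covers F. l < label F G}. \<psi> G + (\<Sum>H\<in>{H\<in>L. G \<subset> H \<and> label F G < label G H}. \<psi> H))"
proof -
  let ?A = "{H\<in>L. F \<subset> H \<and> l < label F H}" and ?C = "{G\<in>covers F. l < label F G}"
  define e where "e H = (SOME e. e \<in> H - F \<and> idx e = label F H)" for H
  have e: "e H \<in> H - F" "idx (e H) = label F H" if "H \<in> L" "F \<subset> H" for H
    using label_obtain[of H F] flat_subset that someI[of "\<lambda>e. e \<in> H - F \<and> idx e = label F H"]
    unfolding e_def by blast+
  define f where "f H = cl (insert (e H) F)" for H
  have f: "f H \<in> covers F" "f H \<subseteq> H" "label F (f H) = label F H" if "H \<in> L" "F \<subset> H" for H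
  proof -
    have eE: "e H \<in> E" "e H \<notin> F" using e that flat_subset by auto
    show fc: "f H \<in> covers F" using cl_insert_flat[OF F eE] by (auto simp: covers_def f_def)
    show fH: "f H \<subseteq> H" using e that unfolding f_def by (intro cl_least) auto
    have fE: "f H \<subseteq> E" "F \<subset> f H" using fc flat_subset by (auto simp: covers_def)
    obtain e' where "e' \<in> f H - F" "idx e' = label F (f H)" using label_obtain[OF fE] by auto
    then have "label F H \<le> label F (f H)" using label_le[of H e' F] fH that flat_subset by auto
    moreover have "e H \<in> f H - F" using cl_insert_flat(4)[OF F eE] eE by (auto simp: f_def)
    then have "label F (f H) \<le> label F H" using label_le[OF fE(1)] e that by metis
    ultimately show "label F (f H) = label F H" by simp
  qed
  have f_cover: "f G = G" if "G \<in> covers F" for G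
    using cover_eq[OF F that, of "e G"] e[of G] that by (auto simp: covers_def f_def)
  \<comment> \<open>The element of least index in \<open>H - F\<close> lies in \<open>G\<close>, so
    by injectivity of \<open>idx\<close> the labels still to come in \<open>H - G\<close> are
    strictly larger. Conversely, if they are larger, that element cannot lie in
    \<open>H - G\<close>.\<close>
  have fib: "{H \<in> ?A. f H = G} = insert G {H\<in>L. G \<subset> H \<and> label F G < label G H}" if G: "G \<in> ?C" for G
  proof (intro set_eqI iffI)
    fix H assume H: "H \<in> {H \<in> ?A. f H = G}"
    show "H \<in> insert G {H\<in>L. G \<subset> H \<and> label F G < label G H}"
    proof (cases "H = G")
      case False
      then have GH: "G \<subset> H" using H f by auto
      obtain e' where e': "e' \<in> H - G" "idx e' = label G H" using label_obtain[of H G] GH H flat_subset by auto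
      have FG: "F \<subset> G" using G by (auto simp: covers_def)
      have "label F H \<le> label G H" using label_le[of H e' F] e' H flat_subset FG by auto
      moreover have "label F H \<noteq> label G H"
      proof
        assume "label F H = label G H"
        then have "idx (e H) = idx e'" using e H e' by auto
        moreover have "e H \<in> E" "e' \<in> E" using e[of H] H e' flat_subset by auto
        ultimately have "e H = e'" using idx(1) by (meson inj_onD)
        moreover have "e H \<in> G" using H cl_insert_flat(4)[OF F, of "e H"] e[of H] flat_subset by (auto simp: f_def)
        ultimately show False using e' by auto
      qed
      moreover have "label F H = label F G"
      proof -
        have "f H = G" "H \<in> L" "F \<subset> H" using H by auto
        with f(3)[of H] show ?thesis by simp
      qed
      ultimately show ?thesis using GH H by auto
    qed auto
  next
    fix H assume H: "H \<in> insert G {H\<in>L. G \<subset> H \<and> label F G < label G H}"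
    show "H \<in> {H \<in> ?A. f H = G}"
    proof (cases "H = G")
      case True
      then show ?thesis using G f_cover by (auto simp: covers_def)
    next
      case False
      then have GH: "G \<subset> H" "H \<in> L" "label F G < label G H" using H by auto
      have FG: "F \<subset> G" "G \<in> L" using G by (auto simp: covers_def)
      have FH: "F \<subset> H" using FG GH by auto
      have e1: "e H \<in> H - F" "idx (e H) = label F H" using e GH FH by auto
      have e2: "e G \<in> G - F" "idx (e G) = label F G" using e FG by auto
      have "label F H \<le> label F G" using label_le[of H "e G" F] e2 GH flat_subset by auto
      then have "idx (e H) < label G H" using GH e1 by auto
      then have "e H \<in> G" using label_le[of H "e H" G] e1 GH flat_subset by (meson DiffD1 DiffI leD)
      then have fG: "f H = G" using cover_eq[OF F, of G "e H"] G e1 by (auto simp: f_def)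
      then have "label F H = label F G" using f(3)[OF GH(2) FH] by simp
      then show ?thesis using fG GH FH G by auto
    qed
  qed
  have "(\<Sum>H\<in>?A. \<psi> H) = (\<Sum>G\<in>?C. \<Sum>H\<in>{H \<in> ?A. f H = G}. \<psi> H)"
  proof (rule sum.group[symmetric])
    show "f ` ?A \<subseteq> ?C"
    proof
      fix G assume "G \<in> f ` ?A"
      then obtain H where H: "H \<in> L" "F \<subset> H" "l < label F H" "G = f H" by blast
      with f[OF H(1,2)] show "G \<in> ?C" by simp
    qed
  qed (auto simp: covers_def finite_flats)
  also have "\<dots> = (\<Sum>G\<in>?C. \<psi> G + (\<Sum>H\<in>{H\<in>L. G \<subset> H \<and> label F G < label G H}. \<psi> H))"
    by (intro sum.cong refl, subst fib) (auto simp: finite_flats)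
  finally show ?thesis .
qed

end

text \<open>\<open>h F\<close> stands for the generating function of the Feichtner--Yuzvinsky
  monomials on chains strictly above \<open>F\<close>; the recursion splits off the smallest flat
  \<open>G\<close> of the chain.\<close>

locale chow_recursion = loopless_matroid +
  fixes h :: "'a set \<Rightarrow> int poly"
  assumes h: "F \<in> L \<Longrightarrow> h F = 1 + (\<Sum>G\<in>{G\<in>L. F \<subset> G}. bracket (rk G - rk F) * h G)"
begin

text \<open>In terms of maximal chains with labels, \<open>V G l\<close> and \<open>W G l\<close> are the weighted sums over the
  continuations from \<open>G\<close> to \<open>E\<close> of a chain whose last label is \<open>l\<close>: for \<open>V\<close> the step into \<open>G\<close>
  opens a block of the chain, so there is no descent at \<open>G\<close>, and for \<open>W\<close> a descent at \<open>G\<close> is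
  allowed. The closed forms below make \<open>V_eq_sum_W\<close> and \<open>W_rec\<close> consequences of \<open>sum_first_cover\<close>.\<close>

definition eps :: "'a set \<Rightarrow> nat \<Rightarrow> int poly" where
  "eps G l = (if G = E \<or> l < label G E then 1 else 0)"

definition tail :: "nat \<Rightarrow> 'a set \<Rightarrow> nat \<Rightarrow> int poly" where
  "tail k G l = (\<Sum>H\<in>{H\<in>L. G \<subset> H \<and> l < label G H}. bracket (rk H - rk G + k) * h H)"

definition V :: "'a set \<Rightarrow> nat \<Rightarrow> int poly" where
  "V G l = eps G l + tail 1 G l"

definition W :: "'a set \<Rightarrow> nat \<Rightarrow> int poly" where
  "W G l = eps G l + bracket 2 * h G + tail 2 G l"

lemma tail_ground: "tail k E l = 0"
proof -
  have "{H \<in> L. E \<subset> H \<and> l < label E H} = {}" using flat_subset by auto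
  then show ?thesis unfolding tail_def by (simp only: sum.empty)
qed

lemma h_ground: "h E = 1"
proof -
  have "{G \<in> L. E \<subset> G} = {}" using flat_subset by auto
  then show ?thesis using h[OF ground_flat] by (simp only: sum.empty add_0_right)
qed

lemma tail_0_all: "G \<in> L \<Longrightarrow> G \<noteq> E \<Longrightarrow> h G = eps G 0 + tail 0 G 0"
proof -
  assume G: "G \<in> L" "G \<noteq> E"
  then have "G \<subset> E" using flat_subset by auto
  then have "eps G 0 = 1" using label_pos[of E G] by (simp add: eps_def)
  moreover have "{H\<in>L. G \<subset> H \<and> 0 < label G H} = {H\<in>L. G \<subset> H}" using label_pos flat_subset by auto
  ultimately show ?thesis using h[OF G(1)] by (simp add: tail_def)
qed

text \<open>\<open>eps\<close> books the constant 1 of the recursion as a term at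
  \<open>H = E\<close>, so that \<open>eps + tail\<close> is a single sum over \<open>H\<close> and
  \<open>sum_first_cover\<close> applies. Passing to the cover \<open>G1\<close> lowers the rank
  difference by one, which raises the shift to \<open>Suc k\<close>; the term \<open>H = G1\<close>
  keeps the weight \<open>bracket (Suc k)\<close>.\<close>

lemma eps_tail_split:
  assumes "G \<in> L" "G \<noteq> E"
  shows "eps G l + tail k G l = (\<Sum>G1\<in>{G1\<in>covers G. l < label G G1}.
     eps G1 (label G G1) + bracket (Suc k) * h G1 + tail (Suc k) G1 (label G G1))"
proof -
  have GE: "G \<subset> E" using assms flat_subset by auto
  let ?\<psi> = "\<lambda>H. (if H = E then 1 else 0) + bracket (rk H - rk G + k) * h H"
  have e: "(\<Sum>H\<in>{H\<in>L. F \<subset> H \<and> l < label F H}. if H = E then 1 else 0 :: int poly)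
     = (if F \<subset> E \<and> l < label F E then 1 else 0)" for F l
    by (subst sum.delta) (auto simp: finite_flats ground_flat)
  have "eps G l + tail k G l = (\<Sum>H\<in>{H\<in>L. G \<subset> H \<and> l < label G H}. ?\<psi> H)"
    unfolding sum.distrib e tail_def using GE by (auto simp: eps_def)
  also have "\<dots> = (\<Sum>G1\<in>{G1\<in>covers G. l < label G G1}. ?\<psi> G1 +
     (\<Sum>H\<in>{H\<in>L. G1 \<subset> H \<and> label G G1 < label G1 H}. ?\<psi> H))"
    by (rule sum_first_cover[OF assms(1)])
  also have "\<dots> = (\<Sum>G1\<in>{G1\<in>covers G. l < label G G1}.
     eps G1 (label G G1) + bracket (Suc k) * h G1 + tail (Suc k) G1 (label G G1))"
  proof (rule sum.cong[OF refl])
    fix G1 assume G1: "G1 \<in> {G1\<in>covers G. l < label G G1}"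
    then have r: "rk G1 = rk G + 1" "G1 \<in> L" by (auto simp: covers_def)
    have "rk H - rk G + k = rk H - rk G1 + Suc k" if "H \<in> L" "G1 \<subset> H" for H
      using flat_strict_mono[OF r(2) that] r by auto
    then have "(\<Sum>H\<in>{H\<in>L. G1 \<subset> H \<and> label G G1 < label G1 H}. bracket (rk H - rk G + k) * h H)
        = tail (Suc k) G1 (label G G1)"
      unfolding tail_def by (intro sum.cong) auto
    moreover have "G1 \<subseteq> E" using r flat_subset by auto
    ultimately show "?\<psi> G1 + (\<Sum>H\<in>{H\<in>L. G1 \<subset> H \<and> label G G1 < label G1 H}. ?\<psi> H)
       = eps G1 (label G G1) + bracket (Suc k) * h G1 + tail (Suc k) G1 (label G G1)"
      unfolding sum.distrib e using r by (auto simp: eps_def)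
  qed
  finally show ?thesis .
qed

text \<open>Shift 0: the weight \<open>bracket 1\<close> of the cover itself vanishes, and what
  remains at each cover is \<open>V\<close>.\<close>

lemma sum_V: "G \<in> L \<Longrightarrow> G \<noteq> E \<Longrightarrow>
    (\<Sum>G1\<in>{G1\<in>covers G. l < label G G1}. V G1 (label G G1)) = eps G l + tail 0 G l"
  by (subst eps_tail_split) (auto simp: V_def bracket_1)

lemma h_eq_sum_V: "G \<in> L \<Longrightarrow> G \<noteq> E \<Longrightarrow> h G = (\<Sum>G1\<in>covers G. V G1 (label G G1))"
proof -
  assume G: "G \<in> L" "G \<noteq> E"
  have "{G1\<in>covers G. 0 < label G G1} = covers G"
    using label_pos flat_subset by (auto simp: covers_def)
  then show ?thesis using sum_V[OF G, of 0] tail_0_all[OF G] by simp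
qed

lemma V_eq_sum_W: "G \<in> L \<Longrightarrow> G \<noteq> E \<Longrightarrow>
    V G l = (\<Sum>G1\<in>{G1\<in>covers G. l < label G G1}. W G1 (label G G1))"
  unfolding V_def by (subst eps_tail_split) (auto simp: W_def numeral_2_eq_2)

text \<open>The covers with label at most \<open>l\<close> are all covers, which sum to
  \<open>h G\<close>, without those of larger label, which \<open>sum_V\<close> evaluates. After
  this substitution the claim is \<open>bracket_rec\<close> for each \<open>H\<close>, with shifts
  2, 1 and 0.\<close>

lemma W_rec:
  assumes "G \<in> L" "G \<noteq> E"
  shows "W G l = [:1, 1:] * V G l + [:0, 1:] * (\<Sum>G1\<in>{G1\<in>covers G. label G G1 \<le> l}. V G1 (label G G1))"
proof -
  let ?S = "\<Sum>G1\<in>{G1\<in>covers G. label G G1 \<le> l}. V G1 (label G G1)"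
  let ?T = "\<Sum>G1\<in>{G1\<in>covers G. l < label G G1}. V G1 (label G G1)"
  have fin: "finite (covers G)" using finite_flats by (auto simp: covers_def)
  have "h G = ?S + ?T" unfolding h_eq_sum_V[OF assms]
    by (subst sum.union_disjoint[symmetric]) (auto intro!: sum.cong simp: fin)
  then have S: "?S = h G - (eps G l + tail 0 G l)" using sum_V[OF assms, of l] by simp
  have "tail 2 G l = [:1, 1:] * tail 1 G l - [:0, 1:] * tail 0 G l"
    unfolding tail_def sum_distrib_left sum_subtractf[symmetric]
  proof (rule sum.cong[OF refl])
    fix H assume "H \<in> {H\<in>L. G \<subset> H \<and> l < label G H}"
    then have "rk G < rk H" using flat_strict_mono assms by auto
    then obtain d where d: "rk H - rk G = Suc d" by (metis Suc_diff_Suc)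
    then have "rk H - rk G + 2 = Suc (Suc (Suc d))" "rk H - rk G + 1 = Suc (Suc d)" "rk H - rk G + 0 = Suc d"
      by auto
    then show "bracket (rk H - rk G + 2) * h H =
        [:1, 1:] * (bracket (rk H - rk G + 1) * h H) - [:0, 1:] * (bracket (rk H - rk G + 0) * h H)"
      by (simp only: bracket_rec left_diff_distrib mult.assoc)
  qed
  moreover have "bracket 2 = [:0, 1:]" by (simp add: bracket_1 numeral_2_eq_2)
  moreover have "[:1, 1:] = 1 + [:0, 1 :: int:]" by (simp add: one_pCons)
  moreover have "e + x * hG + ((1 + x) * t1 - x * t0) = (1 + x) * (e + t1) + x * (hG - (e + t0))"
    for e x hG t1 t0 :: "int poly" by (simp add: algebra_simps)
  ultimately show ?thesis unfolding S by (simp only: V_def W_def)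
qed

lemma V_ground: "V E l = 1"
  by (simp add: V_def eps_def tail_ground)

lemma W_ground: "W E l = [:1, 1:]"
  by (simp add: W_def eps_def tail_ground h_ground bracket_1 numeral_2_eq_2 one_pCons)

text \<open>In \<open>W\<close> the factor for the step into \<open>G\<close> is still pending,
  hence the extra degree. A descent consumes it together with its own step: multiplication by x adds
  two to the length at the cover, which is one more than the length of \<open>V G l\<close>.\<close>

lemma gamma_nonneg_V_W: "G \<in> L \<Longrightarrow>
  gamma_nonneg (rk E - rk G) (V G l) \<and> gamma_nonneg (Suc (rk E - rk G)) (W G l)"
proof (induction "rk E - rk G" arbitrary: G l rule: less_induct)
  case less
  show ?case
  proof (cases "G = E")
    case True
    then show ?thesis using gamma_nonneg_1 gamma_nonneg_mult_1X[OF gamma_nonneg_1]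
      by (simp add: V_ground W_ground)
  next
    case False
    have "rk G < rk E" using flat_strict_mono[OF less.prems ground_flat] False flat_subset less.prems by auto
    then have r: "rk E - rk G = Suc (rk E - rk G1)" if "G1 \<in> covers G" for G1
      using that by (auto simp: covers_def)
    have IH: "gamma_nonneg (rk E - rk G1) (V G1 l) \<and> gamma_nonneg (Suc (rk E - rk G1)) (W G1 l)"
      if "G1 \<in> covers G" for G1 l
      using less.hyps[of G1] that r[OF that] by (auto simp: covers_def)
    have V: "gamma_nonneg (rk E - rk G) (V G l)"
      unfolding V_eq_sum_W[OF less.prems False] using IH r by (intro gamma_nonneg_sum) auto
    have "gamma_nonneg (Suc (rk E - rk G)) ([:0, 1:] * (\<Sum>G1\<in>{G1\<in>covers G. label G G1 \<le> l}. V G1 (label G G1)))"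
      unfolding sum_distrib_left
    proof (rule gamma_nonneg_sum)
      fix G1 assume "G1 \<in> {G1\<in>covers G. label G G1 \<le> l}"
      then show "gamma_nonneg (Suc (rk E - rk G)) ([:0, 1:] * V G1 (label G G1))"
        using gamma_nonneg_mult_X[of "rk E - rk G1" "V G1 (label G G1)"] IH[of G1] r[of G1] by auto
    qed
    from gamma_nonneg_add[OF gamma_nonneg_mult_1X[OF V] this]
    have "gamma_nonneg (Suc (rk E - rk G)) (W G l)" unfolding W_rec[OF less.prems False] .
    with V show ?thesis ..
  qed
qed

text \<open>The first step of a chain carries no weight, hence the \<open>- 1\<close>; at
  \<open>G = E\<close> the truncated subtraction gives 0, as it should for
  \<open>h E = 1\<close>.\<close>

lemma gamma_nonneg_h:
  assumes "G \<in> L" shows "gamma_nonneg (rk E - rk G - 1) (h G)"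
proof (cases "G = E")
  case True
  then show ?thesis by (simp add: h_ground gamma_nonneg_1)
next
  case False
  show ?thesis unfolding h_eq_sum_V[OF assms False]
  proof (rule gamma_nonneg_sum)
    fix G1 assume "G1 \<in> covers G"
    then show "gamma_nonneg (rk E - rk G - 1) (V G1 (label G G1))"
      using gamma_nonneg_V_W[of G1] by (auto simp: covers_def)
  qed
qed

text \<open>The series is \<open>V {} 0\<close>: a virtual bottom below \<open>{}\<close> raises
  every rank difference by one, which is the shift in \<open>tail 1\<close>. The summand at
  \<open>{}\<close> has weight \<open>bracket 1 = 0\<close>.\<close>

lemma gamma_nonneg_aug:
  "gamma_nonneg (rk E) (1 + (\<Sum>G\<in>L. bracket (rk G + 1) * h G))"
proof -
  have "V {} 0 = 1 + (\<Sum>G\<in>L - {{}}. bracket (rk G + 1) * h G)"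
  proof -
    have "eps {} 0 = 1" using label_pos[of E "{}"] unfolding eps_def by (metis order_refl empty_subsetI psubsetI)
    moreover have "{H\<in>L. {} \<subset> H \<and> 0 < label {} H} = L - {{}}" using label_pos[of _ "{}"] flat_subset by auto
    ultimately show ?thesis by (simp add: V_def tail_def rk_empty)
  qed
  moreover have "(\<Sum>G\<in>L. bracket (rk G + 1) * h G) = (\<Sum>G\<in>L - {{}}. bracket (rk G + 1) * h G)"
    by (subst sum.remove[of _ "{}"]) (auto simp: finite_flats empty_flat rk_empty bracket_1)
  ultimately show ?thesis using gamma_nonneg_V_W[OF empty_flat, of 0] by (simp add: rk_empty)
qed

end

section \<open>Ideals and dimensions of graded quotients\<close>

lemma Const_0: "Const 0 = 0" and Const_1: "Const 1 = 1"
  by (simp_all add: Const_def)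

lemma Const_add: "Const (a + b) = Const a + Const b"
  and Const_mult: "Const (a * b) = Const a * Const b"
  and Const_uminus: "Const (- a) = - Const a"
  by (simp_all add: Const_def single_add mult_single single_uminus)

lemma Const_sum: "Const (sum f A) = (\<Sum>i\<in>A. Const (f i))"
  by (induction A rule: infinite_finite_induct) (simp_all add: Const_0 Const_add)

text \<open>Abstract because two kinds of ideals occur: \<open>ideal_gen\<close> of the relations,
  and \<open>hr_ideal\<close>, which is defined by a functional instead of generators.\<close>

locale mideal =
  fixes I :: "'v mpoly set"
  assumes zero_mem: "0 \<in> I"
    and add_mem: "a \<in> I \<Longrightarrow> b \<in> I \<Longrightarrow> a + b \<in> I"
    and mult_mem: "a \<in> I \<Longrightarrow> q * a \<in> I"
begin

lemma mult_mem': "a \<in> I \<Longrightarrow> a * q \<in> I"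
  using mult_mem[of a q] by (simp add: mult.commute)

lemma uminus_mem: "a \<in> I \<Longrightarrow> - a \<in> I"
  using mult_mem[of a "-1"] by simp

lemma diff_mem: "a \<in> I \<Longrightarrow> b \<in> I \<Longrightarrow> a - b \<in> I"
  using add_mem[of a "- b"] uminus_mem[of b] by simp

lemma sum_mem: "(\<And>x. x \<in> A \<Longrightarrow> f x \<in> I) \<Longrightarrow> sum f A \<in> I"
  by (induction A rule: infinite_finite_induct) (auto simp: zero_mem add_mem)

lemma mem_cong: "a - b \<in> I \<Longrightarrow> a \<in> I \<longleftrightarrow> b \<in> I"
  using add_mem[of "a - b" b] diff_mem[of a "a - b"] by auto

text \<open>The factor \<open>q\<close> stays in place because \<open>a\<close> and \<open>b\<close>
  may be congruent only after multiplication by it, as \<open>z G\<close> and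
  \<open>z (join H G)\<close> are after multiplication by \<open>X H\<close>.\<close>

lemma power_cong: "q * a - q * b \<in> I \<Longrightarrow> q * a ^ n - q * b ^ n \<in> I"
proof (induction n)
  case (Suc n)
  have "q * a ^ Suc n - q * b ^ Suc n = a ^ n * (q * a - q * b) + b * (q * a ^ n - q * b ^ n)"
    by (simp add: algebra_simps)
  then show ?case using Suc by (metis add_mem mult_mem)
qed (simp add: zero_mem)

end

lemma mideal_ideal_gen: "mideal (ideal_gen G)"
proof
  show "0 \<in> ideal_gen G"
    unfolding ideal_gen_def by (rule CollectI, rule exI[of _ "{}"]) auto
next
  fix a b :: "'a mpoly" assume "a \<in> ideal_gen G" "b \<in> ideal_gen G"
  then obtain F1 q1 F2 q2 where h: "finite F1" "F1 \<subseteq> G" "a = (\<Sum>g\<in>F1. q1 g * g)"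
     "finite F2" "F2 \<subseteq> G" "b = (\<Sum>g\<in>F2. q2 g * g)"
    unfolding ideal_gen_def by blast
  let ?q = "\<lambda>g. (if g \<in> F1 then q1 g else 0) + (if g \<in> F2 then q2 g else 0)"
  have "(\<Sum>g\<in>F1 \<union> F2. ?q g * g) = (\<Sum>g\<in>F1 \<union> F2. if g \<in> F1 then q1 g * g else 0) + (\<Sum>g\<in>F1 \<union> F2. if g \<in> F2 then q2 g * g else 0)"
    unfolding sum.distrib[symmetric] by (intro sum.cong) (auto simp: distrib_right)
  also have "\<dots> = a + b" unfolding h
    using h by (intro arg_cong2[of _ _ _ _ "(+)"] sum.mono_neutral_cong_right) auto
  finally show "a + b \<in> ideal_gen G" unfolding ideal_gen_def using h
    by (intro CollectI exI[of _ "F1 \<union> F2"] exI[of _ ?q]) auto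
next
  fix a q :: "'a mpoly" assume "a \<in> ideal_gen G"
  then obtain F1 q1 where h: "finite F1" "F1 \<subseteq> G" "a = (\<Sum>g\<in>F1. q1 g * g)"
    unfolding ideal_gen_def by blast
  then have "q * a = (\<Sum>g\<in>F1. (q * q1 g) * g)" by (simp add: sum_distrib_left mult.assoc)
  then show "q * a \<in> ideal_gen G" unfolding ideal_gen_def using h
    by (intro CollectI exI[of _ "F1"] exI[of _ "\<lambda>g. q * q1 g"]) auto
qed

lemma ideal_gen_gen: "g \<in> G \<Longrightarrow> g \<in> ideal_gen G"
  unfolding ideal_gen_def by (rule CollectI, rule exI[of _ "{g}"], rule exI[of _ "\<lambda>_. 1"]) auto

text \<open>Gaussian elimination on the last of the \<open>N\<close> equations in \<open>n\<close>
  unknowns.\<close>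

lemma exists_nontrivial_kernel:
  fixes A :: "nat \<Rightarrow> nat \<Rightarrow> rat"
  assumes "N < n"
  shows "\<exists>c. (\<exists>i<n. c i \<noteq> 0) \<and> (\<forall>k<N. (\<Sum>i<n. A i k * c i) = 0)"
  using assms
proof (induction N arbitrary: n A)
  case 0
  then show ?case by (intro exI[of _ "\<lambda>_. 1"]) auto
next
  case (Suc N)
  then obtain m where m: "n = Suc m" by (cases n) auto
  show ?case
  proof (cases "\<exists>p<n. A p N \<noteq> 0")
    case False
    have "\<exists>c. (\<exists>i<n. c i \<noteq> 0) \<and> (\<forall>k<N. (\<Sum>i<n. A i k * c i) = 0)" using Suc by auto
    then obtain c where c: "\<exists>i<n. c i \<noteq> 0" "\<forall>k<N. (\<Sum>i<n. A i k * c i) = 0" by blast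
    then have "\<forall>k<Suc N. (\<Sum>i<n. A i k * c i) = 0" using False by (auto simp: less_Suc_eq)
    then show ?thesis using c by blast
  next
    case True
    then obtain p where p: "p < n" "A p N \<noteq> 0" by auto
    \<comment> \<open>The transposition of \<open>p\<close> and \<open>m\<close> moves the pivot to
      the last index, so that the remaining unknowns are indexed by \<open>{..<m}\<close>.\<close>
    define s where "s i = (if i = p then m else if i = m then p else i)" for i
    have s: "bij_betw s {..<n} {..<n}"
      using p m by (intro bij_betw_byWitness[where f' = s]) (auto simp: s_def)
    have sm: "s m = p" by (auto simp: s_def)
    define B where "B i k = A (s i) k - A (s i) N / A p N * A p k" for i k
    have "\<exists>c. (\<exists>i<m. c i \<noteq> 0) \<and> (\<forall>k<N. (\<Sum>i<m. B i k * c i) = 0)"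
      using Suc m by auto
    then obtain c where c: "\<exists>i<m. c i \<noteq> 0" "\<forall>k<N. (\<Sum>i<m. B i k * c i) = 0" by blast
    \<comment> \<open>The last unknown is solved from equation \<open>N\<close>.\<close>
    define d where "d i = (if i < m then c i else - (\<Sum>i<m. A (s i) N / A p N * c i))" for i
    have eq: "(\<Sum>i<n. A (s i) k * d i) = (\<Sum>i<m. B i k * c i)" for k
      using m sm by (simp add: d_def B_def left_diff_distrib right_diff_distrib sum_subtractf sum_distrib_left ac_simps)
    have ss: "s (s i) = i" for i by (auto simp: s_def)
    have tr: "(\<Sum>i<n. A i k * d (s i)) = (\<Sum>i<n. A (s i) k * d i)" for k
      using sum.reindex_bij_betw[OF s, of "\<lambda>i. A i k * d (s i)"] by (simp add: ss)
    have N0: "(\<Sum>i<m. B i N * c i) = 0" using p by (simp add: B_def)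
    have "(\<Sum>i<n. A i k * d (s i)) = 0" if "k < Suc N" for k
      using that c N0 unfolding tr eq by (auto simp: less_Suc_eq)
    moreover obtain i where "i < m" "c i \<noteq> 0" using c by auto
    then have "s i < n" "d (s (s i)) \<noteq> 0" using s m by (auto simp: ss d_def bij_betw_def)
    ultimately show ?thesis by (intro exI[of _ "\<lambda>i. d (s i)"]) auto
  qed
qed

text \<open>A family that spans and is independent attains the maximum in \<open>quot_dim\<close>:
  if more than \<open>card B\<close> elements are expressed through it, the coefficient matrix has a
  nontrivial kernel vector, and this is a linear relation modulo the ideal.\<close>

lemma quot_dim_eqI:
  fixes b :: "'b \<Rightarrow> 'v mpoly"
  assumes fin: "finite B"
    and hom: "\<And>x. x \<in> B \<Longrightarrow> homog_in VS j (b x)"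
    and span: "\<And>p. homog_in VS j p \<Longrightarrow> \<exists>c. p - (\<Sum>x\<in>B. Const (c x) * b x) \<in> ideal_gen G"
    and indep: "\<And>c x. (\<Sum>x\<in>B. Const (c x) * b x) \<in> ideal_gen G \<Longrightarrow> x \<in> B \<Longrightarrow> c x = 0"
  shows "quot_dim VS G j = card B"
  unfolding quot_dim_def
proof (rule Greatest_equality)
  interpret mideal "ideal_gen G" by (rule mideal_ideal_gen)
  obtain e where e: "bij_betw e {..<card B} B"
    using ex_bij_betw_nat_finite[OF fin] by (auto simp: atLeast0LessThan)
  show "\<exists>ps :: nat \<Rightarrow> 'v mpoly. (\<forall>i<card B. homog_in VS j (ps i)) \<and>
      (\<forall>c :: nat \<Rightarrow> rat. (\<Sum>i<card B. Const (c i) * ps i) \<in> ideal_gen G \<longrightarrow> (\<forall>i<card B. c i = 0))"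
  proof (intro exI[of _ "b \<circ> e"] conjI allI impI)
    fix i assume "i < card B"
    then show "homog_in VS j ((b \<circ> e) i)" using e hom by (auto simp: bij_betw_def)
  next
    fix c :: "nat \<Rightarrow> rat" and i
    assume c: "(\<Sum>i<card B. Const (c i) * (b \<circ> e) i) \<in> ideal_gen G" and i: "i < card B"
    let ?i = "the_inv_into {..<card B} e"
    have inv: "?i (e i) = i" if "i < card B" for i
      using e that by (auto simp: bij_betw_def the_inv_into_f_f)
    have "(\<Sum>x\<in>B. Const (c (?i x)) * b x) = (\<Sum>i<card B. Const (c i) * (b \<circ> e) i)"
      unfolding sum.reindex_bij_betw[OF e, symmetric] by (intro sum.cong) (auto simp: inv)
    then have "c (?i (e i)) = 0" using indep[of "\<lambda>x. c (?i x)" "e i"] c e i by (auto simp: bij_betw_def)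
    then show "c i = 0" using inv i by auto
  qed
  fix n assume "\<exists>ps :: nat \<Rightarrow> 'v mpoly. (\<forall>i<n. homog_in VS j (ps i)) \<and>
      (\<forall>c :: nat \<Rightarrow> rat. (\<Sum>i<n. Const (c i) * ps i) \<in> ideal_gen G \<longrightarrow> (\<forall>i<n. c i = 0))"
  then obtain ps :: "nat \<Rightarrow> 'v mpoly" where ps: "\<And>i. i < n \<Longrightarrow> homog_in VS j (ps i)"
    "\<And>c. (\<Sum>i<n. Const (c i) * ps i) \<in> ideal_gen G \<Longrightarrow> \<forall>i<n. c i = 0" by blast
  show "n \<le> card B"
  proof (rule ccontr)
    assume "\<not> n \<le> card B"
    have "\<exists>c. i < n \<longrightarrow> ps i - (\<Sum>x\<in>B. Const (c x) * b x) \<in> ideal_gen G" for i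
      using span[OF ps(1)] by blast
    then obtain A where A: "\<And>i. i < n \<Longrightarrow> ps i - (\<Sum>x\<in>B. Const (A i x) * b x) \<in> ideal_gen G" by metis
    have "\<exists>c. (\<exists>i<n. c i \<noteq> 0) \<and> (\<forall>k<card B. (\<Sum>i<n. A i (e k) * c i) = 0)"
      using exists_nontrivial_kernel[of "card B" n "\<lambda>i k. A i (e k)"] \<open>\<not> n \<le> card B\<close> by simp
    then obtain c where c: "\<exists>i<n. c i \<noteq> 0" "\<forall>k<card B. (\<Sum>i<n. A i (e k) * c i) = 0" by blast
    have c': "(\<Sum>i<n. A i x * c i) = 0" if "x \<in> B" for x
    proof -
      have "x \<in> e ` {..<card B}" using that e by (simp add: bij_betw_def)
      then obtain k where "k < card B" "x = e k" by auto
      then show ?thesis using c by auto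
    qed
    have "(\<Sum>i<n. Const (c i) * ps i) =
      (\<Sum>i<n. Const (c i) * (ps i - (\<Sum>x\<in>B. Const (A i x) * b x))) +
      (\<Sum>i<n. \<Sum>x\<in>B. Const (A i x * c i) * b x)"
      by (simp add: right_diff_distrib sum_subtractf sum_distrib_left Const_mult ac_simps)
    also have "(\<Sum>i<n. \<Sum>x\<in>B. Const (A i x * c i) * b x) = (\<Sum>x\<in>B. Const (\<Sum>i<n. A i x * c i) * b x)"
      by (subst sum.swap) (simp add: Const_sum sum_distrib_right)
    also have "\<dots> = 0" using c' by (simp add: Const_0)
    finally have "(\<Sum>i<n. Const (c i) * ps i) \<in> ideal_gen G"
      using A by (auto intro!: sum_mem mult_mem)
    then show False using ps(2)[of c] c by auto
  qed
qed

section \<open>Degrees of monomials and homogeneous polynomials\<close>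

lemma mdeg_add: "mdeg (a + b) = mdeg a + mdeg b"
proof -
  have e: "mdeg m = (\<Sum>v\<in>S. Poly_Mapping.lookup m v)" if "Poly_Mapping.keys m \<subseteq> S" "finite S" for m :: "'v \<Rightarrow>\<^sub>0 nat" and S
    unfolding mdeg_def using that by (intro sum.mono_neutral_left) (auto simp: in_keys_iff)
  let ?S = "Poly_Mapping.keys a \<union> Poly_Mapping.keys b"
  have "Poly_Mapping.keys (a + b) \<subseteq> ?S" by (rule keys_add)
  then show ?thesis using e[of "a + b" ?S] e[of a ?S] e[of b ?S] by (simp add: lookup_add sum.distrib)
qed

lemma keys_add_nat: "Poly_Mapping.keys (a + b :: 'v \<Rightarrow>\<^sub>0 nat) = Poly_Mapping.keys a \<union> Poly_Mapping.keys b"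
  by (auto simp: in_keys_iff lookup_add)

lemma homog_in_1: "homog_in VS 0 1"
  by (auto simp: homog_in_def mdeg_def)

lemma homog_in_0: "homog_in VS j 0"
  by (auto simp: homog_in_def)

lemma homog_in_Var: "v \<in> VS \<Longrightarrow> homog_in VS 1 (Var v)"
  by (auto simp: homog_in_def mdeg_def Var_def)

lemma homog_in_add: "homog_in VS j p \<Longrightarrow> homog_in VS j q \<Longrightarrow> homog_in VS j (p + q)"
  unfolding homog_in_def using keys_add[of p q] by blast

lemma homog_in_uminus: "homog_in VS j p \<Longrightarrow> homog_in VS j (- p)"
  unfolding homog_in_def by (auto simp: in_keys_iff)

lemma homog_in_sum: "(\<And>i. i \<in> A \<Longrightarrow> homog_in VS j (f i)) \<Longrightarrow> homog_in VS j (sum f A)"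
  by (induction A rule: infinite_finite_induct) (auto simp: homog_in_0 homog_in_add)

lemma homog_in_mult: "homog_in VS i p \<Longrightarrow> homog_in VS j q \<Longrightarrow> homog_in VS (i + j) (p * q)"
  unfolding homog_in_def using keys_mult[of p q] by (fastforce simp: mdeg_add keys_add_nat)

lemma poly_mapping_sum_monomials:
  "p = (\<Sum>m\<in>Poly_Mapping.keys p. Poly_Mapping.single m (Poly_Mapping.lookup p m))"
  by (rule poly_mapping_eqI) (auto simp: lookup_sum lookup_single when_def in_keys_iff sum.delta)

lemma nat_monomial_induct [case_names zero add]:
  fixes m :: "'v \<Rightarrow>\<^sub>0 nat"
  assumes "P 0" "\<And>m v. P m \<Longrightarrow> P (Poly_Mapping.single v 1 + m)"
  shows "P m"
proof (induction "mdeg m" arbitrary: m)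
  case 0
  then have "m = 0" by (auto simp: mdeg_def in_keys_iff intro!: poly_mapping_eqI)
  then show ?case using assms by simp
next
  case (Suc n)
  then have "\<not> (\<forall>v\<in>Poly_Mapping.keys m. Poly_Mapping.lookup m v = 0)"
    unfolding mdeg_def by (metis nat.distinct(1) sum.neutral)
  then obtain v where v: "Poly_Mapping.lookup m v \<noteq> 0" by auto
  define m' where "m' = m - Poly_Mapping.single v 1"
  have m: "m = Poly_Mapping.single v 1 + m'"
    by (rule poly_mapping_eqI) (use v in \<open>auto simp: m'_def lookup_add lookup_minus lookup_single when_def\<close>)
  have "mdeg m = Suc (mdeg m')" unfolding m mdeg_add by (simp add: mdeg_def)
  then have "P m'" using Suc by auto
  then show ?case using assms(2) m by metis
qed

section \<open>Feichtner--Yuzvinsky monomials\<close>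

context loopless_matroid
begin

definition pos_flats :: "nat \<Rightarrow> 'a set set" where
  "pos_flats c = {F \<in> L. 1 \<le> rk F + c}"

lemma pos_flats_flat: "F \<in> pos_flats c \<Longrightarrow> F \<in> L"
  by (simp add: pos_flats_def)

lemma finite_pos_flats: "finite (pos_flats c)"
  using finite_flats by (simp add: pos_flats_def)

lemma pos_flats_up: "F \<in> pos_flats c \<Longrightarrow> F \<subseteq> H \<Longrightarrow> H \<in> L \<Longrightarrow> H \<in> pos_flats c"
  using flat_mono[of H F] by (auto simp: pos_flats_def)

text \<open>The flats of shifted rank 1 are the atoms for \<open>c = 0\<close> and the empty flat
  for \<open>c = 1\<close>; \<open>z_power\<close> starts from them.\<close>

lemma pos_flats_min:
  assumes "G \<in> pos_flats c" "c \<le> 1"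
  obtains B where "B \<in> pos_flats c" "B \<subseteq> G" "rk B + c = 1"
proof (cases "c = 0")
  case True
  then obtain i where i: "i \<in> G" using assms rk_empty by (cases "G = {}") (auto simp: pos_flats_def)
  then have "i \<in> E" using assms flat_subset pos_flats_flat by blast
  then have "cl {i} \<in> pos_flats c" "rk (cl {i}) + c = 1" "cl {i} \<subseteq> G"
    using rk_atom cl_singleton_subset_iff[of i G] assms True i by (auto simp: pos_flats_def)
  then show ?thesis using that by blast
next
  case False
  then have "{} \<in> pos_flats c" "rk {} + c = 1" using assms rk_empty empty_flat by (auto simp: pos_flats_def)
  then show ?thesis using that by blast
qed

text \<open>A prefix \<open>None\<close> stands for a virtual bottom element of rank \<open>0\<close>, so that \<open>fy None c\<close> describes
  the Feichtner--Yuzvinsky monomials: of the Chow ring for \<open>c = 0\<close>, and of the augmented Chow ring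
  for \<open>c = 1\<close>, where all ranks are shifted by one.\<close>

fun above :: "nat \<Rightarrow> 'a set option \<Rightarrow> 'a set set" where
  "above c None = pos_flats c"
| "above c (Some F) = {G \<in> pos_flats c. F \<subset> G}"

fun base :: "nat \<Rightarrow> 'a set option \<Rightarrow> nat" where
  "base c None = 0"
| "base c (Some F) = rk F + c"

fun fy :: "nat \<Rightarrow> 'a set option \<Rightarrow> ('a set \<times> nat) list \<Rightarrow> bool" where
  "fy c p [] = True"
| "fy c p ((G, a) # xs) = (G \<in> above c p \<and> 1 \<le> a \<and> base c p + a < rk G + c \<and> fy c (Some G) xs)"

text \<open>Lists serve recursion along a chain; multisets are the monomials themselves, which get
  multiplied and counted.\<close>

fun fy_mset :: "('a set \<times> nat) list \<Rightarrow> 'a set multiset" where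
  "fy_mset [] = {#}"
| "fy_mset ((G, a) # xs) = replicate_mset a G + fy_mset xs"

definition fy_lists :: "nat \<Rightarrow> 'a set option \<Rightarrow> nat \<Rightarrow> ('a set \<times> nat) list set" where
  "fy_lists c p n = {xs. fy c p xs \<and> size (fy_mset xs) = n}"

lemma above_subset: "above c p \<subseteq> pos_flats c"
  by (cases p) auto

lemma finite_above: "finite (above c p)"
  using finite_subset[OF above_subset finite_pos_flats] .

lemma above_Some_psubset: "G \<in> above c p \<Longrightarrow> above c (Some G) \<subset> above c p"
  by (cases p) auto

lemma base_less: "G \<in> above c p \<Longrightarrow> (\<And>F. p = Some F \<Longrightarrow> F \<in> L) \<Longrightarrow> base c p < rk G + c"
  using flat_strict_mono by (cases p) (auto simp: pos_flats_def)

lemma fy_unfold: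
  "{xs. fy c p xs} = insert [] (\<Union>G\<in>above c p. \<Union>a\<in>{1..<rk G + c - base c p}. (#) (G, a) ` {xs. fy c (Some G) xs})"
  (is "?A = ?B")
proof (rule set_eqI)
  fix xs show "xs \<in> ?A \<longleftrightarrow> xs \<in> ?B"
  proof (cases xs)
    case (Cons Ga ys)
    then show ?thesis by (cases Ga) (auto simp: image_iff)
  qed simp
qed

lemma finite_fy: "finite {xs. fy c p xs}"
proof (induction "card (above c p)" arbitrary: p rule: less_induct)
  case less
  have "finite {xs. fy c (Some G) xs}" if "G \<in> above c p" for G
    using less psubset_card_mono[OF finite_above above_Some_psubset[OF that]] by blast
  then show ?case by (subst fy_unfold) (auto simp: finite_above)
qed

lemma finite_fy_lists: "finite (fy_lists c p n)"
  using finite_subset[OF _ finite_fy[of c p]] by (auto simp: fy_lists_def)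

lemma fy_mset_above: "fy c p xs \<Longrightarrow> set_mset (fy_mset xs) \<subseteq> above c p"
proof (induction xs arbitrary: p)
  case (Cons Ga xs)
  obtain G a where [simp]: "Ga = (G, a)" by fastforce
  have "set_mset (fy_mset xs) \<subseteq> above c p"
    using Cons above_Some_psubset[of G c p] by fastforce
  then show ?case using Cons by auto
qed simp

lemma fy_mset_eq_empty: "fy c p xs \<Longrightarrow> fy_mset xs = {#} \<longleftrightarrow> xs = []"
  by (cases xs) auto

text \<open>The head of the list is recovered as the least flat of the multiset, its exponent as the
  multiplicity of that flat.\<close>

lemma fy_mset_inj: "fy c p xs \<Longrightarrow> fy c q ys \<Longrightarrow> fy_mset xs = fy_mset ys \<Longrightarrow> xs = ys"
proof (induction xs arbitrary: p q ys)
  case Nil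
  then show ?case using fy_mset_eq_empty[of c q ys] by simp
next
  case (Cons Ga xs)
  obtain G a where [simp]: "Ga = (G, a)" by fastforce
  have "ys \<noteq> []" using Cons fy_mset_eq_empty[of c p "Ga # xs"] by auto
  then obtain H b ys' where ys: "ys = (H, b) # ys'" by (cases ys) auto
  have above: "set_mset (fy_mset xs) \<subseteq> above c (Some G)" "set_mset (fy_mset ys') \<subseteq> above c (Some H)"
    using Cons fy_mset_above[of c "Some G" xs] fy_mset_above[of c "Some H" ys'] ys by auto
  have ge: "1 \<le> a" "1 \<le> b" using Cons ys by auto
  have eq: "replicate_mset a G + fy_mset xs = replicate_mset b H + fy_mset ys'" using Cons ys by simp
  then have "G \<in># replicate_mset b H + fy_mset ys'" "H \<in># replicate_mset a G + fy_mset xs"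
    using ge by (metis in_replicate_mset union_iff not_one_le_zero gr0I)+
  then have "H \<subseteq> G" "G \<subseteq> H" using above by (auto simp: psubset_eq split: if_splits)
  then have GH: "G = H" by simp
  have "count (replicate_mset a G + fy_mset xs) G = a" "count (replicate_mset b H + fy_mset ys') H = b"
    using above by (auto simp: count_eq_zero_iff)
  then have ab: "a = b" using eq GH by metis
  then have "fy_mset xs = fy_mset ys'" using eq GH by simp
  then have "xs = ys'" using Cons.IH[of "Some G" "Some H" ys'] Cons.prems ys by auto
  then show ?case using GH ab ys by simp
qed

text \<open>Exponents are strictly below the rank jumps, and the jumps telescope.\<close>

lemma fy_mset_size: "fy c p xs \<Longrightarrow> xs \<noteq> [] \<Longrightarrow> size (fy_mset xs) + base c p < rk E + c"
proof (induction xs arbitrary: p)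
  case (Cons Ga xs)
  obtain G a where [simp]: "Ga = (G, a)" by fastforce
  have "rk G \<le> rk E" using Cons.prems above_subset[of c p] pos_flats_flat[of G c] flat_mono[OF ground_flat] flat_subset[of G]
    by auto
  then show ?case using Cons by (cases "xs = []") force+
qed simp

end

section \<open>Monomials over multisets, and the relations shared by both Chow rings\<close>

definition mprod :: "('b \<Rightarrow> 'v mpoly) \<Rightarrow> 'b multiset \<Rightarrow> 'v mpoly" where
  "mprod X M = (\<Prod>F\<in>#M. X F)"

lemma mprod_simps [simp]: "mprod X {#} = 1" "mprod X (add_mset F M) = X F * mprod X M"
    "mprod X (M + N) = mprod X M * mprod X N" "mprod X (replicate_mset n F) = X F ^ n"
  by (simp_all add: mprod_def)

text \<open>Only additive closure of \<open>S\<close> is assumed, so that the lemma serves ideals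
  and the span \<open>fy_span\<close> alike; \<open>q\<close> absorbs the factors already
  expanded.\<close>

lemma power_sum_closure:
  assumes S: "0 \<in> S" "\<And>a b. a \<in> S \<Longrightarrow> b \<in> S \<Longrightarrow> a + b \<in> S"
    and "\<And>M. set_mset M \<subseteq> B \<Longrightarrow> size M = n \<Longrightarrow> q * mprod X M \<in> S"
  shows "q * (\<Sum>H\<in>B. X H) ^ n \<in> S"
  using assms(3)
proof (induction n arbitrary: q)
  case 0
  then show ?case using 0[of "{#}"] by simp
next
  case (Suc n)
  have sum: "sum f A \<in> S" if "\<And>x. x \<in> A \<Longrightarrow> f x \<in> S" for f and A :: "'b set"
    using that by (induction A rule: infinite_finite_induct) (auto simp: S)
  have "q * X H * (\<Sum>H\<in>B. X H) ^ n \<in> S" if "H \<in> B" for H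
  proof (rule Suc.IH)
    fix M assume "set_mset M \<subseteq> B" "size M = n"
    then show "q * X H * mprod X M \<in> S" using Suc.prems[of "add_mset H M"] that by (simp add: mult.assoc)
  qed
  then have "(\<Sum>H\<in>B. q * X H * (\<Sum>H\<in>B. X H) ^ n) \<in> S" by (rule sum)
  then show ?case by (simp add: sum_distrib_left sum_distrib_right mult.assoc)
qed

lemma (in mideal) binomial_middle:
  assumes "0 < n" "\<And>k. 0 < k \<Longrightarrow> k < n \<Longrightarrow> q * a ^ k * b ^ (n - k) \<in> I"
  shows "q * (a + b) ^ n - q * a ^ n - q * b ^ n \<in> I"
proof -
  have "(a + b) ^ n = (\<Sum>k\<le>n. of_nat (n choose k) * a ^ k * b ^ (n - k))" by (rule binomial_ring)
  also have "{..n} = insert 0 (insert n {0<..<n})" using assms by auto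
  also have "(\<Sum>k\<in>insert 0 (insert n {0<..<n}). of_nat (n choose k) * a ^ k * b ^ (n - k)) =
     b ^ n + (a ^ n + (\<Sum>k\<in>{0<..<n}. of_nat (n choose k) * a ^ k * b ^ (n - k)))"
    using assms by simp
  finally have "q * (a + b) ^ n - q * a ^ n - q * b ^ n = (\<Sum>k\<in>{0<..<n}. of_nat (n choose k) * (q * a ^ k * b ^ (n - k)))"
    by (simp add: sum_distrib_left algebra_simps)
  also have "\<dots> \<in> I" by (intro sum_mem mult_mem[of "q * a ^ _ * b ^ _"] assms(2)) auto
  finally show ?thesis .
qed

text \<open>\<open>linear\<close> carries the factor \<open>X F\<close> because in the augmented
  ring the sum over the \<open>H\<close> containing \<open>i\<close> is -y_i, which need not vanish
  but annihilates x_F. \<open>linear_min\<close> is the corresponding relation at the virtual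
  bottom, and \<open>X E\<close> is an element chosen to make it true. \<open>top_nonzero\<close> is
  the only non-vanishing input.\<close>

locale chow_quotient = loopless_matroid E rk + mideal I
  for E :: "'a set" and rk and I :: "'v mpoly set" +
  fixes c :: nat and X :: "'a set \<Rightarrow> 'v mpoly"
  assumes c_le: "c \<le> 1" and pos_ground: "1 \<le> rk E + c"
    and incomparable: "F \<in> pos_flats c \<Longrightarrow> G \<in> pos_flats c \<Longrightarrow> \<not> F \<subseteq> G \<Longrightarrow> \<not> G \<subseteq> F \<Longrightarrow> X F * X G \<in> I"
    and linear: "F \<in> pos_flats c \<Longrightarrow> i \<in> E \<Longrightarrow> i \<notin> F \<Longrightarrow> X F * (\<Sum>H\<in>{H\<in>pos_flats c. i \<in> H}. X H) \<in> I"
    and linear_min: "G \<in> pos_flats c \<Longrightarrow> rk G + c = 1 \<Longrightarrow> (\<Sum>H\<in>{H\<in>pos_flats c. G \<subseteq> H}. X H) \<in> I"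
    and top_nonzero: "X E ^ (rk E + c - 1) \<notin> I"
begin

abbreviation "P \<equiv> pos_flats c"

lemma ground_pos: "E \<in> P"
  using ground_flat pos_ground by (simp add: pos_flats_def)

lemma pos_subset: "F \<in> P \<Longrightarrow> F \<subseteq> E"
  using pos_flats_flat flat_subset by blast

definition z :: "'a set \<Rightarrow> 'v mpoly" where
  "z G = (\<Sum>H\<in>{H\<in>P. G \<subseteq> H}. X H)"

definition Q :: "'a set option \<Rightarrow> 'v mpoly" where
  "Q p = (case p of None \<Rightarrow> 1 | Some F \<Rightarrow> X F)"

definition valid :: "'a set option \<Rightarrow> bool" where
  "valid p \<longleftrightarrow> (\<forall>F. p = Some F \<longrightarrow> F \<in> P)"

text \<open>A flat \<open>K\<close> above \<open>G\<close> but not above \<open>H\<close> is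
  incomparable to \<open>H\<close>, so \<open>X H\<close> sees only the flats above the
  join.\<close>

lemma X_z_join:
  assumes "H \<in> P" "G \<in> P" "\<not> G \<subseteq> H"
  shows "X H * z G - X H * z (join H G) \<in> I"
proof -
  have L: "H \<in> L" "G \<in> L" using assms pos_flats_flat by auto
  have eq: "{K\<in>P. join H G \<subseteq> K} = {K\<in>P. G \<subseteq> K} - {K\<in>P. G \<subseteq> K \<and> \<not> H \<subseteq> K}"
    using join_subset_iff[OF L] pos_flats_flat by auto
  have "z (join H G) = z G - (\<Sum>K\<in>{K\<in>P. G \<subseteq> K \<and> \<not> H \<subseteq> K}. X K)"
    unfolding z_def eq by (rule sum_diff) (auto simp: finite_pos_flats)
  then have "X H * z G - X H * z (join H G) = (\<Sum>K\<in>{K\<in>P. G \<subseteq> K \<and> \<not> H \<subseteq> K}. X H * X K)"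
    by (simp add: right_diff_distrib sum_distrib_left)
  also have "\<dots> \<in> I" using assms by (intro sum_mem incomparable) auto
  finally show ?thesis .
qed

lemma join_rank_bound:
  assumes "H \<in> P" "G \<in> P" "\<not> G \<subseteq> H" "B \<subseteq> H \<inter> G" "B \<in> L"
  shows "join H G \<in> P" "H \<subset> join H G" "rk (join H G) - rk H \<le> rk G - rk B"
proof -
  have L: "H \<in> L" "G \<in> L" using assms pos_flats_flat by auto
  show "join H G \<in> P" using pos_flats_up[OF assms(1) join_upper(1)] join_flat L by auto
  show "H \<subset> join H G" using join_upper[OF L] assms(3) by auto
  have "rk B \<le> rk (H \<inter> G)" using flat_mono[OF flat_inter[OF L]] assms by auto
  then show "rk (join H G) - rk H \<le> rk G - rk B" using rk_join[OF L] by simp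
qed

text \<open>With \<open>i\<close> in \<open>G - F\<close>, \<open>linear\<close> trades one factor
  \<open>z G\<close> for minus the sum over the \<open>H\<close> that contain \<open>i\<close> but
  not \<open>G\<close>. Only an \<open>H\<close> above \<open>F\<close> matters; then
  \<open>H \<inter> G\<close> contains \<open>F\<close> and \<open>i\<close>, so by semimodularity
  \<open>join H G\<close> lies at most \<open>n\<close> ranks above \<open>H\<close>, and the
  induction applies to this pair.\<close>

lemma X_z_power:
  "F \<in> P \<Longrightarrow> G \<in> P \<Longrightarrow> F \<subset> G \<Longrightarrow> rk G - rk F \<le> n \<Longrightarrow> X F * z G ^ n \<in> I"
proof (induction n arbitrary: F G)
  case 0
  then show ?case using flat_strict_mono[of F G] pos_flats_flat by fastforce
next
  case (Suc n)
  then have L: "F \<in> L" "G \<in> L" using pos_flats_flat by auto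
  obtain i where i: "i \<in> G" "i \<notin> F" using Suc by auto
  then have iE: "i \<in> E" using L flat_subset by auto
  let ?R = "{H\<in>P. i \<in> H \<and> \<not> G \<subseteq> H}"
  have eq: "{H\<in>P. G \<subseteq> H} = {H\<in>P. i \<in> H} - ?R" using i by auto
  have zG: "z G = (\<Sum>H\<in>{H\<in>P. i \<in> H}. X H) - (\<Sum>H\<in>?R. X H)"
    unfolding z_def eq by (rule sum_diff) (auto simp: finite_pos_flats)
  have "X F * z G ^ Suc n = z G ^ n * (X F * (\<Sum>H\<in>{H\<in>P. i \<in> H}. X H)) - (\<Sum>H\<in>?R. X F * X H * z G ^ n)"
  proof -
    have "X F * z G ^ Suc n = z G ^ n * (X F * z G)" by simp
    also have "\<dots> = z G ^ n * (X F * ((\<Sum>H\<in>{H\<in>P. i \<in> H}. X H) - (\<Sum>H\<in>?R. X H)))" by (subst (2) zG) simp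
    finally show ?thesis by (simp add: algebra_simps sum_distrib_left)
  qed
  moreover have "z G ^ n * (X F * (\<Sum>H\<in>{H\<in>P. i \<in> H}. X H)) \<in> I"
    using linear[OF Suc.prems(1) iE i(2)] by (rule mult_mem)
  moreover have "X F * X H * z G ^ n \<in> I" if H: "H \<in> ?R" for H
  proof (cases "F \<subseteq> H")
    case True
    let ?B = "cl (insert i F)"
    have B: "?B \<in> L" "rk ?B = rk F + 1" using cl_insert_flat[OF L(1) iE i(2)] by auto
    have "?B \<subseteq> H \<inter> G" using True H i Suc.prems(3) L pos_flats_flat by (intro cl_least flat_inter) auto
    then have K: "join H G \<in> P" "H \<subset> join H G" "rk (join H G) - rk H \<le> n"
      using join_rank_bound[of H G ?B] H Suc.prems B by auto
    have "X H * z (join H G) ^ n \<in> I" using Suc.IH[OF _ K] H by auto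
    moreover have "X H * z G ^ n - X H * z (join H G) ^ n \<in> I"
      using X_z_join[of H G] H Suc.prems by (intro power_cong) auto
    ultimately have "X H * z G ^ n \<in> I" using mem_cong by blast
    then show ?thesis using mult_mem[of _ "X F"] by (simp add: mult.assoc)
  next
    case False
    then show ?thesis using H i Suc.prems by (intro mult_mem' incomparable) auto
  qed
  ultimately show ?case by (simp only:) (intro diff_mem sum_mem, auto)
qed

text \<open>The argument of \<open>X_z_power\<close> at the virtual bottom:
  \<open>z B \<in> I\<close> for some \<open>B\<close> of shifted rank 1 takes the place of
  \<open>linear\<close>.\<close>

lemma z_power:
  assumes "G \<in> P" "rk G + c \<le> n" shows "z G ^ n \<in> I"
proof -
  obtain B where B: "B \<in> P" "B \<subseteq> G" "rk B + c = 1" using pos_flats_min[OF assms(1) c_le] .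
  then have BL: "B \<in> L" using pos_flats_flat by auto
  have "1 \<le> n" using assms by (auto simp: pos_flats_def)
  then obtain m where m: "n = Suc m" by (cases n) auto
  let ?R = "{H\<in>P. B \<subseteq> H \<and> \<not> G \<subseteq> H}"
  have eq: "{H\<in>P. G \<subseteq> H} = {H\<in>P. B \<subseteq> H} - ?R" using B by auto
  have zG: "z G = z B - (\<Sum>H\<in>?R. X H)"
    unfolding z_def eq by (rule sum_diff) (auto simp: finite_pos_flats)
  have "z G ^ n = z G ^ m * z B - (\<Sum>H\<in>?R. X H * z G ^ m)"
  proof -
    have "z G ^ n = z G ^ m * z G" using m by simp
    also have "\<dots> = z G ^ m * (z B - (\<Sum>H\<in>?R. X H))" by (subst (2) zG) simp
    finally show ?thesis by (simp add: algebra_simps sum_distrib_left)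
  qed
  moreover have "z B \<in> I" unfolding z_def using linear_min B by blast
  moreover have "X H * z G ^ m \<in> I" if H: "H \<in> ?R" for H
  proof -
    have K: "join H G \<in> P" "H \<subset> join H G" "rk (join H G) - rk H \<le> rk G - rk B"
      using join_rank_bound[of H G B] H assms B BL by auto
    moreover have "rk G - rk B \<le> m" using assms B m by auto
    ultimately have "X H * z (join H G) ^ m \<in> I" using X_z_power[OF _ K(1,2)] H by auto
    moreover have "X H * z G ^ m - X H * z (join H G) ^ m \<in> I"
      using X_z_join[of H G] H assms by (intro power_cong) auto
    ultimately show ?thesis using mem_cong by blast
  qed
  ultimately show ?thesis by (simp only:) (rule diff_mem[OF mult_mem sum_mem], assumption, blast)
qed

lemma Q_z_power: "valid p \<Longrightarrow> G \<in> above c p \<Longrightarrow> Q p * z G ^ (rk G + c - base c p) \<in> I"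
  using z_power[of G] X_z_power[of _ G] by (cases p) (auto simp: Q_def valid_def)

lemma mprod_incomparable:
  assumes "F \<in># M" "G \<in># M" "set_mset M \<subseteq> P" "\<not> F \<subseteq> G" "\<not> G \<subseteq> F"
  shows "mprod X M \<in> I"
proof -
  obtain M1 where M1: "M = add_mset F M1" using assms multi_member_split by metis
  then have "G \<in># M1" using assms by auto
  then obtain M2 where "M1 = add_mset G M2" using multi_member_split by metis
  then have "mprod X M = X F * X G * mprod X M2" using M1 by (simp add: mult.assoc)
  moreover have "X F * X G \<in> I" using assms by (intro incomparable) auto
  ultimately show ?thesis using mult_mem' by simp
qed

end

section \<open>Straightening: the Feichtner--Yuzvinsky monomials span\<close>

context chow_quotient
begin

definition fy_span :: "'a set option \<Rightarrow> nat \<Rightarrow> 'v mpoly set" where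
  "fy_span p n = {q. \<exists>k. q - Q p * (\<Sum>xs\<in>fy_lists c p n. Const (k xs) * mprod X (fy_mset xs)) \<in> I}"

lemma fy_span_ideal: "q \<in> I \<Longrightarrow> q \<in> fy_span p n"
  unfolding fy_span_def by (intro CollectI exI[of _ "\<lambda>_. 0"]) (simp add: Const_0)

lemma fy_span_add:
  assumes "a \<in> fy_span p n" "b \<in> fy_span p n" shows "a + b \<in> fy_span p n"
proof -
  obtain k k' where "a - Q p * (\<Sum>xs\<in>fy_lists c p n. Const (k xs) * mprod X (fy_mset xs)) \<in> I"
    "b - Q p * (\<Sum>xs\<in>fy_lists c p n. Const (k' xs) * mprod X (fy_mset xs)) \<in> I"
    using assms by (auto simp: fy_span_def)
  from add_mem[OF this] show ?thesis
    unfolding fy_span_def by (intro CollectI exI[of _ "\<lambda>x. k x + k' x"])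
      (simp add: Const_add sum.distrib algebra_simps)
qed

lemma fy_span_Const:
  assumes "a \<in> fy_span p n" shows "Const r * a \<in> fy_span p n"
proof -
  obtain k where "a - Q p * (\<Sum>xs\<in>fy_lists c p n. Const (k xs) * mprod X (fy_mset xs)) \<in> I"
    using assms by (auto simp: fy_span_def)
  from mult_mem[OF this, of "Const r"] show ?thesis
    unfolding fy_span_def by (intro CollectI exI[of _ "\<lambda>x. r * k x"])
      (simp add: Const_mult right_diff_distrib sum_distrib_left ac_simps)
qed

lemma fy_span_0: "0 \<in> fy_span p n"
  using fy_span_ideal zero_mem by blast

lemma fy_span_sum: "(\<And>x. x \<in> A \<Longrightarrow> f x \<in> fy_span p n) \<Longrightarrow> sum f A \<in> fy_span p n"
  by (induction A rule: infinite_finite_induct) (auto simp: fy_span_0 fy_span_add)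

lemma fy_span_uminus: "a \<in> fy_span p n \<Longrightarrow> - a \<in> fy_span p n"
  using fy_span_Const[of a p n "-1"] by (simp add: Const_uminus Const_1)

lemma fy_span_diff: "a \<in> fy_span p n \<Longrightarrow> b \<in> fy_span p n \<Longrightarrow> a - b \<in> fy_span p n"
  using fy_span_add[of a p n "- b"] fy_span_uminus[of b] by simp

lemma fy_span_of_nat: "a \<in> fy_span p n \<Longrightarrow> of_nat m * a \<in> fy_span p n"
  by (induction m) (auto simp: fy_span_0 distrib_right fy_span_add)

lemma fy_span_basis:
  assumes "xs \<in> fy_lists c p n" shows "Q p * mprod X (fy_mset xs) \<in> fy_span p n"
proof -
  have "(\<Sum>ys\<in>fy_lists c p n. Const (if ys = xs then 1 else 0) * mprod X (fy_mset ys)) =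
     (\<Sum>ys\<in>fy_lists c p n. if ys = xs then mprod X (fy_mset ys) else 0)"
    by (intro sum.cong) (auto simp: Const_0 Const_1)
  also have "\<dots> = mprod X (fy_mset xs)" using assms finite_fy_lists by simp
  finally show ?thesis unfolding fy_span_def using zero_mem
    by (intro CollectI exI[of _ "\<lambda>ys. if ys = xs then 1 else 0"]) simp
qed

lemma valid_above: "G \<in> above c p \<Longrightarrow> valid (Some G)"
  using above_subset[of c p] by (auto simp: valid_def)

lemma above_trans: "G \<in> above c p \<Longrightarrow> H \<in> above c (Some G) \<Longrightarrow> H \<in> above c p"
  by (cases p) auto

lemma sum_rank_le: "set_mset M \<subseteq> P \<Longrightarrow> (\<Sum>F\<in>#M. rk F) \<le> size M * rk E"
  using pos_subset rk_mono by (induction M) (auto intro: add_mono)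

lemma sum_rank_above:
  "set_mset M \<subseteq> above c (Some G) \<Longrightarrow> G \<in> P \<Longrightarrow> size M * rk G + size M \<le> (\<Sum>F\<in>#M. rk F)"
proof (induction M)
  case (add F M)
  then have "rk G < rk F" by (intro flat_strict_mono) (auto intro: pos_flats_flat)
  then show ?case using add by simp
qed simp

lemma chain_split:
  assumes "M \<noteq> {#}" "set_mset M \<subseteq> above c p"
    and chain: "\<And>F G. F \<in># M \<Longrightarrow> G \<in># M \<Longrightarrow> F \<subseteq> G \<or> G \<subseteq> F"
  obtains G a R where "G \<in> above c p" "0 < a" "M = replicate_mset a G + R" "set_mset R \<subseteq> above c (Some G)"
proof -
  have "rk ` set_mset M \<noteq> {}" "finite (rk ` set_mset M)" using assms by auto
  then have "Min (rk ` set_mset M) \<in> rk ` set_mset M" by (rule Min_in[rotated])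
  then obtain G where G: "G \<in># M" "rk G = Min (rk ` set_mset M)" by auto
  have sub: "set_mset M \<subseteq> P" using assms above_subset by blast
  have min: "rk G \<le> rk H" if "H \<in># M" for H using that G by simp
  have "G \<subset> H" if H: "H \<in># M" "H \<noteq> G" for H
    using chain[OF G(1) H(1)] min[OF H(1)] flat_strict_mono[of H G] H G sub pos_flats_flat
    by (metis leD psubsetI subset_iff)
  then have R: "set_mset (filter_mset (\<lambda>H. H \<noteq> G) M) \<subseteq> above c (Some G)" using sub by auto
  have "M = replicate_mset (count M G) G + filter_mset (\<lambda>H. H \<noteq> G) M"
    using multiset_partition[of M "\<lambda>H. H = G"] by (simp add: filter_eq_replicate_mset)
  then show ?thesis using that[of G "count M G"] G R assms by auto
qed

text \<open>Straightening: \<open>X_p * z_G ^ d \<in> I\<close> rewrites \<open>X_G ^ d\<close> into monomials of larger total rank.\<close>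

lemma mprod_in_fy_span: "valid p \<Longrightarrow> set_mset M \<subseteq> above c p \<Longrightarrow> Q p * mprod X M \<in> fy_span p (size M)"
proof (induction "size M" arbitrary: M p rule: less_induct)
  case less
  note outer = less.hyps
  \<comment> \<open>The outer induction lowers the degree; this inner one, at fixed degree, lowers
    the distance of the rank sum from its maximum \<open>size M * rk E\<close>.\<close>
  have "Q p * mprod X N \<in> fy_span p (size M)" if "size N = size M" "set_mset N \<subseteq> above c p" for N
    using that
  proof (induction "size M * rk E - (\<Sum>F\<in>#N. rk F)" arbitrary: N rule: less_induct)
    case less
    note inner = less.hyps and N = less.prems
    have NP: "set_mset N \<subseteq> P" using N above_subset by blast
    consider "N = {#}" | "\<exists>F G. F \<in># N \<and> G \<in># N \<and> \<not> F \<subseteq> G \<and> \<not> G \<subseteq> F"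
      | "N \<noteq> {#}" "\<And>F G. F \<in># N \<Longrightarrow> G \<in># N \<Longrightarrow> F \<subseteq> G \<or> G \<subseteq> F" by blast
    then show ?case
    proof cases
      case 1
      have "[] \<in> fy_lists c p 0" by (simp add: fy_lists_def)
      from fy_span_basis[OF this] show ?thesis using N 1 by (metis fy_mset.simps(1) size_empty)
    next
      case 2
      then have "mprod X N \<in> I" using mprod_incomparable[OF _ _ NP] by blast
      then show ?thesis using fy_span_ideal mult_mem by blast
    next
      case 3
      obtain G a R where GR: "G \<in> above c p" "0 < a" "N = replicate_mset a G + R" "set_mset R \<subseteq> above c (Some G)"
        using chain_split[OF 3(1) N(2) 3(2)] by blast
      have GP: "G \<in> P" using GR(1) above_subset by blast
      define d where "d = rk G + c - base c p"
      have d: "0 < d" "base c p + d = rk G + c"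
        using base_less[OF GR(1)] \<open>valid p\<close> pos_flats_flat unfolding d_def valid_def by force+
      show ?thesis
      proof (cases "a < d")
        case True
        \<comment> \<open>The exponent of \<open>G\<close> is admissible. One of its
          \<open>a\<close> factors serves as the prefix for the rest \<open>R\<close>, which has
          smaller degree.\<close>
        have "Q (Some G) * mprod X R \<in> fy_span (Some G) (size R)"
          using GR N by (intro outer valid_above[OF GR(1)]) auto
        then obtain k where k: "X G * mprod X R - X G * (\<Sum>xs\<in>fy_lists c (Some G) (size R). Const (k xs) * mprod X (fy_mset xs)) \<in> I"
          unfolding fy_span_def Q_def by auto
        let ?S = "\<Sum>xs\<in>fy_lists c (Some G) (size R). Const (k xs) * mprod X (fy_mset xs)"
        obtain a' where a': "a = Suc a'" using GR by (cases a) auto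
        have "Q p * mprod X N = (Q p * X G ^ a') * (X G * mprod X R - X G * ?S)
           + (\<Sum>xs\<in>fy_lists c (Some G) (size R). Const (k xs) * (Q p * mprod X (fy_mset ((G, a) # xs))))"
          using GR a' by (simp add: right_diff_distrib sum_distrib_left ac_simps)
        moreover have "(Q p * X G ^ a') * (X G * mprod X R - X G * ?S) \<in> fy_span p (size M)"
          using k by (intro fy_span_ideal mult_mem)
        moreover have "Q p * mprod X (fy_mset ((G, a) # xs)) \<in> fy_span p (size M)" if "xs \<in> fy_lists c (Some G) (size R)" for xs
          using that GR True d N(1) by (intro fy_span_basis) (auto simp: fy_lists_def)
        ultimately show ?thesis by (simp only:) (intro fy_span_add fy_span_sum fy_span_Const)
      next
        case False
        \<comment> \<open>The exponent is too large. Expanding \<open>(X G + u) ^ d\<close>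
          expresses \<open>X G ^ d\<close> by terms in which \<open>d - k > 0\<close> copies of
          \<open>G\<close> give way to flats strictly above it, each raising the rank sum by at
          least one.\<close>
        define u where "u = (\<Sum>H\<in>above c (Some G). X H)"
        have "{H\<in>P. G \<subseteq> H} = insert G (above c (Some G))" using GP by auto
        then have zG: "z G = X G + u" unfolding z_def u_def by (simp add: finite_pos_flats)
        define T where "T = X G ^ (a - d) * mprod X R"
        have "X G ^ a = X G ^ d * X G ^ (a - d)" using False by (simp add: power_add[symmetric])
        then have QN: "Q p * mprod X N = T * (Q p * X G ^ d)" using GR by (simp add: T_def ac_simps)
        have "z G ^ d = (\<Sum>k\<le>d. of_nat (d choose k) * X G ^ k * u ^ (d - k))"
          unfolding zG by (rule binomial_ring)
        also have "{..d} = insert d {..<d}" by auto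
        finally have zd: "X G ^ d = z G ^ d - (\<Sum>k<d. of_nat (d choose k) * X G ^ k * u ^ (d - k))" by simp
        have "Q p * mprod X N = T * (Q p * z G ^ d) -
            (\<Sum>k<d. of_nat (d choose k) * ((Q p * T * X G ^ k) * u ^ (d - k)))"
          unfolding QN zd by (simp add: right_diff_distrib sum_distrib_left ac_simps)
        moreover have "T * (Q p * z G ^ d) \<in> fy_span p (size M)"
          unfolding d_def by (rule fy_span_ideal[OF mult_mem[OF Q_z_power[OF \<open>valid p\<close> GR(1)]]])
        moreover have "(Q p * T * X G ^ k) * u ^ (d - k) \<in> fy_span p (size M)" if k: "k < d" for k
          unfolding u_def
        proof (rule power_sum_closure[OF fy_span_0 fy_span_add])
          fix K assume K: "set_mset K \<subseteq> above c (Some G)" "size K = d - k"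
          let ?N = "replicate_mset (a - d + k) G + R + K"
          have "above c (Some G) \<subseteq> above c p" using above_trans[OF GR(1)] by blast
          then have Ns: "size ?N = size M" "set_mset ?N \<subseteq> above c p"
            using GR K k N(1) False by (auto simp del: above.simps split: if_splits)
          then have "set_mset ?N \<subseteq> P" using above_subset by blast
          then have "(\<Sum>F\<in>#?N. rk F) \<le> size M * rk E" using sum_rank_le[of ?N] Ns by metis
          moreover have "(\<Sum>F\<in>#N. rk F) < (\<Sum>F\<in>#?N. rk F)"
          proof -
            have "a * rk G < (a - d + k) * rk G + (\<Sum>F\<in>#K. rk F)"
            proof -
              have "a * rk G = (a - d + k) * rk G + (d - k) * rk G"
                using False k by (simp add: distrib_right[symmetric])
              also have "\<dots> < (a - d + k) * rk G + ((d - k) * rk G + (d - k))" using k by simp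
              also have "(d - k) * rk G + (d - k) \<le> (\<Sum>F\<in>#K. rk F)" using sum_rank_above[OF K(1) GP] K(2) by simp
              finally show ?thesis by simp
            qed
            then show ?thesis using GR(3) by simp
          qed
          ultimately have "Q p * mprod X ?N \<in> fy_span p (size M)" by (intro inner Ns) linarith
          moreover have "Q p * mprod X ?N = Q p * T * X G ^ k * mprod X K"
            by (simp add: T_def power_add ac_simps)
          ultimately show "Q p * T * X G ^ k * mprod X K \<in> fy_span p (size M)" by simp
        qed
        ultimately show ?thesis by (simp only:) (intro fy_span_diff fy_span_sum fy_span_of_nat, auto)
      qed
    qed
  qed
  then show ?case using less.prems by simp
qed

text \<open>Vanishing is read off from spanning: by \<open>fy_mset_size\<close> no admissible list
  above \<open>F\<close> reaches this degree.\<close>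

lemma mprod_vanish_above:
  assumes "F \<in> P" "F \<noteq> E" "set_mset M \<subseteq> above c (Some F)" "rk E - rk F \<le> size M"
  shows "X F * mprod X M \<in> I"
proof -
  have "F \<subset> E" using assms pos_subset by auto
  then have "rk F < rk E" using flat_strict_mono assms pos_flats_flat ground_flat by auto
  have "fy_lists c (Some F) (size M) = {}"
  proof -
    have False if "xs \<in> fy_lists c (Some F) (size M)" for xs
    proof (cases "xs = []")
      case True
      then show ?thesis using that \<open>rk F < rk E\<close> assms by (auto simp: fy_lists_def)
    next
      case False
      then show ?thesis using that fy_mset_size[of c "Some F" xs] assms by (auto simp: fy_lists_def)
    qed
    then show ?thesis by blast
  qed
  then show ?thesis using mprod_in_fy_span[of "Some F" M] assms by (auto simp: fy_span_def Q_def valid_def)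
qed

text \<open>Too few factors at or below \<open>C\<close> leave at least \<open>rk E - rk C\<close>
  factors strictly above it, and those vanish together with one factor \<open>X C\<close>. This
  count is the source of the triangularity.\<close>

lemma mprod_vanish:
  assumes N: "set_mset N \<subseteq> P" "rk E + c \<le> size N + 1"
    and C: "C \<in># N" "C \<noteq> E" "size (filter_mset (\<lambda>H. H \<subseteq> C) N) < rk C + c"
  shows "mprod X N \<in> I"
proof (cases "\<forall>H\<in>#N. H \<subseteq> C \<or> C \<subseteq> H")
  case False
  then show ?thesis using mprod_incomparable[OF C(1) _ N(1)] by blast
next
  case True
  let ?lo = "filter_mset (\<lambda>H. H \<subseteq> C) N" and ?hi = "filter_mset (\<lambda>H. \<not> H \<subseteq> C) N"
  have part: "N = ?lo + ?hi" by (rule multiset_partition)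
  have "C \<in># ?lo" using C by simp
  then obtain lo where lo: "?lo = add_mset C lo" using multi_member_split by metis
  have "X C * mprod X ?hi \<in> I"
  proof (rule mprod_vanish_above)
    show "set_mset ?hi \<subseteq> above c (Some C)" using True N C by auto
    have "size N = size ?lo + size ?hi" using part size_union by metis
    then show "rk E - rk C \<le> size ?hi" using N(2) C(3) by linarith
  qed (use C N in auto)
  moreover have "mprod X N = mprod X lo * (X C * mprod X ?hi)"
    by (subst part, subst lo) (simp add: ac_simps)
  ultimately show ?thesis using mult_mem by simp
qed

end

section \<open>Linear independence\<close>

lemma replicate_mset_add: "replicate_mset (m + n) x = replicate_mset m x + replicate_mset n x"
  by (induction m) auto

lemma filter_replicate_mset:
  "filter_mset P (replicate_mset n x) = (if P x then replicate_mset n x else {#})"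
  by (induction n) auto

context loopless_matroid
begin

text \<open>The recursion stops at \<open>E\<close>, whose exponent is settled by the padding in
  \<open>test_mset\<close> and not by a rank jump.\<close>

fun dual_mset :: "nat \<Rightarrow> nat \<Rightarrow> ('a set \<times> nat) list \<Rightarrow> 'a set multiset" where
  "dual_mset c b [] = {#}"
| "dual_mset c b ((G, a) # xs) =
     (if G = E then {#} else replicate_mset (rk G + c - b - a) G + dual_mset c (rk G + c) xs)"

fun full_mset :: "nat \<Rightarrow> nat \<Rightarrow> ('a set \<times> nat) list \<Rightarrow> 'a set multiset" where
  "full_mset c b [] = {#}"
| "full_mset c b ((G, a) # xs) =
     (if G = E then {#} else replicate_mset (rk G + c - b) G + full_mset c (rk G + c) xs)"

definition test_mset :: "nat \<Rightarrow> ('a set \<times> nat) list \<Rightarrow> 'a set multiset" where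
  "test_mset c xs = dual_mset c 0 xs + replicate_mset (rk E + c - 1 - size (fy_mset xs) - size (dual_mset c 0 xs)) E"

lemma above_ground: "above c (Some E) = {}"
  using flat_subset pos_flats_flat by auto

lemma fy_ground: "fy c (Some E) xs \<Longrightarrow> xs = []"
  by (cases xs) (auto simp: above_ground simp del: above.simps)

text \<open>Ensures that the truncated subtraction in \<open>test_mset\<close> is exact.\<close>

lemma dual_mset_size:
  "fy c p xs \<Longrightarrow> base c p < rk E + c \<Longrightarrow>
    size (dual_mset c (base c p) xs) + size (fy_mset xs) + base c p + 1 \<le> rk E + c"
proof (induction xs arbitrary: p)
  case (Cons Ga xs)
  obtain G a where [simp]: "Ga = (G, a)" by fastforce
  show ?case
  proof (cases "G = E")
    case True
    then have "xs = []" using Cons fy_ground by auto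
    then show ?thesis using Cons True by auto
  next
    case False
    have "G \<in> above c p" using Cons.prems by simp
    then have "G \<in> L" using above_subset pos_flats_flat by blast
    then have "G \<subset> E" using False flat_subset by auto
    then have "rk G < rk E" using flat_strict_mono \<open>G \<in> L\<close> ground_flat by auto
    then have "size (dual_mset c (rk G + c) xs) + size (fy_mset xs) + (rk G + c) + 1 \<le> rk E + c"
      using Cons.IH[of "Some G"] Cons.prems by auto
    then show ?thesis using Cons.prems False by auto
  qed
qed simp

lemma fy_dual_mset:
  "fy c p xs \<Longrightarrow> fy_mset xs + dual_mset c (base c p) xs
     = full_mset c (base c p) xs + replicate_mset (count (fy_mset xs) E) E"
proof (induction xs arbitrary: p)
  case (Cons Ga xs)
  obtain G a where [simp]: "Ga = (G, a)" by fastforce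
  show ?case
  proof (cases "G = E")
    case True
    then have "xs = []" using Cons fy_ground by auto
    then show ?thesis using True by auto
  next
    case False
    have IH: "fy_mset xs + dual_mset c (rk G + c) xs
       = full_mset c (rk G + c) xs + replicate_mset (count (fy_mset xs) E) E"
      using Cons.IH[of "Some G"] Cons.prems by simp
    have "rk G + c - base c p = a + (rk G + c - base c p - a)" using Cons.prems by auto
    then have r: "replicate_mset (rk G + c - base c p) G = replicate_mset a G + replicate_mset (rk G + c - base c p - a) G"
      by (metis replicate_mset_add)
    have "fy_mset (Ga # xs) + dual_mset c (base c p) (Ga # xs)
      = replicate_mset a G + replicate_mset (rk G + c - base c p - a) G + (fy_mset xs + dual_mset c (rk G + c) xs)"
      using False by simp
    then show ?thesis unfolding IH r[symmetric] using False by simp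
  qed
qed simp

text \<open>In the product of a monomial with its own test monomial the exponents below
  \<open>E\<close> are the full rank jumps, whatever the original exponents were.\<close>

lemma fy_test_mset:
  assumes "fy c None xs" "1 \<le> rk E + c"
  shows "fy_mset xs + test_mset c xs
    = full_mset c 0 xs + replicate_mset (rk E + c - 1 - size (full_mset c 0 xs)) E"
proof -
  have e: "fy_mset xs + dual_mset c 0 xs = full_mset c 0 xs + replicate_mset (count (fy_mset xs) E) E"
    using fy_dual_mset[OF assms(1)] by simp
  then have s: "size (fy_mset xs) + size (dual_mset c 0 xs) = size (full_mset c 0 xs) + count (fy_mset xs) E"
    by (metis size_union size_replicate_mset)
  have le: "size (dual_mset c 0 xs) + size (fy_mset xs) + 1 \<le> rk E + c"
    using dual_mset_size[OF assms(1)] assms(2) unfolding base.simps by linarith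
  have k: "rk E + c - 1 - size (full_mset c 0 xs) = count (fy_mset xs) E +
     (rk E + c - 1 - size (fy_mset xs) - size (dual_mset c 0 xs))" using s le by linarith
  show ?thesis unfolding test_mset_def k replicate_mset_add
    using e by (metis add.assoc)
qed

lemma test_mset_size:
  assumes "fy c None xs" "1 \<le> rk E + c"
  shows "size (fy_mset xs) + size (test_mset c xs) = rk E + c - 1"
proof -
  have "size (dual_mset c 0 xs) + size (fy_mset xs) + 1 \<le> rk E + c"
    using dual_mset_size[OF assms(1)] assms(2) unfolding base.simps by linarith
  then show ?thesis by (simp add: test_mset_def)
qed

lemma dual_mset_above: "fy c p xs \<Longrightarrow> set_mset (dual_mset c b xs) \<subseteq> above c p"
proof (induction xs arbitrary: p b)
  case (Cons Ga xs)
  obtain G a where [simp]: "Ga = (G, a)" by fastforce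
  have "set_mset (dual_mset c (rk G + c) xs) \<subseteq> above c p"
    using Cons above_Some_psubset[of G c p] by fastforce
  then show ?case using Cons by auto
qed simp

text \<open>Exponents and complementary exponents add up to the rank jumps, which telescope to the
  shifted rank of \<open>G\<close>. \<open>G\<close> occurs in the dual because its exponent is
  strictly below its jump.\<close>

lemma dual_mset_count_le:
  "fy c p xs \<Longrightarrow> G \<in># fy_mset xs \<Longrightarrow> G \<noteq> E \<Longrightarrow> G \<in># dual_mset c (base c p) xs \<and>
    size (filter_mset (\<lambda>H. H \<subseteq> G) (dual_mset c (base c p) xs))
     + size (filter_mset (\<lambda>H. H \<subseteq> G) (fy_mset xs)) + base c p = rk G + c"
proof (induction xs arbitrary: p)
  case (Cons Fa xs)
  obtain F a where [simp]: "Fa = (F, a)" by fastforce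
  have fy: "fy c (Some F) xs" "1 \<le> a" "base c p + a < rk F + c" using Cons.prems by auto
  have above: "set_mset (fy_mset xs) \<subseteq> above c (Some F)" "set_mset (dual_mset c (rk F + c) xs) \<subseteq> above c (Some F)"
    using fy_mset_above dual_mset_above fy by blast+
  show ?case
  proof (cases "G = F")
    case True
    have "filter_mset (\<lambda>H. H \<subseteq> G) (fy_mset xs) = {#}" "filter_mset (\<lambda>H. H \<subseteq> G) (dual_mset c (rk F + c) xs) = {#}"
      using above True by auto
    then show ?thesis using True Cons.prems fy by (auto simp: filter_replicate_mset)
  next
    case False
    then have G: "G \<in># fy_mset xs" using Cons.prems by (auto split: if_splits)
    then have FG: "F \<subset> G" "G \<in> L" using above pos_flats_flat by auto
    then have "F \<noteq> E" using flat_subset by auto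
    have IH: "G \<in># dual_mset c (rk F + c) xs \<and> size (filter_mset (\<lambda>H. H \<subseteq> G) (dual_mset c (rk F + c) xs))
     + size (filter_mset (\<lambda>H. H \<subseteq> G) (fy_mset xs)) + (rk F + c) = rk G + c"
      using Cons.IH[OF fy(1) G] Cons.prems by simp
    then show ?thesis using \<open>F \<noteq> E\<close> FG fy by (auto simp: filter_replicate_mset)
  qed
qed simp

text \<open>The counting hypothesis says that, with both chains sorted, each entry of
  \<open>A\<close> is contained in the corresponding entry of \<open>B\<close>. The induction strips
  the largest entry from both.\<close>

lemma rank_sum_dominance:
  assumes "set_mset A \<subseteq> L" "set_mset B \<subseteq> L" "size A = size B"
    and "\<And>F G. F \<in># A + B \<Longrightarrow> G \<in># A + B \<Longrightarrow> F \<subseteq> G \<or> G \<subseteq> F"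
    and "\<And>G. G \<in># B \<Longrightarrow> size (filter_mset (\<lambda>H. H \<subseteq> G) B) \<le> size (filter_mset (\<lambda>H. H \<subseteq> G) A)"
  shows "(\<Sum>F\<in>#A. rk F) \<le> (\<Sum>F\<in>#B. rk F) \<and> ((\<Sum>F\<in>#A. rk F) = (\<Sum>F\<in>#B. rk F) \<longrightarrow> A = B)"
  using assms
proof (induction "size A" arbitrary: A B)
  case 0
  then show ?case by auto
next
  case (Suc n)
  have max: "\<exists>S. S \<in># M \<and> (\<forall>H\<in>#M. H \<subseteq> S)"
    if "M \<noteq> {#}" "\<And>F G. F \<in># M \<Longrightarrow> G \<in># M \<Longrightarrow> F \<subseteq> G \<or> G \<subseteq> F" for M :: "'a set multiset"
    using that
  proof (induction M)
    case (add x M)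
    show ?case
    proof (cases "M = {#}")
      case False
      then obtain S where S: "S \<in># M" "\<forall>H\<in>#M. H \<subseteq> S" using add by (metis union_iff add_mset_add_single)
      then have "x \<subseteq> S \<or> S \<subseteq> x" using add.prems by simp
      then show ?thesis
      proof
        assume "x \<subseteq> S"
        then show ?thesis using S by (intro exI[of _ S]) auto
      next
        assume "S \<subseteq> x"
        then show ?thesis using S by (intro exI[of _ x]) auto
      qed
    qed simp
  qed simp
  have ne: "A \<noteq> {#}" "B \<noteq> {#}" using Suc(2,5) by auto
  obtain S where S: "S \<in># A" "\<And>H. H \<in># A \<Longrightarrow> H \<subseteq> S" using max[OF ne(1)] Suc.prems(4) by (metis union_iff)
  obtain T where T: "T \<in># B" "\<And>H. H \<in># B \<Longrightarrow> H \<subseteq> T" using max[OF ne(2)] Suc.prems(4) by (metis union_iff)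
  obtain A' where A': "A = add_mset S A'" using S multi_member_split by metis
  obtain B' where B': "B = add_mset T B'" using T multi_member_split by metis
  have full: "filter_mset (\<lambda>H. H \<subseteq> U) M = M" if "\<And>H. H \<in># M \<Longrightarrow> H \<subseteq> U" for U :: "'a set" and M
    using that by (auto simp: filter_mset_eq_conv)
  \<comment> \<open>At the top \<open>T\<close> of \<open>B\<close> the hypothesis counts all of
    \<open>B\<close>, hence all of \<open>A\<close>, so the top of \<open>A\<close> lies in
    \<open>T\<close>.\<close>
  have "size B \<le> size (filter_mset (\<lambda>H. H \<subseteq> T) A)" using Suc.prems(5)[OF T(1)] full[OF T(2)] by simp
  then have "filter_mset (\<lambda>H. H \<subseteq> T) A = A"
    using Suc.prems(3) by (metis multiset_filter_subset mset_subset_size subset_mset.le_neq_trans leD)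
  then have ST: "S \<subseteq> T" using S by (metis filter_mset_eq_conv set_mset_filter mem_Collect_eq)
  have L: "S \<in> L" "T \<in> L" using S T Suc.prems by auto
  have IH: "(\<Sum>F\<in>#A'. rk F) \<le> (\<Sum>F\<in>#B'. rk F) \<and> ((\<Sum>F\<in>#A'. rk F) = (\<Sum>F\<in>#B'. rk F) \<longrightarrow> A' = B')"
  proof (rule Suc.hyps(1))
    fix G assume G: "G \<in># B'"
    have cA: "size (filter_mset (\<lambda>H. H \<subseteq> G) A) = (if S \<subseteq> G then 1 else 0) + size (filter_mset (\<lambda>H. H \<subseteq> G) A')"
      unfolding A' by simp
    have cB: "size (filter_mset (\<lambda>H. H \<subseteq> G) B) = (if T \<subseteq> G then 1 else 0) + size (filter_mset (\<lambda>H. H \<subseteq> G) B')"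
      unfolding B' by simp
    have le: "size (filter_mset (\<lambda>H. H \<subseteq> G) B) \<le> size (filter_mset (\<lambda>H. H \<subseteq> G) A)" using Suc.prems(5) G B' by auto
    show "size (filter_mset (\<lambda>H. H \<subseteq> G) B') \<le> size (filter_mset (\<lambda>H. H \<subseteq> G) A')"
    proof (cases "S \<subseteq> G")
      case True
      then have "filter_mset (\<lambda>H. H \<subseteq> G) A' = A'" using S A' by (intro full) auto
      moreover have "size (filter_mset (\<lambda>H. H \<subseteq> G) B') \<le> size B'" by (simp add: size_filter_mset_lesseq)
      ultimately show ?thesis using Suc.prems(3) A' B' by simp
    next
      case False
      then show ?thesis using cA cB le by (auto split: if_splits)
    qed
  qed (use Suc A' B' in auto)
  have r: "rk S \<le> rk T" using ST L flat_mono by auto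
  have "S = T" if "rk S = rk T" using that ST L flat_strict_mono[of S T] by (auto simp: psubset_eq)
  then show ?case using IH r A' B' by auto
qed

end

section \<open>The triangular pairing in top degree\<close>

context chow_quotient
begin

lemma fy_mset_pos: "fy c None xs \<Longrightarrow> set_mset (fy_mset xs) \<subseteq> P"
  using fy_mset_above[of c None] by simp

lemma test_mset_pos: "fy c None xs \<Longrightarrow> set_mset (test_mset c xs) \<subseteq> P"
  using dual_mset_above[of c None xs 0] ground_pos by (auto simp: test_mset_def split: if_splits)

text \<open>By \<open>mprod_vanish\<close> a nonzero product has at least \<open>rk G + c\<close>
  factors at or below each \<open>G \<noteq> E\<close> of \<open>ys\<close>. The test monomial
  supplies exactly this number minus the count in \<open>ys\<close>, so \<open>xs\<close> has at
  least as many factors at or below \<open>G\<close> as \<open>ys\<close>.\<close>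

lemma pairing_triangular:
  assumes xs: "xs \<in> fy_lists c None j" and ys: "ys \<in> fy_lists c None j"
    and nz: "mprod X (fy_mset xs + test_mset c ys) \<notin> I"
  shows "(\<Sum>F\<in>#fy_mset xs. rk F) \<le> (\<Sum>F\<in>#fy_mset ys. rk F) \<and>
    ((\<Sum>F\<in>#fy_mset xs. rk F) = (\<Sum>F\<in>#fy_mset ys. rk F) \<longrightarrow> fy_mset xs = fy_mset ys)"
proof (rule rank_sum_dominance)
  let ?N = "fy_mset xs + test_mset c ys"
  have fy: "fy c None xs" "fy c None ys" "size (fy_mset xs) = j" "size (fy_mset ys) = j"
    using xs ys by (auto simp: fy_lists_def)
  have N: "set_mset ?N \<subseteq> P" using fy_mset_pos test_mset_pos fy by simp
  have size: "size ?N + 1 = rk E + c" using test_mset_size[OF fy(2) pos_ground] fy pos_ground by simp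
  show L: "set_mset (fy_mset xs) \<subseteq> L" "set_mset (fy_mset ys) \<subseteq> L" using fy_mset_pos fy pos_flats_flat by blast+
  show "size (fy_mset xs) = size (fy_mset ys)" using fy by simp
  \<comment> \<open>Flats of \<open>ys\<close> reappear in its test monomial, so non-vanishing makes
    the flats of \<open>xs\<close> and of \<open>ys\<close> comparable.\<close>
  have yt: "G \<in># test_mset c ys \<or> G = E" if "G \<in># fy_mset ys" for G
    using dual_mset_count_le[OF fy(2) that] by (auto simp: test_mset_def)
  have in_N: "F \<in># ?N \<or> F = E" if "F \<in># fy_mset xs + fy_mset ys" for F using that yt by auto
  show "F \<subseteq> G \<or> G \<subseteq> F" if "F \<in># fy_mset xs + fy_mset ys" "G \<in># fy_mset xs + fy_mset ys" for F G
  proof -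
    have "F \<subseteq> E" "G \<subseteq> E" using that L flat_subset by auto
    then show ?thesis using in_N[OF that(1)] in_N[OF that(2)] mprod_incomparable[OF _ _ N] nz by blast
  qed
  fix G assume G: "G \<in># fy_mset ys"
  show "size (filter_mset (\<lambda>H. H \<subseteq> G) (fy_mset ys)) \<le> size (filter_mset (\<lambda>H. H \<subseteq> G) (fy_mset xs))"
  proof (cases "G = E")
    case True
    have "filter_mset (\<lambda>H. H \<subseteq> E) (fy_mset xs) = fy_mset xs" "filter_mset (\<lambda>H. H \<subseteq> E) (fy_mset ys) = fy_mset ys"
      using L flat_subset by (auto simp: filter_mset_eq_conv)
    then show ?thesis using True fy by simp
  next
    case False
    have "\<not> size (filter_mset (\<lambda>H. H \<subseteq> G) ?N) < rk G + c"
      using mprod_vanish[OF N _ _ False] size yt[OF G] False nz by auto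
    moreover have "\<not> E \<subseteq> G" using G L flat_subset False by auto
    then have "filter_mset (\<lambda>H. H \<subseteq> G) (test_mset c ys) = filter_mset (\<lambda>H. H \<subseteq> G) (dual_mset c 0 ys)"
      by (simp add: test_mset_def filter_replicate_mset)
    ultimately show ?thesis using dual_mset_count_le[OF fy(2) G False] by simp
  qed
qed

end

context chow_quotient
begin

text \<open>\<open>N\<close> holds the full powers of the flats passed so far, the last being
  \<open>F\<close>. Its size is exactly the shifted rank of \<open>F\<close>, which makes the counts
  for \<open>mprod_vanish\<close> come out sharp.\<close>

definition prefix_mset :: "'a set option \<Rightarrow> 'a set multiset \<Rightarrow> bool" where
  "prefix_mset p N \<longleftrightarrow> (case p of None \<Rightarrow> N = {#}
     | Some F \<Rightarrow> F \<in># N \<and> F \<noteq> E \<and> size N = rk F + c \<and> (\<forall>H\<in>#N. H \<in> P \<and> H \<subseteq> F))"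

text \<open>In the expansion of \<open>(X E + (X G + u)) ^ d\<close>, which is
  \<open>z G ^ d\<close> and is killed by \<open>Q p\<close>, all terms but \<open>X E ^ d\<close>
  and \<open>X G ^ d\<close> vanish by counting, so these two are opposite. Stating an equivalence
  of memberships absorbs the sign.\<close>

lemma prefix_step:
  assumes N: "prefix_mset p N" "valid p" and G: "G \<in> above c p" "G \<noteq> E"
    and d: "d = rk G + c - base c p" and s: "size N + d + s + 1 = rk E + c"
  shows "mprod X (N + replicate_mset d G + replicate_mset s E) \<in> I
     \<longleftrightarrow> mprod X (N + replicate_mset (d + s) E) \<in> I"
proof -
  have GP: "G \<in> P" using G above_subset by blast
  have dp: "0 < d" "base c p + d = rk G + c"
    using base_less[OF G(1)] \<open>valid p\<close> pos_flats_flat unfolding d valid_def by force+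
  have sN: "size N = base c p" using N by (cases p) (auto simp: prefix_mset_def)
  have NP: "set_mset N \<subseteq> P" using N by (cases p) (auto simp: prefix_mset_def)
  obtain q0 where q0: "mprod X N = q0 * Q p"
  proof (cases p)
    case None
    then show ?thesis using that[of "mprod X N"] by (simp add: Q_def)
  next
    case (Some F)
    then have "F \<in># N" using N(1) by (simp add: prefix_mset_def)
    then obtain N' where "N = add_mset F N'" using multi_member_split by metis
    then show ?thesis using that[of "mprod X N'"] Some by (simp add: Q_def mult.commute)
  qed
  define q where "q = mprod X N * X E ^ s"
  define B where "B = {H\<in>P. G \<subset> H \<and> H \<noteq> E}"
  define u where "u = (\<Sum>H\<in>B. X H)"
  have zG: "z G = X E + (X G + u)"
  proof -
    have "{H\<in>P. G \<subseteq> H} = insert E (insert G B)" using GP G ground_pos pos_subset by (auto simp: B_def)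
    moreover have "finite B" "E \<notin> insert G B" "G \<notin> B" using G finite_pos_flats by (auto simp: B_def)
    ultimately show ?thesis by (simp add: z_def u_def)
  qed
  have not_EH: "\<not> E \<subseteq> H" if "H \<in> P" "H \<noteq> E" for H using that pos_subset by blast
  have vanish: "mprod X (N + M + replicate_mset i E) \<in> I"
    if "H \<in># M" "H \<in> P" "H \<noteq> E" "set_mset M \<subseteq> P" "size N + size M + i + 1 = rk E + c" "size N + size M < rk H + c"
    for M H i
  proof (rule mprod_vanish[where C = H])
    show "set_mset (N + M + replicate_mset i E) \<subseteq> P" using NP that ground_pos by (auto split: if_splits)
    have "size (filter_mset (\<lambda>K. K \<subseteq> H) (N + M)) \<le> size (N + M)" by (rule size_filter_mset_lesseq)
    then show "size (filter_mset (\<lambda>K. K \<subseteq> H) (N + M + replicate_mset i E)) < rk H + c"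
      using that not_EH[of H] by (simp add: filter_replicate_mset)
  qed (use that in auto)
  have rB: "rk G < rk H" if "H \<in> B" for H
    using that flat_strict_mono[of G H] pos_flats_flat[of G c] pos_flats_flat[of H c] GP by (simp add: B_def)
  have GB: "H \<in> P \<and> H \<noteq> E \<and> rk G \<le> rk H" if "H \<in> insert G B" for H
    using that GP G rB by (auto simp: B_def dest: less_imp_le)
  have XGu: "X G + u = (\<Sum>H\<in>insert G B. X H)"
    unfolding u_def using finite_pos_flats by (subst sum.insert) (auto simp: B_def)
  \<comment> \<open>Moving \<open>k > 0\<close> factors to \<open>E\<close> leaves fewer than
    \<open>rk G + c\<close> factors at or below any flat of \<open>M\<close>.\<close>
  have 1: "q * X E ^ k * (X G + u) ^ (d - k) \<in> I" if k: "0 < k" "k < d" for k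
    unfolding XGu
  proof (rule power_sum_closure[OF zero_mem add_mem])
    fix M assume M: "set_mset M \<subseteq> insert G B" "size M = d - k"
    then obtain H where H: "H \<in># M" using k by (cases M) auto
    then have HB: "H \<in> insert G B" using M by blast
    have "mprod X (N + M + replicate_mset (s + k) E) \<in> I"
    proof (rule vanish[OF H])
      show "set_mset M \<subseteq> P" using M GB by blast
      show "size N + size M + (s + k) + 1 = rk E + c" using M k s by simp
      show "size N + size M < rk H + c" using M k dp sN GB[OF HB] by linarith
    qed (use GB[OF HB] in auto)
    then show "q * X E ^ k * mprod X M \<in> I" by (simp add: q_def power_add ac_simps)
  qed
  \<comment> \<open>Here all \<open>d\<close> factors remain, but together with \<open>N\<close>
    they number only \<open>rk G + c\<close>, which is less than the shifted rank of an
    \<open>H\<close> strictly above \<open>G\<close>.\<close>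
  have 2: "q * X G ^ k * u ^ (d - k) \<in> I" if k: "k < d" for k
    unfolding u_def
  proof (rule power_sum_closure[OF zero_mem add_mem])
    fix M assume M: "set_mset M \<subseteq> B" "size M = d - k"
    then obtain H where H: "H \<in># M" using k by (cases M) auto
    then have HB: "H \<in> B" using M by auto
    have MP: "set_mset (replicate_mset k G + M) \<subseteq> P" using M GP by (auto simp: B_def split: if_splits)
    have "mprod X (N + (replicate_mset k G + M) + replicate_mset s E) \<in> I"
    proof (rule vanish[OF _ _ _ MP])
      show "H \<in># replicate_mset k G + M" using H by simp
      show "size N + size (replicate_mset k G + M) + s + 1 = rk E + c" using M k s by simp
      show "size N + size (replicate_mset k G + M) < rk H + c" using M k dp sN rB[OF HB] by simp
    qed (use HB in \<open>auto simp: B_def\<close>)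
    then show "q * X G ^ k * mprod X M \<in> I" by (simp add: q_def ac_simps)
  qed
  have z: "q * z G ^ d \<in> I"
  proof -
    have "q * z G ^ d = (q0 * X E ^ s) * (Q p * z G ^ d)" by (simp add: q_def q0 ac_simps)
    then show ?thesis using mult_mem[OF Q_z_power[OF N(2) G(1)]] d by simp
  qed
  have zE: "q * z G ^ d - q * X E ^ d - q * (X G + u) ^ d \<in> I"
    unfolding zG using 1 dp by (intro binomial_middle) auto
  have Gu: "q * (X G + u) ^ d - q * X G ^ d - q * u ^ d \<in> I"
    using 2 dp by (intro binomial_middle) auto
  have "q * u ^ d \<in> I" using 2[of 0] dp by simp
  from diff_mem[OF diff_mem[OF diff_mem[OF z zE] Gu] this]
  have sum: "q * X G ^ d - (- (q * X E ^ d)) \<in> I" by (simp add: algebra_simps)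
  have "q * X G ^ d \<in> I \<longleftrightarrow> - (q * X E ^ d) \<in> I" using mem_cong[OF sum] .
  also have "\<dots> \<longleftrightarrow> q * X E ^ d \<in> I" using uminus_mem[of "q * X E ^ d"] uminus_mem[of "- (q * X E ^ d)"] by auto
  finally show ?thesis by (simp add: q_def power_add ac_simps)
qed

text \<open>\<open>prefix_step\<close> turns the flats of the chain into \<open>E\<close> one after
  another, the largest first, until a pure power of \<open>X E\<close> follows
  \<open>N\<close>.\<close>

lemma full_mset_nonzero:
  "fy c p ys \<Longrightarrow> valid p \<Longrightarrow> prefix_mset p N \<Longrightarrow> base c p < rk E + c \<Longrightarrow>
   mprod X (N + full_mset c (base c p) ys
      + replicate_mset (rk E + c - 1 - size N - size (full_mset c (base c p) ys)) E) \<in> I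
   \<longleftrightarrow> mprod X (N + replicate_mset (rk E + c - 1 - size N) E) \<in> I"
proof (induction ys arbitrary: p N)
  case (Cons Ga ys)
  obtain G a where [simp]: "Ga = (G, a)" by fastforce
  show ?case
  proof (cases "G = E")
    case True
    then show ?thesis by simp
  next
    case False
    have G: "G \<in> above c p" "fy c (Some G) ys" "1 \<le> a" "base c p + a < rk G + c" using Cons.prems by auto
    then have GP: "G \<in> P" using above_subset by blast
    then have "G \<subset> E" using pos_subset False by auto
    then have rG: "rk G < rk E" using GP pos_flats_flat flat_strict_mono ground_flat by auto
    define d where "d = rk G + c - base c p"
    have dp: "0 < d" "base c p + d = rk G + c" using G by (auto simp: d_def)
    have sN: "size N = base c p" using Cons.prems by (cases p) (auto simp: prefix_mset_def)
    let ?N = "N + replicate_mset d G"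
    have N': "prefix_mset (Some G) ?N"
      using Cons.prems(3) G(1) GP False dp sN by (cases p) (auto simp: prefix_mset_def split: if_splits)
    have "full_mset c (base c p) (Ga # ys) = replicate_mset d G + full_mset c (rk G + c) ys"
      using False by (simp add: d_def)
    then have "mprod X (N + full_mset c (base c p) (Ga # ys)
       + replicate_mset (rk E + c - 1 - size N - size (full_mset c (base c p) (Ga # ys))) E)
      = mprod X (?N + full_mset c (base c (Some G)) ys
       + replicate_mset (rk E + c - 1 - size ?N - size (full_mset c (base c (Some G)) ys)) E)"
      by (simp add: ac_simps)
    also have "\<dots> \<in> I \<longleftrightarrow> mprod X (?N + replicate_mset (rk E + c - 1 - size ?N) E) \<in> I"
      using G N' GP rG by (intro Cons.IH) (auto simp: valid_def)
    also have "\<dots> \<longleftrightarrow> mprod X (N + replicate_mset (d + (rk E + c - 1 - size ?N)) E) \<in> I"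
      using Cons.prems G False d_def dp rG sN by (intro prefix_step) auto
    also have "d + (rk E + c - 1 - size ?N) = rk E + c - 1 - size N"
      using dp rG sN by simp
    finally show ?thesis .
  qed
qed simp

text \<open>Among the lists with nonzero coefficient take \<open>ys\<close> of least rank sum and
  multiply by its test monomial. By triangularity a surviving list has at most the rank sum of
  \<open>ys\<close>, so only \<open>ys\<close> itself survives.\<close>

lemma fy_independent:
  assumes "(\<Sum>xs\<in>fy_lists c None j. Const (k xs) * mprod X (fy_mset xs)) \<in> I" "xs \<in> fy_lists c None j"
  shows "k xs = 0"
proof (rule ccontr)
  assume "k xs \<noteq> 0"
  let ?A = "{xs \<in> fy_lists c None j. k xs \<noteq> 0}" and ?\<phi> = "\<lambda>xs. \<Sum>F\<in>#fy_mset xs. rk F"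
  have "finite ?A" "?A \<noteq> {}" using finite_fy_lists assms(2) \<open>k xs \<noteq> 0\<close> by auto
  then obtain ys where ys: "ys \<in> ?A" "\<And>xs. xs \<in> ?A \<Longrightarrow> ?\<phi> ys \<le> ?\<phi> xs"
    using ex_min_if_finite[of "?\<phi> ` ?A"] by (auto simp: not_less)
  let ?t = "mprod X (test_mset c ys)"
  have fy: "fy c None ys" using ys by (auto simp: fy_lists_def)
  have "Const (k zs) * mprod X (fy_mset zs) * ?t \<in> I" if zs: "zs \<in> fy_lists c None j" "zs \<noteq> ys" for zs
  proof (cases "k zs = 0")
    case True
    then show ?thesis by (simp add: Const_0 zero_mem)
  next
    case False
    have "mprod X (fy_mset zs + test_mset c ys) \<in> I"
    proof (rule ccontr)
      assume nz: "mprod X (fy_mset zs + test_mset c ys) \<notin> I"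
      then have "fy_mset zs = fy_mset ys"
        using pairing_triangular[OF zs(1) _ nz] ys(1) ys(2)[of zs] zs False by auto
      then show False using fy_mset_inj[of c None zs None ys] fy zs by (auto simp: fy_lists_def)
    qed
    then have "Const (k zs) * mprod X (fy_mset zs + test_mset c ys) \<in> I" by (rule mult_mem)
    then show ?thesis by (simp add: mult.assoc)
  qed
  then have rest: "(\<Sum>zs\<in>fy_lists c None j - {ys}. Const (k zs) * mprod X (fy_mset zs) * ?t) \<in> I" by (intro sum_mem) auto
  have all: "(\<Sum>zs\<in>fy_lists c None j. Const (k zs) * mprod X (fy_mset zs) * ?t) \<in> I"
    using mult_mem'[OF assms(1), of ?t] by (simp add: sum_distrib_right)
  have "(\<Sum>zs\<in>fy_lists c None j. Const (k zs) * mprod X (fy_mset zs) * ?t)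
    = Const (k ys) * mprod X (fy_mset ys) * ?t + (\<Sum>zs\<in>fy_lists c None j - {ys}. Const (k zs) * mprod X (fy_mset zs) * ?t)"
    using ys by (intro sum.remove finite_fy_lists) auto
  with diff_mem[OF all rest] have "Const (k ys) * mprod X (fy_mset ys) * ?t \<in> I" by simp
  then have "Const (1 / k ys) * (Const (k ys) * mprod X (fy_mset ys) * ?t) \<in> I" by (rule mult_mem)
  moreover have "Const (1 / k ys) * (Const (k ys) * mprod X (fy_mset ys) * ?t) = mprod X (fy_mset ys + test_mset c ys)"
    using ys by (simp add: mult.assoc[symmetric] Const_mult[symmetric] Const_1)
  ultimately have "mprod X (full_mset c 0 ys + replicate_mset (rk E + c - 1 - size (full_mset c 0 ys)) E) \<in> I"
    using fy_test_mset[OF fy pos_ground] by simp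
  moreover have "base c None < rk E + c" unfolding base.simps using pos_ground by linarith
  ultimately have "mprod X (replicate_mset (rk E + c - 1) E) \<in> I"
    using full_mset_nonzero[of None ys "{#}"] fy by (simp add: valid_def prefix_mset_def)
  then show False using top_nonzero by simp
qed

lemma quot_dim_eq_card:
  assumes I: "I = ideal_gen Gs"
    and hom: "\<And>F. F \<in> P \<Longrightarrow> homog_in VS 1 (X F)"
    and gen: "\<And>v. v \<in> VS \<Longrightarrow> \<exists>k. Var v - (\<Sum>F\<in>P. Const (k F) * X F) \<in> I"
  shows "quot_dim VS Gs j = card (fy_lists c None j)"
proof (rule quot_dim_eqI[where b = "\<lambda>xs. mprod X (fy_mset xs)"])
  show "finite (fy_lists c None j)" by (rule finite_fy_lists)
next
  fix xs assume xs: "xs \<in> fy_lists c None j"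
  have "homog_in VS (size M) (mprod X M)" if "set_mset M \<subseteq> P" for M
    using that
  proof (induction M)
    case (add F M)
    then show ?case using homog_in_mult[of VS 1 "X F" "size M" "mprod X M"] hom by simp
  qed (simp add: homog_in_1)
  then show "homog_in VS j (mprod X (fy_mset xs))" using xs fy_mset_pos by (auto simp: fy_lists_def)
next
  fix k xs assume "(\<Sum>x\<in>fy_lists c None j. Const (k x) * mprod X (fy_mset x)) \<in> ideal_gen Gs" "xs \<in> fy_lists c None j"
  then show "k xs = 0" using fy_independent I by blast
next
  fix q assume q: "homog_in VS j q"
  \<comment> \<open>Variables are replaced one at a time by combinations of the \<open>X F\<close>;
    \<open>M\<close> collects the factors already replaced.\<close>
  have key: "Poly_Mapping.single m 1 * mprod X M \<in> fy_span None (mdeg m + size M)"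
    if "Poly_Mapping.keys m \<subseteq> VS" "set_mset M \<subseteq> P" for m M
    using that
  proof (induction m arbitrary: M rule: nat_monomial_induct)
    case zero
    then show ?case using mprod_in_fy_span[of None M] by (simp add: valid_def Q_def mdeg_def)
  next
    case (add m v)
    then have vm: "v \<in> VS" "Poly_Mapping.keys m \<subseteq> VS" by (auto simp: keys_add_nat)
    obtain k where k: "Var v - (\<Sum>F\<in>P. Const (k F) * X F) \<in> I" using gen[OF vm(1)] by blast
    let ?m = "Poly_Mapping.single m 1 :: 'v mpoly"
    have s: "Poly_Mapping.single (Poly_Mapping.single v 1 + m) 1 = Var v * ?m"
      by (simp add: Var_def mult_single)
    have "Var v * ?m * mprod X M = ?m * mprod X M * (Var v - (\<Sum>F\<in>P. Const (k F) * X F))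
       + (\<Sum>F\<in>P. Const (k F) * (?m * mprod X (add_mset F M)))"
      by (simp add: algebra_simps sum_distrib_left)
    moreover have "?m * mprod X M * (Var v - (\<Sum>F\<in>P. Const (k F) * X F)) \<in> fy_span None (Suc (mdeg m + size M))"
      by (rule fy_span_ideal[OF mult_mem[OF k]])
    moreover have "?m * mprod X (add_mset F M) \<in> fy_span None (Suc (mdeg m + size M))" if "F \<in> P" for F
      using add.IH[of "add_mset F M"] vm add.prems that by simp
    ultimately have "Var v * ?m * mprod X M \<in> fy_span None (Suc (mdeg m + size M))"
      by (simp only:) (intro fy_span_add fy_span_sum fy_span_Const)
    moreover have "mdeg (Poly_Mapping.single v 1 + m) = Suc (mdeg m)" by (simp add: mdeg_add) (simp add: mdeg_def)
    ultimately show ?case unfolding s by simp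
  qed
  have eq: "q = (\<Sum>m\<in>Poly_Mapping.keys q. Const (Poly_Mapping.lookup q m) * Poly_Mapping.single m 1)"
    using poly_mapping_sum_monomials[of q] by (simp add: Const_def mult_single)
  have "Poly_Mapping.single m 1 \<in> fy_span None j" if "m \<in> Poly_Mapping.keys q" for m
    using key[of m "{#}"] q that by (auto simp: homog_in_def)
  then have "(\<Sum>m\<in>Poly_Mapping.keys q. Const (Poly_Mapping.lookup q m) * Poly_Mapping.single m 1) \<in> fy_span None j"
    by (intro fy_span_sum fy_span_Const)
  then have "q \<in> fy_span None j"
    using eq[symmetric] by (rule back_subst[of "\<lambda>x. x \<in> fy_span None j"])
  then obtain k where "q - (\<Sum>xs\<in>fy_lists c None j. Const (k xs) * mprod X (fy_mset xs)) \<in> I"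
    by (auto simp: fy_span_def Q_def)
  then show "\<exists>k. q - (\<Sum>xs\<in>fy_lists c None j. Const (k xs) * mprod X (fy_mset xs)) \<in> ideal_gen Gs"
    using I by blast
qed

end

section \<open>The degree map\<close>

definition subst_monom :: "('v \<Rightarrow> 'w mpoly) \<Rightarrow> ('v \<Rightarrow>\<^sub>0 nat) \<Rightarrow> 'w mpoly" where
  "subst_monom g m = (\<Prod>v\<in>Poly_Mapping.keys m. g v ^ Poly_Mapping.lookup m v)"

definition subst :: "('v \<Rightarrow> 'w mpoly) \<Rightarrow> 'v mpoly \<Rightarrow> 'w mpoly" where
  "subst g p = (\<Sum>m\<in>Poly_Mapping.keys p. Const (Poly_Mapping.lookup p m) * subst_monom g m)"

lemma subst_monom_superset:
  "finite S \<Longrightarrow> Poly_Mapping.keys m \<subseteq> S \<Longrightarrow> subst_monom g m = (\<Prod>v\<in>S. g v ^ Poly_Mapping.lookup m v)"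
  unfolding subst_monom_def by (rule prod.mono_neutral_left) (auto simp: in_keys_iff)

lemma subst_monom_add: "subst_monom g (a + b) = subst_monom g a * subst_monom g b"
proof -
  let ?S = "Poly_Mapping.keys a \<union> Poly_Mapping.keys b"
  have "Poly_Mapping.keys (a + b) \<subseteq> ?S" by (rule keys_add)
  then show ?thesis
    using subst_monom_superset[of ?S "a + b" g] subst_monom_superset[of ?S a g] subst_monom_superset[of ?S b g]
    by (simp add: lookup_add power_add prod.distrib)
qed

lemma subst_superset:
  "finite S \<Longrightarrow> Poly_Mapping.keys p \<subseteq> S \<Longrightarrow> subst g p = (\<Sum>m\<in>S. Const (Poly_Mapping.lookup p m) * subst_monom g m)"
  unfolding subst_def by (rule sum.mono_neutral_left) (auto simp: in_keys_iff Const_0)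

lemma subst_add: "subst g (p + q) = subst g p + subst g q"
proof -
  let ?S = "Poly_Mapping.keys p \<union> Poly_Mapping.keys q"
  have "Poly_Mapping.keys (p + q) \<subseteq> ?S" by (rule keys_add)
  then show ?thesis
    using subst_superset[of ?S "p + q" g] subst_superset[of ?S p g] subst_superset[of ?S q g]
    by (simp add: lookup_add Const_add distrib_right sum.distrib)
qed

lemma subst_0: "subst g 0 = 0"
  by (simp add: subst_def)

lemma subst_sum: "subst g (\<Sum>i\<in>A. f i) = (\<Sum>i\<in>A. subst g (f i))"
  by (induction A rule: infinite_finite_induct) (auto simp: subst_0 subst_add)

lemma subst_single: "subst g (Poly_Mapping.single m a) = Const a * subst_monom g m"
  by (simp add: subst_def Const_0)

lemma subst_Var: "subst g (Var v) = g v"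
  by (simp add: Var_def subst_single Const_1 subst_monom_def)

lemma subst_mult: "subst g (p * q) = subst g p * subst g q"
proof -
  have "p * q = (\<Sum>m\<in>Poly_Mapping.keys p. \<Sum>n\<in>Poly_Mapping.keys q.
     Poly_Mapping.single (m + n) (Poly_Mapping.lookup p m * Poly_Mapping.lookup q n))"
    by (subst (1) poly_mapping_sum_monomials[of p], subst (1) poly_mapping_sum_monomials[of q])
      (simp add: sum_product mult_single)
  then have "subst g (p * q) = (\<Sum>m\<in>Poly_Mapping.keys p. \<Sum>n\<in>Poly_Mapping.keys q.
     (Const (Poly_Mapping.lookup p m) * subst_monom g m) * (Const (Poly_Mapping.lookup q n) * subst_monom g n))"
    by (simp add: subst_sum subst_single Const_mult subst_monom_add ac_simps)
  then show ?thesis by (simp add: subst_def sum_product)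
qed

lemma subst_1: "subst g 1 = 1"
  using subst_single[of g 0 1] by (simp add: subst_monom_def Const_1)

lemma subst_power: "subst g (p ^ n) = subst g p ^ n"
  by (induction n) (auto simp: subst_1 subst_mult)

lemma subst_uminus: "subst g (- p) = - subst g p"
  using subst_add[of g p "- p"] by (simp add: subst_0 add_eq_0_iff)

lemma subst_diff: "subst g (p - q) = subst g p - subst g q"
  using subst_add[of g p "- q"] by (simp add: subst_uminus)

lemma (in mideal) subst_ideal_gen:
  assumes "\<And>x. x \<in> Gs \<Longrightarrow> subst g x \<in> I" "p \<in> ideal_gen Gs" shows "subst g p \<in> I"
proof -
  obtain F q where "F \<subseteq> Gs" "p = (\<Sum>x\<in>F. q x * x)" using assms(2) by (auto simp: ideal_gen_def)
  then show ?thesis using assms(1) by (auto simp: subst_sum subst_mult intro!: sum_mem mult_mem)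
qed

section \<open>The Hall--Rado functional and its ideal\<close>

context loopless_matroid
begin

text \<open>The degree map in the simplicial presentation: on a monomial in the variables
  \<open>h_F = (\<Sum>G \<supseteq> F. x_G)\<close> it is \<open>1\<close> or \<open>0\<close> according to the dragon Hall--Rado condition
  (for \<open>c = 0\<close>) or the Hall--Rado condition (for \<open>c = 1\<close>), here tested on flats only.\<close>

definition load :: "nat \<Rightarrow> ('a set \<Rightarrow>\<^sub>0 nat) \<Rightarrow> 'a set \<Rightarrow> nat" where
  "load c m U = (\<Sum>H\<in>{H\<in>pos_flats c. H \<subseteq> U}. Poly_Mapping.lookup m H)"

definition hall_rado :: "nat \<Rightarrow> ('a set \<Rightarrow>\<^sub>0 nat) \<Rightarrow> bool" where
  "hall_rado c m \<longleftrightarrow> (\<forall>U\<in>pos_flats c. load c m U < rk U + c)"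

definition hr_deg :: "nat \<Rightarrow> 'a set mpoly \<Rightarrow> rat" where
  "hr_deg c p = (\<Sum>m\<in>Poly_Mapping.keys p. Poly_Mapping.lookup p m * of_bool (hall_rado c m))"

text \<open>The largest ideal on which \<open>hr_deg\<close> vanishes; by linearity it is enough to
  test against monomials.\<close>

definition hr_ideal :: "nat \<Rightarrow> 'a set mpoly set" where
  "hr_ideal c = {p. \<forall>m. hr_deg c (p * Poly_Mapping.single m 1) = 0}"

lemma hr_deg_superset: "finite S \<Longrightarrow> Poly_Mapping.keys p \<subseteq> S \<Longrightarrow>
    hr_deg c p = (\<Sum>m\<in>S. Poly_Mapping.lookup p m * of_bool (hall_rado c m))"
  unfolding hr_deg_def by (rule sum.mono_neutral_left) (auto simp: in_keys_iff)

lemma hr_deg_add: "hr_deg c (p + q) = hr_deg c p + hr_deg c q"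
proof -
  let ?S = "Poly_Mapping.keys p \<union> Poly_Mapping.keys q"
  have "Poly_Mapping.keys (p + q) \<subseteq> ?S" by (rule keys_add)
  then show ?thesis
    using hr_deg_superset[of ?S "p + q" c] hr_deg_superset[of ?S p c] hr_deg_superset[of ?S q c]
    by (simp add: lookup_add distrib_right sum.distrib)
qed

lemma hr_deg_0: "hr_deg c 0 = 0"
  by (simp add: hr_deg_def)

lemma hr_deg_diff: "hr_deg c (p - q) = hr_deg c p - hr_deg c q"
  using hr_deg_add[of c "p - q" q] by simp

lemma hr_deg_sum: "hr_deg c (\<Sum>i\<in>A. f i) = (\<Sum>i\<in>A. hr_deg c (f i))"
  by (induction A rule: infinite_finite_induct) (auto simp: hr_deg_0 hr_deg_add)

lemma hr_deg_single: "hr_deg c (Poly_Mapping.single m a) = a * of_bool (hall_rado c m)"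
  by (simp add: hr_deg_def)

lemma hr_deg_Const: "hr_deg c (Const a * p) = a * hr_deg c p"
proof -
  have "Const a * p = (\<Sum>m\<in>Poly_Mapping.keys p. Poly_Mapping.single m (a * Poly_Mapping.lookup p m))"
    by (subst poly_mapping_sum_monomials[of p]) (simp add: Const_def sum_distrib_left mult_single)
  then have "hr_deg c (Const a * p) = (\<Sum>m\<in>Poly_Mapping.keys p. a * Poly_Mapping.lookup p m * of_bool (hall_rado c m))"
    by (simp add: hr_deg_sum hr_deg_single)
  then show ?thesis by (simp only: hr_deg_def[of c p] sum_distrib_left mult.assoc)
qed

lemma mideal_hr: "mideal (hr_ideal c)"
proof
  fix a q assume a: "a \<in> hr_ideal c"
  { fix m
    have "q * a * Poly_Mapping.single m 1 = (\<Sum>n\<in>Poly_Mapping.keys q.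
        Const (Poly_Mapping.lookup q n) * (a * Poly_Mapping.single (n + m) 1))"
    proof -
      have "q * (a * Poly_Mapping.single m 1) =
        (\<Sum>n\<in>Poly_Mapping.keys q. Poly_Mapping.single n (Poly_Mapping.lookup q n)) * (a * Poly_Mapping.single m 1)"
        by (rule arg_cong[of _ _ "\<lambda>x. x * _", OF poly_mapping_sum_monomials])
      also have "\<dots> = (\<Sum>n\<in>Poly_Mapping.keys q.
        Const (Poly_Mapping.lookup q n) * (a * Poly_Mapping.single (n + m) 1))"
        unfolding sum_distrib_right
      proof (rule sum.cong[OF refl])
        fix n
        have "Poly_Mapping.single n (Poly_Mapping.lookup q n) = Const (Poly_Mapping.lookup q n) * Poly_Mapping.single n 1"
          by (simp add: Const_def mult_single)
        moreover have "Poly_Mapping.single (n + m) 1 = Poly_Mapping.single n 1 * Poly_Mapping.single m (1 :: rat)"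
          by (simp add: mult_single)
        ultimately show "Poly_Mapping.single n (Poly_Mapping.lookup q n) * (a * Poly_Mapping.single m 1)
          = Const (Poly_Mapping.lookup q n) * (a * Poly_Mapping.single (n + m) 1)"
          by (simp only: ac_simps)
      qed
      finally show ?thesis by (simp only: mult.assoc)
    qed
    then have "hr_deg c (q * a * Poly_Mapping.single m 1) = 0"
      using a by (simp add: hr_deg_sum hr_deg_Const hr_ideal_def) }
  then show "q * a \<in> hr_ideal c" by (simp add: hr_ideal_def)
qed (auto simp: hr_ideal_def hr_deg_0 hr_deg_add distrib_right)

lemma load_add_single:
  "F \<in> pos_flats c \<Longrightarrow> load c (Poly_Mapping.single F 1 + m) U = of_bool (F \<subseteq> U) + load c m U"
proof -
  assume F: "F \<in> pos_flats c"
  have "(\<Sum>H\<in>{H\<in>pos_flats c. H \<subseteq> U}. if F = H then 1 else 0 :: nat) = of_bool (F \<subseteq> U)"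
    using F finite_pos_flats[of c] by (subst sum.delta') auto
  then show ?thesis by (simp only: load_def lookup_add lookup_single when_def sum.distrib)
qed

lemma load_supermodular:
  assumes "U \<in> L" "V \<in> L"
  shows "load c m U + load c m V \<le> load c m (join U V) + load c m (U \<inter> V)"
proof -
  let ?S = "\<lambda>U. {H\<in>pos_flats c. H \<subseteq> U}"
  have fin: "finite (?S U)" for U using finite_pos_flats by simp
  have mono: "?S A \<subseteq> ?S B" if "A \<subseteq> B" for A B using that by auto
  have "?S U \<union> ?S V \<subseteq> ?S (join U V)"
    using mono[OF join_upper(1)[OF assms]] mono[OF join_upper(2)[OF assms]] by (rule Un_least)
  then have "sum (Poly_Mapping.lookup m) (?S U \<union> ?S V) \<le> load c m (join U V)"
    unfolding load_def by (intro sum_mono2 fin) simp_all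
  moreover have "?S U \<inter> ?S V = ?S (U \<inter> V)" by auto
  then have "sum (Poly_Mapping.lookup m) (?S U \<inter> ?S V) = load c m (U \<inter> V)" by (simp only: load_def)
  moreover have "load c m U + load c m V =
      sum (Poly_Mapping.lookup m) (?S U \<union> ?S V) + sum (Poly_Mapping.lookup m) (?S U \<inter> ?S V)"
    unfolding load_def using sum.union_inter[OF fin fin, of "Poly_Mapping.lookup m" U V] by simp
  ultimately show ?thesis by linarith
qed

text \<open>The slack \<open>rk U + c - load c m U\<close> is submodular and nonnegative at the
  meet, hence subadditive at the join. An empty meet for \<open>c = 0\<close> lies outside
  \<open>pos_flats\<close>, but its slack is 0.\<close>

lemma slack_submodular:
  assumes "U \<in> L" "V \<in> L"
    and "\<And>W. W \<in> pos_flats c \<Longrightarrow> load c m W < rk W + c"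
  shows "rk (join U V) + c + load c m U + load c m V \<le> load c m (join U V) + (rk U + c) + (rk V + c)"
proof -
  have "load c m (U \<inter> V) \<le> rk (U \<inter> V) + c"
  proof (cases "U \<inter> V \<in> pos_flats c")
    case True
    then show ?thesis using assms(3) by (simp add: less_imp_le)
  next
    case False
    then have "rk (U \<inter> V) = 0" "c = 0" using flat_inter[OF assms(1,2)] by (auto simp: pos_flats_def)
    then have "U \<inter> V = {}" using flat_inter[OF assms(1,2)] flat_rk_0 by blast
    then have "{H\<in>pos_flats c. H \<subseteq> U \<inter> V} = {}" using \<open>c = 0\<close> by (auto simp: pos_flats_def rk_empty)
    then show ?thesis unfolding load_def by (simp only: sum.empty)
  qed
  then show ?thesis using load_supermodular[OF assms(1,2), of c m] rk_join[OF assms(1,2)] by linarith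
qed

lemma hr_deg_Var2:
  "hr_deg c (Var F * Var G * Poly_Mapping.single m 1) =
     of_bool (hall_rado c (Poly_Mapping.single F 1 + (Poly_Mapping.single G 1 + m)))"
  by (simp add: Var_def mult_single hr_deg_single add.assoc)

text \<open>Write J for the join. The four truth values cancel by inclusion-exclusion: the condition
  for (F, G) is the conjunction of those for (F, J) and (J, G), and the condition for (J, J) is
  their disjunction. The substantial part: if the two fail at \<open>U\<close> and \<open>V\<close>,
  both have slack at most 1, so \<open>join U V\<close> has slack at most 2, whereas (J, J) requires
  more.\<close>

lemma hr_ideal_join:
  assumes "F \<in> pos_flats c" "G \<in> pos_flats c"
  shows "(Var F - Var (join F G)) * (Var G - Var (join F G)) \<in> hr_ideal c"
proof -
  let ?J = "join F G"
  have L: "F \<in> L" "G \<in> L" using assms pos_flats_flat by auto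
  have J: "?J \<in> pos_flats c" using pos_flats_up[OF assms(1) join_upper(1)[OF L] join_flat[OF L]] .
  have sub: "?J \<subseteq> U \<longleftrightarrow> F \<subseteq> U \<and> G \<subseteq> U" if "U \<in> pos_flats c" for U
    using join_subset_iff[OF L] that pos_flats_flat by blast
  { fix m
    let ?h = "\<lambda>A B. hall_rado c (Poly_Mapping.single A 1 + (Poly_Mapping.single B 1 + m))"
    have h: "?h A B \<longleftrightarrow> (\<forall>U\<in>pos_flats c. of_bool (A \<subseteq> U) + of_bool (B \<subseteq> U) + load c m U < rk U + c)"
      if "A \<in> pos_flats c" "B \<in> pos_flats c" for A B
      using that by (simp only: hall_rado_def load_add_single add.assoc)
    have FG: "?h F G \<longleftrightarrow> (\<forall>U\<in>pos_flats c. of_bool (F \<subseteq> U) + of_bool (G \<subseteq> U) + load c m U < rk U + c)"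
      using h assms by blast
    have FJ: "?h F ?J \<longleftrightarrow> (\<forall>U\<in>pos_flats c. of_bool (F \<subseteq> U) + of_bool (F \<subseteq> U \<and> G \<subseteq> U) + load c m U < rk U + c)"
      using h[OF assms(1) J] sub by simp
    have JG: "?h ?J G \<longleftrightarrow> (\<forall>U\<in>pos_flats c. of_bool (F \<subseteq> U \<and> G \<subseteq> U) + of_bool (G \<subseteq> U) + load c m U < rk U + c)"
      using h[OF J assms(2)] sub by simp
    have JJ: "?h ?J ?J \<longleftrightarrow> (\<forall>U\<in>pos_flats c. of_bool (F \<subseteq> U \<and> G \<subseteq> U) + of_bool (F \<subseteq> U \<and> G \<subseteq> U) + load c m U < rk U + c)"
      using h[OF J J] sub by simp
    have 1: "?h F G \<longleftrightarrow> ?h F ?J \<and> ?h ?J G" unfolding FG FJ JG by (fastforce simp: of_bool_def split: if_splits)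
    have 2: "?h F ?J \<or> ?h ?J G \<longleftrightarrow> ?h ?J ?J"
    proof
      show "?h F ?J \<or> ?h ?J G \<Longrightarrow> ?h ?J ?J" unfolding FJ JG JJ by (fastforce simp: of_bool_def split: if_splits)
    next
      assume jj: "?h ?J ?J"
      show "?h F ?J \<or> ?h ?J G"
      proof (rule ccontr)
        assume "\<not> (?h F ?J \<or> ?h ?J G)"
        then obtain U V where U: "U \<in> pos_flats c" "\<not> of_bool (F \<subseteq> U) + of_bool (F \<subseteq> U \<and> G \<subseteq> U) + load c m U < rk U + c"
          and V: "V \<in> pos_flats c" "\<not> of_bool (F \<subseteq> V \<and> G \<subseteq> V) + of_bool (G \<subseteq> V) + load c m V < rk V + c"
          unfolding FJ JG by blast
        have ub: "load c m W < rk W + c" if "W \<in> pos_flats c" for W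
          using jj that unfolding JJ by (meson add_lessD1 trans_less_add2 le_add2 le_less_trans)
        have "of_bool (F \<subseteq> U \<and> G \<subseteq> U) + of_bool (F \<subseteq> U \<and> G \<subseteq> U) + load c m U < rk U + c"
          "of_bool (F \<subseteq> V \<and> G \<subseteq> V) + of_bool (F \<subseteq> V \<and> G \<subseteq> V) + load c m V < rk V + c"
          using jj U(1) V(1) unfolding JJ by blast+
        then have FU: "F \<subseteq> U" "load c m U + 1 \<ge> rk U + c" and GV: "G \<subseteq> V" "load c m V + 1 \<ge> rk V + c"
          using U(2) V(2) by (auto simp: of_bool_def split: if_splits)
        have UV: "U \<in> L" "V \<in> L" using U V pos_flats_flat by auto
        have W: "join U V \<in> pos_flats c" using pos_flats_up[OF U(1) join_upper(1)[OF UV] join_flat[OF UV]] .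
        have "F \<subseteq> join U V" "G \<subseteq> join U V" using FU GV join_upper[OF UV] by auto
        then have "2 + load c m (join U V) < rk (join U V) + c" using jj W unfolding JJ by auto
        then show False using slack_submodular[OF UV ub] FU GV by linarith
      qed
    qed
    have "hr_deg c ((Var F - Var ?J) * (Var G - Var ?J) * Poly_Mapping.single m 1) =
      of_bool (?h F G) - of_bool (?h F ?J) - of_bool (?h ?J G) + of_bool (?h ?J ?J)"
    proof -
      have "(Var F - Var ?J) * (Var G - Var ?J) * Poly_Mapping.single m 1 =
        Var F * Var G * Poly_Mapping.single m 1 - Var F * Var ?J * Poly_Mapping.single m 1
         - Var ?J * Var G * Poly_Mapping.single m 1 + Var ?J * Var ?J * Poly_Mapping.single m 1"
        by (simp add: algebra_simps)
      then show ?thesis by (simp only: hr_deg_add hr_deg_diff hr_deg_Var2)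
    qed
    also have "\<dots> = 0" using 1 2 by (auto simp: of_bool_def)
    finally have "hr_deg c ((Var F - Var ?J) * (Var G - Var ?J) * Poly_Mapping.single m 1) = 0" . }
  then show ?thesis by (simp add: hr_ideal_def)
qed

text \<open>If only the condition with \<open>F\<close> itself fails, at \<open>U\<close>, then
  \<open>U\<close> contains \<open>F\<close> but not the atom and has slack at most 1. Joining the
  atom raises the rank by at most one, so the slack becomes at most 2, too small for the two new
  factors below the join.\<close>

lemma hr_ideal_atom:
  assumes "F \<in> pos_flats c" "i \<in> E"
  shows "(Var F - Var (join F (cl {i}))) * Var (cl {i}) \<in> hr_ideal c"
proof -
  let ?A = "cl {i}"
  let ?J = "join F ?A"
  have L: "F \<in> L" "?A \<in> L" using assms pos_flats_flat rk_atom by auto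
  have J: "?J \<in> pos_flats c" using pos_flats_up[OF assms(1) join_upper(1)[OF L] join_flat[OF L]] .
  have A: "?A \<in> pos_flats c" using rk_atom assms by (simp add: pos_flats_def)
  have sub: "?J \<subseteq> U \<longleftrightarrow> F \<subseteq> U \<and> ?A \<subseteq> U" if "U \<in> pos_flats c" for U
    using join_subset_iff[OF L] that pos_flats_flat by blast
  { fix m
    let ?h = "\<lambda>A B. hall_rado c (Poly_Mapping.single A 1 + (Poly_Mapping.single B 1 + m))"
    have h: "?h A B \<longleftrightarrow> (\<forall>U\<in>pos_flats c. of_bool (A \<subseteq> U) + of_bool (B \<subseteq> U) + load c m U < rk U + c)"
      if "A \<in> pos_flats c" "B \<in> pos_flats c" for A B
      using that by (simp only: hall_rado_def load_add_single add.assoc)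
    have FA: "?h F ?A \<longleftrightarrow> (\<forall>U\<in>pos_flats c. of_bool (F \<subseteq> U) + of_bool (?A \<subseteq> U) + load c m U < rk U + c)"
      using h assms A by blast
    have JA: "?h ?J ?A \<longleftrightarrow> (\<forall>U\<in>pos_flats c. of_bool (F \<subseteq> U \<and> ?A \<subseteq> U) + of_bool (?A \<subseteq> U) + load c m U < rk U + c)"
      using h[OF J A] sub by simp
    have "?h F ?A \<longleftrightarrow> ?h ?J ?A"
    proof
      show "?h F ?A \<Longrightarrow> ?h ?J ?A" unfolding FA JA by (fastforce simp: of_bool_def split: if_splits)
    next
      assume ja: "?h ?J ?A"
      show "?h F ?A"
      proof (rule ccontr)
        assume "\<not> ?h F ?A"
        then obtain U where U: "U \<in> pos_flats c" "\<not> of_bool (F \<subseteq> U) + of_bool (?A \<subseteq> U) + load c m U < rk U + c"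
          unfolding FA by blast
        have "of_bool (F \<subseteq> U \<and> ?A \<subseteq> U) + of_bool (?A \<subseteq> U) + load c m U < rk U + c"
          using ja U(1) unfolding JA by blast
        then have FU: "F \<subseteq> U" "load c m U + 1 \<ge> rk U + c"
          using U(2) by (auto simp: of_bool_def split: if_splits)
        have UV: "U \<in> L" "?A \<in> L" using U L pos_flats_flat by auto
        have W: "join U ?A \<in> pos_flats c" using pos_flats_up[OF U(1) join_upper(1)[OF UV] join_flat[OF UV]] .
        have "F \<subseteq> join U ?A" "?A \<subseteq> join U ?A" using FU join_upper[OF UV] by auto
        then have "2 + load c m (join U ?A) < rk (join U ?A) + c" using ja W unfolding JA by auto
        moreover have "rk (join U ?A) \<le> rk U + 1" using rk_join[OF UV] rk_atom[OF assms(2)] by simp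
        moreover have "load c m U \<le> load c m (join U ?A)"
          unfolding load_def using join_upper[OF UV] finite_pos_flats by (intro sum_mono2) auto
        ultimately show False using FU by linarith
      qed
    qed
    then have "hr_deg c ((Var F - Var ?J) * Var ?A * Poly_Mapping.single m 1) = 0"
      by (simp only: left_diff_distrib hr_deg_diff hr_deg_Var2) }
  then show ?thesis by (simp add: hr_ideal_def)
qed

lemma hr_ideal_min:
  assumes "G \<in> pos_flats c" "rk G + c = 1" shows "Var G \<in> hr_ideal c"
proof -
  have "\<not> hall_rado c (Poly_Mapping.single G 1 + m)" for m
  proof
    assume "hall_rado c (Poly_Mapping.single G 1 + m)"
    then have "load c (Poly_Mapping.single G 1 + m) G < rk G + c" using assms by (auto simp: hall_rado_def)
    then show False unfolding load_add_single[OF assms(1)] using assms by simp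
  qed
  then show ?thesis by (simp add: hr_ideal_def Var_def mult_single hr_deg_single)
qed

text \<open>Moebius inversion: \<open>Var F\<close> stands for h_F, and \<open>hr_x c F\<close> is
  the image of x_F.\<close>

function hr_x :: "nat \<Rightarrow> 'a set \<Rightarrow> 'a set mpoly" where
  "hr_x c F = Var F - (\<Sum>H\<in>{H\<in>pos_flats c. F \<subset> H}. hr_x c H)"
  by auto
termination
proof (relation "measure (\<lambda>(c, F). card (E - F))")
  fix c F H assume "H \<in> {H\<in>pos_flats c. F \<subset> H}"
  then have "E - H \<subset> E - F" using pos_flats_flat[of H c] flat_subset[of H] by blast
  then show "((c, H), (c, F)) \<in> measure (\<lambda>(c, F). card (E - F))"
    using finite_ground psubset_card_mono by auto
qed auto

declare hr_x.simps [simp del]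

lemma sum_hr_x: "F \<in> pos_flats c \<Longrightarrow> (\<Sum>H\<in>{H\<in>pos_flats c. F \<subseteq> H}. hr_x c H) = Var F"
proof -
  assume "F \<in> pos_flats c"
  then have "{H\<in>pos_flats c. F \<subseteq> H} = insert F {H\<in>pos_flats c. F \<subset> H}" by auto
  then show ?thesis using hr_x.simps[of c F] finite_pos_flats by simp
qed

lemma Var_diff_join:
  assumes "F \<in> pos_flats c" "G \<in> L"
  shows "Var F - Var (join F G) = (\<Sum>H\<in>{H\<in>pos_flats c. F \<subseteq> H \<and> \<not> G \<subseteq> H}. hr_x c H)"
proof -
  have L: "F \<in> L" using assms pos_flats_flat by auto
  have J: "join F G \<in> pos_flats c" using pos_flats_up[OF assms(1) join_upper(1)[OF L] join_flat[OF L]] assms by blast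
  have "{H\<in>pos_flats c. F \<subseteq> H \<and> \<not> G \<subseteq> H} = {H\<in>pos_flats c. F \<subseteq> H} - {H\<in>pos_flats c. join F G \<subseteq> H}"
    using join_subset_iff[OF L assms(2)] pos_flats_flat by auto
  also have "(\<Sum>H\<in>\<dots>. hr_x c H) = Var F - Var (join F G)"
    using join_subset_iff[OF L assms(2)] pos_flats_flat finite_pos_flats
    by (subst sum_diff) (auto simp: sum_hr_x[OF assms(1)] sum_hr_x[OF J])
  finally show ?thesis by simp
qed

text \<open>\<open>Var_diff_join\<close> expands the product in \<open>hr_ideal_join\<close> over
  pairs \<open>(H, K)\<close> with \<open>H\<close> above \<open>F\<close> but not \<open>G\<close>,
  and \<open>K\<close> above \<open>G\<close> but not \<open>F\<close>. Such pairs are again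
  incomparable, and all except \<open>(F, G)\<close> have smaller complements, so the induction
  removes them.\<close>

lemma hr_x_incomparable:
  "F \<in> pos_flats c \<Longrightarrow> G \<in> pos_flats c \<Longrightarrow> \<not> F \<subseteq> G \<Longrightarrow> \<not> G \<subseteq> F \<Longrightarrow> hr_x c F * hr_x c G \<in> hr_ideal c"
proof (induction "card (E - F) + card (E - G)" arbitrary: F G rule: less_induct)
  case less
  interpret mideal "hr_ideal c" by (rule mideal_hr)
  have L: "F \<in> L" "G \<in> L" using less.prems pos_flats_flat by auto
  let ?A = "{H\<in>pos_flats c. F \<subseteq> H \<and> \<not> G \<subseteq> H}" and ?B = "{H\<in>pos_flats c. G \<subseteq> H \<and> \<not> F \<subseteq> H}"
  let ?S = "?A \<times> ?B - {(F, G)}"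
  have "join F G = join G F" by (simp add: join_def Un_commute)
  then have "(Var F - Var (join F G)) * (Var G - Var (join F G)) = (\<Sum>(H, K)\<in>?A \<times> ?B. hr_x c H * hr_x c K)"
    using Var_diff_join[OF less.prems(1) L(2)] Var_diff_join[OF less.prems(2) L(1)]
    by (simp add: sum_product sum.cartesian_product)
  also have "\<dots> = hr_x c F * hr_x c G + (\<Sum>(H, K)\<in>?S. hr_x c H * hr_x c K)"
    using less.prems finite_pos_flats by (subst sum.remove[of _ "(F, G)"]) auto
  finally have eq: "hr_x c F * hr_x c G = (Var F - Var (join F G)) * (Var G - Var (join F G)) - (\<Sum>(H, K)\<in>?S. hr_x c H * hr_x c K)"
    by simp
  have "(\<Sum>(H, K)\<in>?S. hr_x c H * hr_x c K) \<in> hr_ideal c"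
  proof (rule sum_mem)
    fix x assume x: "x \<in> ?S"
    obtain H K where HK: "x = (H, K)" by fastforce
    have h: "H \<in> ?A" "K \<in> ?B" "H \<noteq> F \<or> K \<noteq> G" using x HK by auto
    have fin: "finite (E - F)" "finite (E - G)" using finite_ground by auto
    have sub: "E - H \<subseteq> E - F" "E - K \<subseteq> E - G" using h by auto
    have "H \<subseteq> E" "K \<subseteq> E" using h pos_flats_flat flat_subset by auto
    then have "E - (E - H) = H" "E - (E - K) = K" "E - (E - F) = F" "E - (E - G) = G"
      using L flat_subset by (auto simp: double_diff)
    then have "E - H \<subset> E - F \<or> E - K \<subset> E - G" using h(3) sub by (metis psubset_eq)
    then have "card (E - H) + card (E - K) < card (E - F) + card (E - G)"
      using card_mono[OF fin(1) sub(1)] card_mono[OF fin(2) sub(2)] psubset_card_mono[OF fin(1), of "E - H"]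
        psubset_card_mono[OF fin(2), of "E - K"] by linarith
    then show "(case x of (H, K) \<Rightarrow> hr_x c H * hr_x c K) \<in> hr_ideal c"
      using less.hyps[of H K] h HK by auto
  qed
  then show ?case unfolding eq using hr_ideal_join[OF less.prems(1,2)] by (rule diff_mem[rotated])
qed

text \<open>The expansion of \<open>hr_x_incomparable\<close>, applied to the relation
  \<open>hr_ideal_atom\<close>.\<close>

lemma hr_x_atom:
  "F \<in> pos_flats c \<Longrightarrow> i \<in> E \<Longrightarrow> i \<notin> F \<Longrightarrow> hr_x c F * Var (cl {i}) \<in> hr_ideal c"
proof (induction "card (E - F)" arbitrary: F rule: less_induct)
  case less
  interpret mideal "hr_ideal c" by (rule mideal_hr)
  have A: "cl {i} \<in> L" using rk_atom less by auto
  let ?A = "{H\<in>pos_flats c. F \<subseteq> H \<and> \<not> cl {i} \<subseteq> H}"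
  have iff: "cl {i} \<subseteq> H \<longleftrightarrow> i \<in> H" if "H \<in> pos_flats c" for H
    using cl_singleton_subset_iff that less pos_flats_flat by blast
  have "(Var F - Var (join F (cl {i}))) * Var (cl {i}) = (\<Sum>H\<in>?A. hr_x c H * Var (cl {i}))"
    unfolding Var_diff_join[OF less.prems(1) A] by (rule sum_distrib_right)
  also have "\<dots> = hr_x c F * Var (cl {i}) + (\<Sum>H\<in>?A - {F}. hr_x c H * Var (cl {i}))"
    using less.prems finite_pos_flats iff by (intro sum.remove) auto
  finally have eq: "hr_x c F * Var (cl {i}) = (Var F - Var (join F (cl {i}))) * Var (cl {i}) - (\<Sum>H\<in>?A - {F}. hr_x c H * Var (cl {i}))"
    by simp
  have "(\<Sum>H\<in>?A - {F}. hr_x c H * Var (cl {i})) \<in> hr_ideal c"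
  proof (rule sum_mem)
    fix H assume H: "H \<in> ?A - {F}"
    then have "E - H \<subset> E - F" using pos_flats_flat flat_subset by blast
    then show "hr_x c H * Var (cl {i}) \<in> hr_ideal c"
      using less.hyps[of H] H iff[of H] less.prems finite_ground psubset_card_mono[of "E - F" "E - H"] by auto
  qed
  then show ?case unfolding eq using hr_ideal_atom[OF less.prems(1,2)] by (rule diff_mem[rotated])
qed

text \<open>A substitution that sends the relations into \<open>hr_ideal c\<close> sends their whole
  ideal there. The image of \<open>q\<close> is congruent to h_E, and the power of h_E meets the
  Hall--Rado condition because it loads only \<open>E\<close>, with one less than its shifted
  rank.\<close>

lemma power_notin_ideal_gen:
  assumes pos: "1 \<le> rk E + c"
    and gens: "\<And>p. p \<in> Gs \<Longrightarrow> subst g p \<in> hr_ideal c"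
    and top: "subst g q - Var E \<in> hr_ideal c"
  shows "q ^ (rk E + c - 1) \<notin> ideal_gen Gs"
proof
  interpret mideal "hr_ideal c" by (rule mideal_hr)
  let ?n = "rk E + c - 1"
  assume "q ^ ?n \<in> ideal_gen Gs"
  then have "subst g q ^ ?n \<in> hr_ideal c" using subst_ideal_gen[OF gens] by (metis subst_power)
  moreover have "subst g q ^ ?n - Var E ^ ?n \<in> hr_ideal c" using power_cong[of 1 "subst g q" "Var E" ?n] top by simp
  ultimately have "Var E ^ ?n \<in> hr_ideal c" using mem_cong by blast
  then have "hr_deg c (Var E ^ ?n * Poly_Mapping.single 0 1) = 0" unfolding hr_ideal_def by blast
  moreover have "Var E ^ n = Poly_Mapping.single (Poly_Mapping.single E n) 1" for n
    by (induction n) (auto simp: Var_def mult_single single_add[symmetric])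
  ultimately have "\<not> hall_rado c (Poly_Mapping.single E ?n)"
    by (simp add: hr_deg_single)
  moreover have "hall_rado c (Poly_Mapping.single E ?n)"
    unfolding hall_rado_def
  proof
    fix U assume U: "U \<in> pos_flats c"
    show "load c (Poly_Mapping.single E ?n) U < rk U + c"
    proof (cases "U = E")
      case True
      have "load c (Poly_Mapping.single E ?n) E \<le> ?n"
        unfolding load_def lookup_single when_def by (subst sum.delta') (auto simp: finite_pos_flats)
      then show ?thesis using True pos by simp
    next
      case False
      then have "\<not> E \<subseteq> U" using U pos_flats_flat flat_subset by blast
      then have "load c (Poly_Mapping.single E ?n) U = 0"
        unfolding load_def lookup_single when_def by (intro sum.neutral) auto
      then show ?thesis using U by (simp add: pos_flats_def Suc_le_eq)
    qed
  qed
  ultimately show False by blast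
qed

end

section \<open>The Chow ring and the augmented Chow ring\<close>

context loopless_matroid
begin

definition fy_poly :: "nat \<Rightarrow> 'a set option \<Rightarrow> int poly" where
  "fy_poly c p = (\<Sum>xs\<in>{xs. fy c p xs}. monom 1 (size (fy_mset xs)))"

lemma coeff_fy_poly: "coeff (fy_poly c p) j = int (card (fy_lists c p j))"
proof -
  have "coeff (fy_poly c p) j = (\<Sum>xs\<in>{xs. fy c p xs}. if size (fy_mset xs) = j then 1 else 0)"
    by (simp add: fy_poly_def coeff_sum)
  also have "\<dots> = (\<Sum>xs\<in>fy_lists c p j. 1)"
    using finite_fy[of c p] by (intro sum.mono_neutral_cong_right) (auto simp: fy_lists_def)
  finally show ?thesis by simp
qed

lemma coeff_0_fy_poly: "coeff (fy_poly c p) 0 = 1"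
proof -
  have "fy_lists c p 0 = {[]}" using fy_mset_eq_empty by (auto simp: fy_lists_def)
  then show ?thesis by (simp add: coeff_fy_poly)
qed

lemma fy_poly_rec:
  "fy_poly c p = 1 + (\<Sum>G\<in>above c p. bracket (rk G + c - base c p) * fy_poly c (Some G))"
proof -
  let ?f = "\<lambda>xs. monom (1 :: int) (size (fy_mset xs))"
  let ?T = "\<lambda>G a. (#) (G, a) ` {xs. fy c (Some G) xs}"
  let ?A = "\<lambda>G. {1..<rk G + c - base c p}"
  have fin: "finite (?T G a)" for G a using finite_fy by simp
  have T: "sum ?f (?T G a) = monom 1 a * fy_poly c (Some G)" for G a
    by (subst sum.reindex) (auto simp: fy_poly_def sum_distrib_left mult_monom)
  have "fy_poly c p = sum ?f (insert [] (\<Union>G\<in>above c p. \<Union>a\<in>?A G. ?T G a))"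
    unfolding fy_poly_def by (subst fy_unfold) simp
  also have "\<dots> = 1 + sum ?f (\<Union>G\<in>above c p. \<Union>a\<in>?A G. ?T G a)"
    using fin finite_above by (subst sum.insert) auto
  also have "sum ?f (\<Union>G\<in>above c p. \<Union>a\<in>?A G. ?T G a) = (\<Sum>G\<in>above c p. sum ?f (\<Union>a\<in>?A G. ?T G a))"
    using fin finite_above by (intro sum.UNION_disjoint) auto
  also have "\<dots> = (\<Sum>G\<in>above c p. \<Sum>a\<in>?A G. sum ?f (?T G a))"
    using fin by (intro sum.cong refl sum.UNION_disjoint) auto
  finally show ?thesis by (simp add: T bracket_def sum_distrib_right)
qed

lemma pos_flats_0: "pos_flats 0 = L - {{}}"
  using flat_rk_0 by (auto simp: pos_flats_def Suc_le_eq rk_empty)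

lemma pos_flats_1: "pos_flats 1 = L"
  by (auto simp: pos_flats_def)

lemma gamma_positive_fy_poly_0: "gamma_positive (fy_poly 0 None)"
proof -
  \<comment> \<open>For \<open>c = 0\<close> the virtual bottom and the empty flat have the same
    rank and the same flats above, so \<open>None\<close> stands in for \<open>{}\<close>.\<close>
  define h where "h F = fy_poly 0 (if F = {} then None else Some F)" for F
  interpret chow_recursion E rk h
  proof
    fix F assume F: "F \<in> L"
    let ?p = "if F = {} then None else Some F"
    have above: "above 0 ?p = {G\<in>L. F \<subset> G}" using F by (auto simp: pos_flats_0)
    have base: "base 0 ?p = rk F" by (simp add: rk_empty)
    have "h G = fy_poly 0 (Some G)" if "F \<subset> G" for G using that by (auto simp: h_def)
    then have "(\<Sum>G\<in>{G\<in>L. F \<subset> G}. bracket (rk G - rk F) * h G)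
       = (\<Sum>G\<in>above 0 ?p. bracket (rk G + 0 - base 0 ?p) * fy_poly 0 (Some G))"
      unfolding above base by (intro sum.cong) auto
    then show "h F = 1 + (\<Sum>G\<in>{G\<in>L. F \<subset> G}. bracket (rk G - rk F) * h G)"
      using fy_poly_rec[of 0 ?p] h_def[of F] by (simp only:)
  qed
  have "gamma_nonneg (rk E - 1) (fy_poly 0 None)"
    using gamma_nonneg_h[OF empty_flat] by (simp add: rk_empty h_def)
  then show ?thesis by (rule gamma_nonneg_imp_gamma_positive) (rule coeff_0_fy_poly)
qed

text \<open>Rank differences between flats do not see the shift, so \<open>h\<close> obeys the same
  recursion; the shift enters only at \<open>None\<close>, in the form of
  \<open>gamma_nonneg_aug\<close>.\<close>

lemma gamma_positive_fy_poly_1: "gamma_positive (fy_poly 1 None)"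
proof -
  define h where "h F = fy_poly 1 (Some F)" for F
  interpret chow_recursion E rk h
  proof
    fix F assume F: "F \<in> L"
    show "h F = 1 + (\<Sum>G\<in>{G\<in>L. F \<subset> G}. bracket (rk G - rk F) * h G)"
      unfolding h_def by (subst fy_poly_rec) (auto simp: pos_flats_1[unfolded One_nat_def] intro!: sum.cong)
  qed
  have "gamma_nonneg (rk E) (fy_poly 1 None)"
    using gamma_nonneg_aug by (subst fy_poly_rec) (simp add: pos_flats_1[unfolded One_nat_def] h_def)
  then show ?thesis by (rule gamma_nonneg_imp_gamma_positive) (rule coeff_0_fy_poly)
qed

lemma sum_pos_flats_split:
  fixes X :: "'a set \<Rightarrow> 'b::ab_group_add"
  assumes "E \<in> A" "finite A"
  shows "(\<Sum>H\<in>{H\<in>A. Q H}. X H) = (if Q E then X E else 0) + (\<Sum>H\<in>{H\<in>A - {E}. Q H}. X H)"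
proof (cases "Q E")
  case True
  then have "{H\<in>A. Q H} = insert E {H\<in>A - {E}. Q H}" using assms by auto
  then show ?thesis using True assms by simp
next
  case False
  then have "{H\<in>A. Q H} = {H\<in>A - {E}. Q H}" by auto
  then show ?thesis using False by simp
qed

lemma uH_coeff_eq_card: "uH_coeff E rk j = card (fy_lists 0 None j)"
proof (cases "E = {}")
  \<comment> \<open>For an empty ground set \<open>pos_ground\<close> fails at \<open>c = 0\<close>;
    the ring consists of the constants.\<close>
  case True
  then have L: "L = {{}}" by (auto simp: flats_def)
  have rels: "uCH_rels E rk = {}" and vars: "uCH_vars E rk = {}"
    using True L by (auto simp: uCH_rels_def uCH_vars_def)
  have "above 0 None = {}" using L by (simp add: pos_flats_0)
  then have fy: "fy 0 None xs \<longleftrightarrow> xs = []" for xs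
    using fy_mset_above[of 0 None xs] fy_mset_eq_empty[of 0 None xs] by auto
  have I0: "ideal_gen {} = {0 :: 'a set mpoly}" by (auto simp: ideal_gen_def)
  have lists: "fy_lists 0 None j = (if j = 0 then {[]} else {})" by (auto simp: fy_lists_def fy)
  show ?thesis unfolding uH_coeff_def rels vars
  proof (rule quot_dim_eqI[where b = "\<lambda>_. 1"])
    fix p :: "'a set mpoly" assume "homog_in {} j p"
    then have m: "m = 0 \<and> j = 0" if "m \<in> Poly_Mapping.keys p" for m
      using that by (auto simp: homog_in_def mdeg_def)
    have p: "p = Const (Poly_Mapping.lookup p 0)"
    proof (rule poly_mapping_eqI)
      fix k show "Poly_Mapping.lookup p k = Poly_Mapping.lookup (Const (Poly_Mapping.lookup p 0)) k"
        using m by (cases "k = 0") (auto simp: Const_def lookup_single when_def in_keys_iff)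
    qed
    show "\<exists>k. p - (\<Sum>x\<in>fy_lists 0 None j. Const (k x) * 1) \<in> ideal_gen {}"
    proof (cases "j = 0")
      case True
      then have l: "fy_lists 0 None j = {[]}" using lists by simp
      have "p - Const (Poly_Mapping.lookup p 0) = 0" using p by (rule eq_iff_diff_eq_0[THEN iffD1])
      then show ?thesis unfolding l I0 by (intro exI[of _ "\<lambda>_. Poly_Mapping.lookup p 0"]) simp
    next
      case False
      then have "Poly_Mapping.keys p = {}" using m by blast
      then have "p = 0" by simp
      then show ?thesis using False by (simp add: lists I0)
    qed
  qed (auto simp: lists homog_in_1 I0 Const_def split: if_splits dest!: arg_cong[of _ 0 "\<lambda>p. Poly_Mapping.lookup p 0"])
next
  case False
  then obtain i0 where i0: "i0 \<in> E" by auto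
  let ?V = "uCH_vars E rk" and ?R = "uCH_rels E rk"
  have V: "?V = pos_flats 0 - {E}" by (auto simp: uCH_vars_def pos_flats_0)
  have EP: "E \<in> pos_flats 0" using False ground_flat by (simp add: pos_flats_0)
  \<comment> \<open>Modulo the linear relations this value of x_E does not depend on
    \<open>i0\<close>, and the sum over all flats containing a given \<open>i\<close> becomes
    0.\<close>
  define X where "X F = (if F = E then - (\<Sum>H\<in>{H\<in>?V. i0 \<in> H}. Var H) else Var F)" for F
  interpret mideal "ideal_gen ?R" by (rule mideal_ideal_gen)
  have rk1: "1 \<le> rk E + 0" using EP by (auto simp: pos_flats_def)
  have XV: "(\<Sum>H\<in>{H\<in>?V. i \<in> H}. X H) = (\<Sum>H\<in>{H\<in>?V. i \<in> H}. Var H)" for i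
    by (intro sum.cong) (auto simp: X_def V)
  have lin: "(\<Sum>H\<in>{H\<in>pos_flats 0. i \<in> H}. X H) \<in> ideal_gen ?R" if "i \<in> E" for i
  proof -
    have "(\<Sum>H\<in>{H\<in>pos_flats 0. i \<in> H}. X H) = (\<Sum>H\<in>{H\<in>?V. i \<in> H}. Var H) - (\<Sum>H\<in>{H\<in>?V. i0 \<in> H}. Var H)"
      using sum_pos_flats_split[OF EP finite_pos_flats, of X "\<lambda>H. i \<in> H"] that XV[of i]
      by (simp add: V[symmetric]) (simp add: X_def)
    also have "\<dots> \<in> ideal_gen ?R" using that i0 by (intro ideal_gen_gen) (auto simp: uCH_rels_def)
    finally show ?thesis .
  qed
  interpret hr: mideal "hr_ideal 0" by (rule mideal_hr)
  \<comment> \<open>This sum is h_F for the atom \<open>F = cl {i}\<close>, which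
    \<open>hr_ideal_min\<close> kills.\<close>
  have hr_sum: "(\<Sum>H\<in>{H\<in>?V. i \<in> H}. hr_x 0 H) + hr_x 0 E \<in> hr_ideal 0" if "i \<in> E" for i
  proof -
    have i: "cl {i} \<in> pos_flats 0" using rk_atom that by (simp add: pos_flats_def)
    have "{H\<in>pos_flats 0. cl {i} \<subseteq> H} = {H\<in>pos_flats 0. i \<in> H}"
      using cl_singleton_subset_iff that pos_flats_flat by blast
    then have "(\<Sum>H\<in>{H\<in>pos_flats 0. i \<in> H}. hr_x 0 H) = Var (cl {i})" using sum_hr_x[OF i] by simp
    moreover have "Var (cl {i}) \<in> hr_ideal 0" using rk_atom that i by (intro hr_ideal_min) auto
    ultimately show ?thesis
      using sum_pos_flats_split[OF EP finite_pos_flats, of "hr_x 0" "\<lambda>H. i \<in> H"] that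
      by (simp add: V[symmetric] add.commute)
  qed
  have hr_E: "hr_x 0 E = Var E"
  proof -
    have "{H\<in>pos_flats 0. E \<subset> H} = {}" using pos_flats_flat flat_subset by blast
    then show ?thesis by (subst hr_x.simps) (simp only: sum.empty diff_zero)
  qed
  have gens: "subst (hr_x 0) p \<in> hr_ideal 0" if p: "p \<in> ?R" for p
  proof -
    consider F G where "F \<in> ?V" "G \<in> ?V" "\<not> F \<subseteq> G" "\<not> G \<subseteq> F" "p = Var F * Var G"
      | i k where "i \<in> E" "k \<in> E" "p = (\<Sum>H\<in>{H\<in>?V. i \<in> H}. Var H) - (\<Sum>H\<in>{H\<in>?V. k \<in> H}. Var H)"
      using p unfolding uCH_rels_def by blast
    then show ?thesis
    proof cases
      case 1
      then show ?thesis using hr_x_incomparable[of F 0 G] by (simp add: subst_mult subst_Var V)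
    next
      case 2
      have "((\<Sum>H\<in>{H\<in>?V. i \<in> H}. hr_x 0 H) + hr_x 0 E) - ((\<Sum>H\<in>{H\<in>?V. k \<in> H}. hr_x 0 H) + hr_x 0 E) \<in> hr_ideal 0"
        using hr_sum 2 by (intro hr.diff_mem) auto
      then show ?thesis using 2 by (simp add: subst_diff subst_sum subst_Var)
    qed
  qed
  interpret chow_quotient E rk "ideal_gen ?R" 0 X
  proof unfold_locales
    show "1 \<le> rk E + 0" by (rule rk1)
    fix F G assume FG: "F \<in> pos_flats 0" "G \<in> pos_flats 0" "\<not> F \<subseteq> G" "\<not> G \<subseteq> F"
    then have "F \<subseteq> E" "G \<subseteq> E" using pos_flats_flat flat_subset by auto
    then have FV: "F \<in> ?V" "G \<in> ?V" using FG by (auto simp: V)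
    then have "X F = Var F" "X G = Var G" by (simp_all add: X_def V)
    moreover have "Var F * Var G \<in> ?R" unfolding uCH_rels_def using FV FG(3,4) by blast
    ultimately show "X F * X G \<in> ideal_gen ?R" by (simp add: ideal_gen_gen)
  next
    fix F i assume "F \<in> pos_flats 0" "i \<in> E" "i \<notin> F"
    then show "X F * (\<Sum>H\<in>{H\<in>pos_flats 0. i \<in> H}. X H) \<in> ideal_gen ?R" using lin by (intro mult_mem) auto
  next
    fix G assume G: "G \<in> pos_flats 0" "rk G + 0 = 1"
    then obtain i where i: "i \<in> E" "G = cl {i}" using flat_rk_1E pos_flats_flat by (metis add_0_right)
    then have "{H\<in>pos_flats 0. G \<subseteq> H} = {H\<in>pos_flats 0. i \<in> H}"
      using cl_singleton_subset_iff pos_flats_flat by blast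
    then show "(\<Sum>H\<in>{H\<in>pos_flats 0. G \<subseteq> H}. X H) \<in> ideal_gen ?R" using lin i by simp
  next
    show "X E ^ (rk E + 0 - 1) \<notin> ideal_gen ?R"
    proof (rule power_notin_ideal_gen[OF rk1 gens])
      have "- ((\<Sum>H\<in>{H\<in>?V. i0 \<in> H}. hr_x 0 H) + hr_x 0 E) \<in> hr_ideal 0"
        using hr_sum i0 by (intro hr.uminus_mem) auto
      then show "subst (hr_x 0) (X E) - Var E \<in> hr_ideal 0"
        by (simp add: X_def subst_uminus subst_sum subst_Var hr_E)
    qed
  qed simp
  show ?thesis unfolding uH_coeff_def
  proof (rule quot_dim_eq_card[OF refl])
    fix F assume "F \<in> P"
    then show "homog_in ?V 1 (X F)"
      by (auto simp: X_def V intro!: homog_in_uminus homog_in_sum homog_in_Var[unfolded One_nat_def])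
  next
    fix v assume v: "v \<in> ?V"
    have "(\<Sum>F\<in>P. Const (if F = v then 1 else 0) * X F) = (\<Sum>F\<in>P. if F = v then X F else 0)"
      by (intro sum.cong) (auto simp: Const_0 Const_1)
    also have "\<dots> = Var v" using v by (simp add: V X_def finite_pos_flats)
    finally show "\<exists>k. Var v - (\<Sum>F\<in>P. Const (k F) * X F) \<in> ideal_gen ?R"
      by (intro exI[of _ "\<lambda>F. if F = v then 1 else 0"]) (simp add: zero_mem)
  qed
qed

lemma H_coeff_eq_card: "H_coeff E rk j = card (fy_lists 1 None j)"
proof -
  let ?V = "L - {E}" and ?R = "CH_rels E rk"
  have finV: "finite ?V" using finite_flats by simp
  \<comment> \<open>Chosen so that the x_H sum to 0 over all flats; in the quotient y_i is then
    minus the sum over the flats containing \<open>i\<close>.\<close>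
  define X :: "'a set \<Rightarrow> ('a set + 'a) mpoly" where
    "X F = (if F = E then - (\<Sum>H\<in>?V. Var (Inl H)) else Var (Inl F))" for F
  interpret mideal "ideal_gen ?R" by (rule mideal_ideal_gen)
  have P: "pos_flats 1 = L" by (rule pos_flats_1)
  have rk1: "1 \<le> rk E + 1" by simp
  have XV: "(\<Sum>H\<in>{H\<in>?V. Q H}. X H) = (\<Sum>H\<in>{H\<in>?V. Q H}. Var (Inl H))" for Q
    by (intro sum.cong) (auto simp: X_def)
  have split: "(\<Sum>H\<in>A. f H) = (\<Sum>H\<in>{H\<in>A. i \<in> H}. f H) + (\<Sum>H\<in>{H\<in>A. i \<notin> H}. f H)"
    if "finite A" for A i and f :: "'a set \<Rightarrow> 'b::ab_group_add"
    using that by (subst sum.union_disjoint[symmetric]) (auto intro!: sum.cong)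
  have lin: "(\<Sum>H\<in>{H\<in>L. i \<in> H}. X H) + Var (Inr i) \<in> ideal_gen ?R" if "i \<in> E" for i
  proof -
    have "(\<Sum>H\<in>{H\<in>L. i \<in> H}. X H) = X E + (\<Sum>H\<in>{H\<in>?V. i \<in> H}. Var (Inl H))"
      using sum_pos_flats_split[OF ground_flat finite_flats, of X "\<lambda>H. i \<in> H"] that XV[of "\<lambda>H. i \<in> H"] by simp
    also have "\<dots> = - (\<Sum>H\<in>{H\<in>?V. i \<notin> H}. Var (Inl H))"
      using split[OF finV, of "\<lambda>H. Var (Inl H) :: ('a set + 'a) mpoly" i] by (simp add: X_def)
    finally have "(\<Sum>H\<in>{H\<in>L. i \<in> H}. X H) + Var (Inr i) = Var (Inr i) - (\<Sum>H\<in>{H\<in>?V. i \<notin> H}. Var (Inl H))" by simp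
    also have "\<dots> \<in> ideal_gen ?R" using that by (intro ideal_gen_gen) (auto simp: CH_rels_def)
    finally show ?thesis .
  qed
  \<comment> \<open>The image of y_i is dictated by its defining relation.\<close>
  define g where "g v = (case v of Inl F \<Rightarrow> hr_x 1 F | Inr i \<Rightarrow> \<Sum>H\<in>{H\<in>?V. i \<notin> H}. hr_x 1 H)" for v
  have g: "g (Inl F) = hr_x 1 F" "g (Inr i) = (\<Sum>H\<in>{H\<in>?V. i \<notin> H}. hr_x 1 H)" for F i
    by (simp_all add: g_def)
  interpret hr: mideal "hr_ideal 1" by (rule mideal_hr)
  have bot: "{} \<in> pos_flats 1" using empty_flat P by simp
  have hr_all: "(\<Sum>H\<in>L. hr_x 1 H) \<in> hr_ideal 1"
  proof -
    have "{H\<in>pos_flats 1. {} \<subseteq> H} = L" using P by auto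
    then have "(\<Sum>H\<in>L. hr_x 1 H) = Var {}" using sum_hr_x[OF bot] by simp
    then show ?thesis using hr_ideal_min[OF bot] by (simp add: rk_empty)
  qed
  have hr_E: "hr_x 1 E = Var E"
  proof -
    have "{H\<in>pos_flats 1. E \<subset> H} = {}" using pos_flats_flat flat_subset by blast
    then show ?thesis by (subst hr_x.simps) (simp only: sum.empty diff_zero)
  qed
  have hr_V: "(\<Sum>H\<in>L. hr_x 1 H) = hr_x 1 E + (\<Sum>H\<in>?V. hr_x 1 H)"
    by (rule sum.remove[OF finite_flats ground_flat])
  \<comment> \<open>All \<open>hr_x 1 H\<close> together give h of the empty flat, which is killed,
    so the image of y_i is congruent to -h_F for \<open>F = cl {i}\<close> and
    \<open>hr_x_atom\<close> applies.\<close>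
  have hr_y: "hr_x 1 F * (\<Sum>H\<in>{H\<in>?V. i \<notin> H}. hr_x 1 H) \<in> hr_ideal 1" if "F \<in> L" "i \<in> E" "i \<notin> F" for F i
  proof -
    have i: "cl {i} \<in> pos_flats 1" using rk_atom that P by simp
    have "{H\<in>pos_flats 1. cl {i} \<subseteq> H} = {H\<in>L. i \<in> H}"
      using cl_singleton_subset_iff that P by blast
    then have s: "(\<Sum>H\<in>{H\<in>L. i \<in> H}. hr_x 1 H) = Var (cl {i})" using sum_hr_x[OF i] by simp
    have "{H\<in>?V. i \<notin> H} = {H\<in>L. i \<notin> H}" using that by auto
    then have "(\<Sum>H\<in>{H\<in>?V. i \<notin> H}. hr_x 1 H) = (\<Sum>H\<in>L. hr_x 1 H) - Var (cl {i})"
      using split[OF finite_flats, of "hr_x 1" i] s by simp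
    then have "hr_x 1 F * (\<Sum>H\<in>{H\<in>?V. i \<notin> H}. hr_x 1 H) = hr_x 1 F * (\<Sum>H\<in>L. hr_x 1 H) - hr_x 1 F * Var (cl {i})"
      by (simp only: right_diff_distrib)
    also have "\<dots> \<in> hr_ideal 1" using that P by (intro hr.diff_mem hr.mult_mem[OF hr_all] hr_x_atom) auto
    finally show ?thesis .
  qed
  have gens: "subst g p \<in> hr_ideal 1" if p: "p \<in> ?R" for p
  proof -
    consider i where "i \<in> E" "p = Var (Inr i) - (\<Sum>H\<in>{H\<in>?V. i \<notin> H}. Var (Inl H))"
      | F G where "F \<in> ?V" "G \<in> ?V" "\<not> F \<subseteq> G" "\<not> G \<subseteq> F" "p = Var (Inl F) * Var (Inl G)"
      | i F where "i \<in> E" "F \<in> ?V" "i \<notin> F" "p = Var (Inr i) * Var (Inl F)"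
      using p unfolding CH_rels_def by blast
    then show ?thesis
    proof cases
      case 1
      then show ?thesis by (simp only: subst_diff subst_sum subst_Var g diff_self hr.zero_mem)
    next
      case 2
      then show ?thesis using hr_x_incomparable[of F 1 G] P by (simp only: subst_mult subst_Var g) blast
    next
      case 3
      then show ?thesis using hr_y[of F i] by (simp only: subst_mult subst_Var g mult.commute) blast
    qed
  qed
  interpret chow_quotient E rk "ideal_gen ?R" 1 X
  proof unfold_locales
    fix F G assume FG: "F \<in> pos_flats 1" "G \<in> pos_flats 1" "\<not> F \<subseteq> G" "\<not> G \<subseteq> F"
    then have "F \<subseteq> E" "G \<subseteq> E" using pos_flats_flat flat_subset by auto
    then have FV: "F \<in> ?V" "G \<in> ?V" using FG P by auto
    then have "X F = Var (Inl F)" "X G = Var (Inl G)" by (simp_all add: X_def)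
    moreover have "Var (Inl F) * Var (Inl G) \<in> ?R" unfolding CH_rels_def using FV FG(3,4) by blast
    ultimately show "X F * X G \<in> ideal_gen ?R" by (simp add: ideal_gen_gen)
  next
    fix F i assume F: "F \<in> pos_flats 1" and i: "i \<in> E" "i \<notin> F"
    then have FV: "F \<in> ?V" using P by auto
    \<comment> \<open>\<open>lin\<close> is multiplied by x_F, and the y_i it contains disappears
      through the relation between y_i and x_F.\<close>
    have "X F * ((\<Sum>H\<in>{H\<in>L. i \<in> H}. X H) + Var (Inr i)) - Var (Inr i) * Var (Inl F) \<in> ideal_gen ?R"
      using FV i by (intro diff_mem mult_mem[OF lin] ideal_gen_gen) (auto simp: CH_rels_def)
    moreover have "X F = Var (Inl F)" using FV by (simp add: X_def)
    ultimately show "X F * (\<Sum>H\<in>{H\<in>pos_flats 1. i \<in> H}. X H) \<in> ideal_gen ?R"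
      unfolding P by (simp add: distrib_left mult.commute)
  next
    fix G assume G: "G \<in> pos_flats 1" "rk G + 1 = 1"
    then have "G = {}" using flat_rk_0 P by auto
    then have "(\<Sum>H\<in>{H\<in>pos_flats 1. G \<subseteq> H}. X H) = (\<Sum>H\<in>L. X H)" using P by simp
    also have "\<dots> = X E + (\<Sum>H\<in>?V. X H)" by (rule sum.remove[OF finite_flats ground_flat])
    also have "(\<Sum>H\<in>?V. X H) = - X E" using XV[of "\<lambda>_. True"] by (simp add: X_def)
    finally show "(\<Sum>H\<in>{H\<in>pos_flats 1. G \<subseteq> H}. X H) \<in> ideal_gen ?R" by (simp add: zero_mem)
  next
    show "X E ^ (rk E + 1 - 1) \<notin> ideal_gen ?R"
    proof (rule power_notin_ideal_gen[OF rk1 gens])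
      have "subst g (X E) - Var E = - (\<Sum>H\<in>L. hr_x 1 H)"
        unfolding hr_V hr_E by (simp add: X_def subst_uminus subst_sum subst_Var g)
      then show "subst g (X E) - Var E \<in> hr_ideal 1" using hr.uminus_mem[OF hr_all] by simp
    qed
  qed simp_all
  show ?thesis unfolding H_coeff_def
  proof (rule quot_dim_eq_card[OF refl])
    fix F assume "F \<in> P"
    then have "F \<in> L" using P by simp
    then show "homog_in (CH_vars E rk) 1 (X F)"
      by (auto simp: X_def CH_vars_def intro!: homog_in_uminus homog_in_sum homog_in_Var[unfolded One_nat_def])
  next
    fix v assume v: "v \<in> CH_vars E rk"
    have ind: "(\<Sum>F\<in>P. Const (if F \<in> S then 1 else 0) * X F) = (\<Sum>F\<in>S. Var (Inl F))" if "S \<subseteq> ?V" for S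
    proof -
      have "(\<Sum>F\<in>P. Const (if F \<in> S then 1 else 0) * X F) = (\<Sum>F\<in>S. X F)"
        using that P finite_flats
        by (intro sum.mono_neutral_cong_right) (auto simp: Const_0 Const_1)
      also have "\<dots> = (\<Sum>F\<in>S. Var (Inl F))" using that by (intro sum.cong) (auto simp: X_def)
      finally show ?thesis .
    qed
    show "\<exists>k. Var v - (\<Sum>F\<in>P. Const (k F) * X F) \<in> ideal_gen ?R"
    proof (cases v)
      case (Inl F)
      then have "F \<in> ?V" using v by (auto simp: CH_vars_def)
      then show ?thesis using ind[of "{F}"] Inl zero_mem
        by (intro exI[of _ "\<lambda>H. if H \<in> {F} then 1 else 0"]) simp
    next
      case (Inr i)
      then have i: "i \<in> E" using v by (auto simp: CH_vars_def)
      let ?S = "{H\<in>?V. i \<notin> H}"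
      have "Var v - (\<Sum>F\<in>?S. Var (Inl F)) \<in> ?R" unfolding CH_rels_def Inr using i by blast
      moreover have "(\<Sum>F\<in>P. Const (if F \<in> ?S then 1 else 0) * X F) = (\<Sum>F\<in>?S. Var (Inl F))"
        by (rule ind) blast
      ultimately have "Var v - (\<Sum>F\<in>P. Const (if F \<in> ?S then 1 else 0) * X F) \<in> ideal_gen ?R"
        using ideal_gen_gen by simp
      then show ?thesis by (rule exI[of _ "\<lambda>F. if F \<in> ?S then 1 else 0"])
    qed
  qed
qed

end

theorem theorem3p25:
  fixes E :: "'a set" and rk :: "'a set \<Rightarrow> nat"
  assumes "matroid E rk" and "loopless E rk"
  shows "(\<exists>f :: int poly. (\<forall>j. coeff f j = int (uH_coeff E rk j)) \<and> gamma_positive f)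
       \<and> (\<exists>f :: int poly. (\<forall>j. coeff f j = int (H_coeff E rk j)) \<and> gamma_positive f)"
proof -
  interpret loopless_matroid E rk using assms by unfold_locales
  show ?thesis
    using coeff_fy_poly uH_coeff_eq_card H_coeff_eq_card gamma_positive_fy_poly_0 gamma_positive_fy_poly_1
    by metis
qed

end
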